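(* Let $\alpha\in\mathbb{T}=\mathbb{R}/\mathbb{Z}$ be irrational and let $A\subset\mathbb{T}$ be a countable $R_\alpha$-invariant subset containing $0$. Fix $m\in\mathbb{N}_{>0}$, let $A'\subset A$ be a set containing exactly one point from each $R_\alpha$-orbit in $A$ and such that $0\in A'$, and let $A'(m)=\{R_{m\alpha}^k(x):x\in A',\,k\in\mathbb{Z}\}$. Then there is a 2-AI factor between Denjoy systems $$(\mathcal{D}_{\alpha,A},F_{\alpha,A}^m)\to(\mathcal{D}_{m\alpha,A'(m)},F_{m\alpha,A'(m)}).$$ Hence the Sturmian system $(X_{m\alpha},\sigma_{m\alpha})$ is 2-AI equivalent to the system $(X_\alpha,\sigma_\alpha^m)$.
   Context: A system $(X,S)$ is a non-empty compact metric space with a homeomorphism; a factor map $\pi:(X,S)\to(Y,T)$ is a continuous surjection with $\pi S=T\pi$. Denjoy systems. $R_\alpha(t)=t+\alpha$ on $\mathbb{T}$. A Denjoy homeomorphism is an orientation-preserving homeomorphism $F$ of $\mathbb{T}$ with irrational rotation number $\alpha$ not conjugate to $R_\alpha$. There is a continuous surjection $H:\mathbb{T}\to\mathbb{T}$ with $HF=R_\alpha H$, unique up to post-composition with a rotation, and $F$ has a unique minimal set $\mathcal{D}_F$, a Cantor set. $H$ collapses the closure of each component of $\mathbb{T}\setminus\mathcal{D}_F$ to a point; the set $A$ of these points is countable and $R_\alpha$-invariant, and is well defined up to rotation. For each irrational $\alpha$ and countable $R_\alpha$-invariant $A\ni0$ there is such an $F$ with invariants $(\alpha,A)$, unique up to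 orientation-preserving conjugacy; it is denoted $F_{\alpha,A}$, and the Denjoy system is its restriction $(\mathcal{D}_{\alpha,A},F_{\alpha,A})$ to its minimal set. Sturmian systems. For irrational $\alpha\in\mathbb{T}$ (represented in $(0,1)$), define $x\in\{0,1\}^{\mathbb{Z}}$ by $x_n=0$ if $n\alpha\bmod1\in[0,1-\alpha)$ and $x_n=1$ otherwise. $X_\alpha$ is the closure of the shift orbit of $x$ and $\sigma_\alpha$ is the restriction of the shift. 2-AI factors. $\mathcal{G}_S=C(X,\mathbb{Z})/\{f-f\circ S\}$. A state is a homomorphism $\tau:\mathcal{G}_S\to\mathbb{R}$ with $\tau([1])=1$ and $\tau([f])\ge0$ for $f\ge0$; $\mathrm{Inf}_S$ is the intersection of the kernels of all states. Points $x,x'$ are asymptotic if $d(S^nx,S^nx')\to0$ as $n\to+\infty$ and $n\to-\infty$. A factor map $\pi:(X,S)\to(Y,T)$ is 2-asymptotic (2-A) if there is a countable $B\subset Y$ such that $|\pi^{-1}(y)|>1$ iff $y\in B$, and for $y\in B$ the fiber consists of exactly two points, which are asymptotic. Choosing a representative $y$ of each $T$-orbit in $B$ and an ordering $(x,x')$ of $\pi^{-1}(y)$, put $\mathcal{I}_y([f])=\sum_{n\in\mathbb{Z}}(f(S^nx)-f(S^nx'))$ and $\mathcal{I}=\bigoplus_y\mathcal{I}_y:\mathcal{G}_S\to\bigoplus_{B\bmod T}\mathbb{Z}$. A 2-A factor is infinitesimal (2-AI) if $\mathcal{I}(\mathcal{G}_S)/\mathcal{I}(\mathrm{Inf}_S)$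 is torsion. 2-AI equivalence is the equivalence relation on systems generated by: $(Y_1,T_1)\sim(Y_2,T_2)$ whenever some system has 2-AI factor maps onto both. *)

theory Defs
  imports
    "HOL-Analysis.Analysis"
    "HOL-Algebra.Coset"
    "HOL-Library.Groups_Big_Fun"
begin

section \<open>The circle\<close>

quotient_type circle = real / "\<lambda>x y::real. x - y \<in> \<int>"
  morphisms rep_circle to_circle
proof (rule equivpI)
  show "reflp (\<lambda>x y::real. x - y \<in> \<int>)" by (simp add: reflp_def)
  show "symp (\<lambda>x y::real. x - y \<in> \<int>)"
    by (rule sympI) (metis Ints_minus minus_diff_eq)
  show "transp (\<lambda>x y::real. x - y \<in> \<int>)"
  proof (rule transpI)
    fix x y z :: real
    assume "x - y \<in> \<int>" "y - z \<in> \<int>"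
    from Ints_add[OF this] show "x - z \<in> \<int>" by simp
  qed
qed

lemma frac_cong: "x - y \<in> \<int> \<Longrightarrow> frac x = frac (y::real)"
proof -
  assume "x - y \<in> \<int>"
  then obtain k where "x = y + of_int k" by (metis Ints_cases add.commute diff_add_cancel)
  then show ?thesis by (simp add: frac_def)
qed

text \<open>\<open>coord t\<close> is the representative of \<open>t\<close> in \<open>[0,1)\<close>.\<close>

lift_definition coord :: "circle \<Rightarrow> real" is frac
  by (rule frac_cong)

instantiation circle :: ab_group_add
begin
lift_definition zero_circle :: circle is 0 .
lift_definition plus_circle :: "circle \<Rightarrow> circle \<Rightarrow> circle" is "(+)"
  by (simp only: add_diff_add Ints_add)
lift_definition uminus_circle :: "circle \<Rightarrow> circle" is "uminus"
  by (simp only: minus_diff_minus Ints_minus)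
lift_definition minus_circle :: "circle \<Rightarrow> circle \<Rightarrow> circle" is "(-)"
proof -
  fix x x' y y' :: real
  assume "x - x' \<in> \<int>" "y - y' \<in> \<int>"
  then have "(x - x') - (y - y') \<in> \<int>" by (rule Ints_diff)
  then show "(x - y) - (x' - y') \<in> \<int>" by (simp add: algebra_simps)
qed
instance
  by standard (transfer; simp add: algebra_simps)+
end

lift_definition scale_circle :: "nat \<Rightarrow> circle \<Rightarrow> circle" is "\<lambda>m x. real m * x"
  by (simp only: right_diff_distrib[symmetric] Ints_mult Ints_of_nat)

instantiation circle :: metric_space
begin
text \<open>Arc length, i.e. the distance from \<open>x - y\<close> to the nearest integer.\<close>
lift_definition dist_circle :: "circle \<Rightarrow> circle \<Rightarrow> real"
  is "\<lambda>x y. min (frac (x - y)) (1 - frac (x - y))"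
proof -
  fix x x' y y' :: real
  assume "x - x' \<in> \<int>" "y - y' \<in> \<int>"
  then have "(x - x') - (y - y') \<in> \<int>" by (rule Ints_diff)
  then have "(x - y) - (x' - y') \<in> \<int>" by (simp add: algebra_simps)
  then show "min (frac (x - y)) (1 - frac (x - y)) = min (frac (x' - y')) (1 - frac (x' - y'))"
    using frac_cong by metis
qed
definition uniformity_circle :: "(circle \<times> circle) filter"
  where "uniformity_circle = (INF e\<in>{0<..}. principal {(x, y). dist x y < e})"
definition open_circle :: "circle set \<Rightarrow> bool"
  where "open_circle U \<longleftrightarrow> (\<forall>x\<in>U. eventually (\<lambda>(x', y). x' = x \<longrightarrow> y \<in> U) uniformity)"
instance
proof
  show "dist x y = 0 \<longleftrightarrow> x = y" for x y :: circle
  proof transfer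
    fix x y :: real
    have "frac (x - y) < 1" by (rule frac_lt_1)
    moreover have "0 \<le> frac (x - y)" by simp
    ultimately show "min (frac (x - y)) (1 - frac (x - y)) = 0 \<longleftrightarrow> x - y \<in> \<int>"
      by (auto simp: min_def frac_eq_0_iff[symmetric] simp del: frac_eq_0_iff)
  qed
  show "dist x y \<le> dist x z + dist y z" for x y z :: circle
  proof transfer
    fix x y z :: real
    have 1: "frac (x - y) = (if frac (y - z) \<le> frac (x - z) then frac (x - z) - frac (y - z)
              else frac (x - z) - frac (y - z) + 1)"
    proof -
      have "x - y - (frac (x - z) - frac (y - z)) \<in> \<int>"
        by (simp add: frac_def)
      then have 2: "frac (x - y) = frac (frac (x - z) - frac (y - z))" by (rule frac_cong)
      have 3: "frac (frac (x - z) - frac (y - z)) = frac (frac (x - z) - frac (y - z) + 1)"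
        by (rule frac_cong) simp
      show ?thesis
      proof (cases "frac (y - z) \<le> frac (x - z)")
        case True
        then have "frac (frac (x - z) - frac (y - z)) = frac (x - z) - frac (y - z)"
          using frac_lt_1[of "x - z"] frac_ge_0[of "y - z"] unfolding frac_eq by linarith
        with True show ?thesis unfolding 2 by simp
      next
        case False
        then have "frac (frac (x - z) - frac (y - z) + 1) = frac (x - z) - frac (y - z) + 1"
          using frac_lt_1[of "y - z"] frac_ge_0[of "x - z"] unfolding frac_eq by linarith
        with False show ?thesis unfolding 2 3 by simp
      qed
    qed
    show "min (frac (x - y)) (1 - frac (x - y)) \<le>
        min (frac (x - z)) (1 - frac (x - z)) + min (frac (y - z)) (1 - frac (y - z))"
      using frac_lt_1[of "x - z"] frac_lt_1[of "y - z"] frac_ge_0[of "x - z"] frac_ge_0[of "y - z"]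
      unfolding 1 min_def by argo
  qed
qed (simp_all add: uniformity_circle_def open_circle_def)
end

definition rotation :: "circle \<Rightarrow> circle \<Rightarrow> circle"
  where "rotation \<alpha> t = t + \<alpha>"

definition irrational :: "circle \<Rightarrow> bool"
  where "irrational \<alpha> \<longleftrightarrow> coord \<alpha> \<notin> \<rat>"


section \<open>Systems and factor maps\<close>

text \<open>A system is a carrier in a metric space together with a map of which only the
  restriction to the carrier matters.\<close>

definition system :: "'a::metric_space set \<Rightarrow> ('a \<Rightarrow> 'a) \<Rightarrow> bool"
  where "system X S \<longleftrightarrow> X \<noteq> {} \<and> compact X \<and> (\<exists>S'. homeomorphism X X S S')"

definition factor_map ::
  "'a::metric_space set \<Rightarrow> ('a \<Rightarrow> 'a) \<Rightarrow> 'b::metric_space set \<Rightarrow> ('b \<Rightarrow> 'b) \<Rightarrow> ('a \<Rightarrow> 'b) \<Rightarrow> bool"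
  where "factor_map X S Y T \<pi> \<longleftrightarrow> system X S \<and> system Y T \<and>
    continuous_on X \<pi> \<and> \<pi> ` X = Y \<and> (\<forall>x\<in>X. \<pi> (S x) = T (\<pi> x))"

definition conjugate ::
  "'a::metric_space set \<Rightarrow> ('a \<Rightarrow> 'a) \<Rightarrow> 'b::metric_space set \<Rightarrow> ('b \<Rightarrow> 'b) \<Rightarrow> bool"
  where "conjugate X S Y T \<longleftrightarrow> (\<exists>h h'. homeomorphism X Y h h' \<and> (\<forall>x\<in>X. h (S x) = T (h x)))"

text \<open>\<open>zpow X S n\<close> is \<open>S\<^sup>n\<close> for an integer \<open>n\<close>, where \<open>S\<close> is a bijection of \<open>X\<close>.\<close>

definition zpow :: "'a set \<Rightarrow> ('a \<Rightarrow> 'a) \<Rightarrow> int \<Rightarrow> 'a \<Rightarrow> 'a"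
  where "zpow X S n = (if n \<ge> 0 then S ^^ nat n else inv_into X S ^^ nat (- n))"

definition orbit :: "'a set \<Rightarrow> ('a \<Rightarrow> 'a) \<Rightarrow> 'a \<Rightarrow> 'a set"
  where "orbit X S x = {zpow X S k x | k. True}"

definition orbit_representatives :: "'a set \<Rightarrow> ('a \<Rightarrow> 'a) \<Rightarrow> 'a set \<Rightarrow> 'a set \<Rightarrow> bool"
  where "orbit_representatives X S B R \<longleftrightarrow> R \<subseteq> B \<and> (\<forall>y\<in>B. \<exists>!r. r \<in> R \<and> r \<in> orbit X S y)"

definition asymptotic :: "'a::metric_space set \<Rightarrow> ('a \<Rightarrow> 'a) \<Rightarrow> 'a \<Rightarrow> 'a \<Rightarrow> bool"
  where "asymptotic X S x x' \<longleftrightarrow>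
    ((\<lambda>n. dist (zpow X S n x) (zpow X S n x')) \<longlongrightarrow> 0) at_top \<and>
    ((\<lambda>n. dist (zpow X S n x) (zpow X S n x')) \<longlongrightarrow> 0) at_bot"


section \<open>The coinvariant group\<close>

text \<open>Functions on \<open>X\<close> are extended by \<open>0\<close> to the ambient type, so that equality of group
  elements is equality on \<open>X\<close>.\<close>

definition extend0 :: "'a set \<Rightarrow> ('a \<Rightarrow> int) \<Rightarrow> 'a \<Rightarrow> int"
  where "extend0 X f = (\<lambda>x. if x \<in> X then f x else 0)"

definition CZ :: "'a::metric_space set \<Rightarrow> ('a \<Rightarrow> int) monoid"
  where "CZ X = \<lparr>carrier = {f. continuous_on X f \<and> (\<forall>x. x \<notin> X \<longrightarrow> f x = 0)},
    monoid.mult = (\<lambda>f g x. f x + g x), one = (\<lambda>_. 0)\<rparr>"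

definition coboundaries :: "'a::metric_space set \<Rightarrow> ('a \<Rightarrow> 'a) \<Rightarrow> ('a \<Rightarrow> int) set"
  where "coboundaries X S = {extend0 X (\<lambda>x. f x - f (S x)) | f. f \<in> carrier (CZ X)}"

definition coinvariants :: "'a::metric_space set \<Rightarrow> ('a \<Rightarrow> 'a) \<Rightarrow> ('a \<Rightarrow> int) set monoid"
  where "coinvariants X S = CZ X Mod coboundaries X S"

definition cls :: "'a::metric_space set \<Rightarrow> ('a \<Rightarrow> 'a) \<Rightarrow> ('a \<Rightarrow> int) \<Rightarrow> ('a \<Rightarrow> int) set"
  where "cls X S f = coboundaries X S #>\<^bsub>CZ X\<^esub> f"

definition real_group :: "real monoid"
  where "real_group = \<lparr>carrier = UNIV, monoid.mult = (+), one = 0\<rparr>"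

definition state :: "'a::metric_space set \<Rightarrow> ('a \<Rightarrow> 'a) \<Rightarrow> (('a \<Rightarrow> int) set \<Rightarrow> real) \<Rightarrow> bool"
  where "state X S \<tau> \<longleftrightarrow> \<tau> \<in> hom (coinvariants X S) real_group \<and>
    \<tau> (cls X S (extend0 X (\<lambda>_. 1))) = 1 \<and>
    (\<forall>f\<in>carrier (CZ X). (\<forall>x\<in>X. f x \<ge> 0) \<longrightarrow> \<tau> (cls X S f) \<ge> 0)"

definition Inf_subgroup :: "'a::metric_space set \<Rightarrow> ('a \<Rightarrow> 'a) \<Rightarrow> ('a \<Rightarrow> int) set set"
  where "Inf_subgroup X S =
    {c \<in> carrier (coinvariants X S). \<forall>\<tau>. state X S \<tau> \<longrightarrow> \<tau> c = 0}"


section \<open>2-AI factors\<close>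

definition nontrivial_fibres :: "'a set \<Rightarrow> 'b set \<Rightarrow> ('a \<Rightarrow> 'b) \<Rightarrow> 'b set"
  where "nontrivial_fibres X Y \<pi> = {y \<in> Y. \<exists>x\<in>X. \<exists>x'\<in>X. x \<noteq> x' \<and> \<pi> x = y \<and> \<pi> x' = y}"

definition two_A_factor ::
  "'a::metric_space set \<Rightarrow> ('a \<Rightarrow> 'a) \<Rightarrow> 'b::metric_space set \<Rightarrow> ('b \<Rightarrow> 'b) \<Rightarrow> ('a \<Rightarrow> 'b) \<Rightarrow> bool"
  where "two_A_factor X S Y T \<pi> \<longleftrightarrow> factor_map X S Y T \<pi> \<and>
    countable (nontrivial_fibres X Y \<pi>) \<and>
    (\<forall>y\<in>nontrivial_fibres X Y \<pi>.
      \<exists>x x'. x \<noteq> x' \<and> {z \<in> X. \<pi> z = y} = {x, x'} \<and> asymptotic X S x x')"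

text \<open>\<open>R\<close> is the set of chosen orbit representatives and \<open>(p y, q y)\<close> the chosen ordering of the
  fibre over \<open>y\<close>. The sum over \<open>\<int>\<close> is \<^const>\<open>Sum_any\<close>: by asymptoticity only finitely many terms
  are nonzero. It takes the same value on all functions in a coset, and \<^const>\<open>the_elem\<close>
  extracts that value.\<close>

definition index_map ::
  "'a::metric_space set \<Rightarrow> ('a \<Rightarrow> 'a) \<Rightarrow> 'b set \<Rightarrow> ('b \<Rightarrow> 'a) \<Rightarrow> ('b \<Rightarrow> 'a) \<Rightarrow>
    ('a \<Rightarrow> int) set \<Rightarrow> 'b \<Rightarrow> int"
  where "index_map X S R p q c = (\<lambda>y. if y \<in> R
    then the_elem ((\<lambda>f. Sum_any (\<lambda>n. f (zpow X S n (p y)) - f (zpow X S n (q y)))) ` c)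
    else 0)"

text \<open>The second conjunct says that the index map takes values in the direct sum (rather than the
  product) of copies of \<open>\<int>\<close>; the third, that the quotient of the image of the whole group by
  that of the infinitesimals is torsion.\<close>

definition infinitesimal_for ::
  "'a::metric_space set \<Rightarrow> ('a \<Rightarrow> 'a) \<Rightarrow> 'b set \<Rightarrow> ('b \<Rightarrow> 'a) \<Rightarrow> ('b \<Rightarrow> 'a) \<Rightarrow> bool"
  where "infinitesimal_for X S R p q \<longleftrightarrow>
    (let \<I> = index_map X S R p q in
      (\<forall>c\<in>carrier (coinvariants X S). finite {y. \<I> c y \<noteq> 0}) \<and>
      (\<forall>u\<in>\<I> ` carrier (coinvariants X S). \<exists>n>0. (\<lambda>y. int n * u y) \<in> \<I> ` Inf_subgroup X S))"

text \<open>The condition does not depend on the choices: another representative shifts the summation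
  index, and exchanging the two points changes a sign.\<close>

definition two_AI_factor ::
  "'a::metric_space set \<Rightarrow> ('a \<Rightarrow> 'a) \<Rightarrow> 'b::metric_space set \<Rightarrow> ('b \<Rightarrow> 'b) \<Rightarrow> ('a \<Rightarrow> 'b) \<Rightarrow> bool"
  where "two_AI_factor X S Y T \<pi> \<longleftrightarrow> two_A_factor X S Y T \<pi> \<and>
    (\<forall>R p q. orbit_representatives Y T (nontrivial_fibres X Y \<pi>) R \<and>
        (\<forall>y\<in>R. p y \<noteq> q y \<and> {z \<in> X. \<pi> z = y} = {p y, q y})
      \<longrightarrow> infinitesimal_for X S R p q)"

text \<open>The equivalence relation ranges over all systems. Since HOL cannot quantify over types, the
  systems in a chain of elementary steps are taken in \<open>\<real>\<^sup>\<int>\<close> with the product topology. By the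
  following lemma every system is conjugate to one of these, and conjugate systems are 2-AI
  equivalent, a conjugacy being a 2-AI factor map with \<open>B = {}\<close>.\<close>

lemma conjugate_to_universal:
  fixes X :: "'a::metric_space set"
  assumes "system X S"
  obtains Y :: "(int \<Rightarrow> real) set" and T where "system Y T" "conjugate X S Y T"
proof -
  have X: "X \<noteq> {}" "compact X" using assms by (auto simp: system_def)
  obtain S' where S': "homeomorphism X X S S'" using assms by (auto simp: system_def)
  have "\<forall>n::nat. \<exists>k. finite k \<and> k \<subseteq> X \<and> X \<subseteq> (\<Union>x\<in>k. ball x (1 / real (Suc n)))"
    using X(2) seq_compact_imp_totally_bounded[of X]
    by (simp add: compact_eq_seq_compact_metric)
  then obtain K where K: "\<And>n. finite (K n)" "\<And>n. K n \<subseteq> X"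
    "\<And>n. X \<subseteq> (\<Union>x\<in>K n. ball x (1 / real (Suc n)))"
    by metis
  define D where "D = (\<Union>n. K n)"
  have D: "countable D" "D \<subseteq> X" using K by (auto simp: D_def countable_finite)
  have "D \<noteq> {}" using K(3)[of 0] X(1) by (fastforce simp: D_def)
  define h :: "'a \<Rightarrow> int \<Rightarrow> real" where "h = (\<lambda>x n. dist x (from_nat_into D (nat n)))"
  have cont: "continuous_on X h"
    unfolding h_def by (intro continuous_on_coordinatewise_then_product continuous_intros)
  have inj: "inj_on h X"
  proof (rule inj_onI, rule ccontr)
    fix x y assume xy: "x \<in> X" "y \<in> X" "h x = h y" "x \<noteq> y"
    then obtain n where n: "1 / real (Suc n) < dist x y / 2"
      by (metis half_gt_zero nat_approx_posE zero_less_dist_iff)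
    obtain d where d: "d \<in> K n" "dist d x < 1 / real (Suc n)"
      using K(3)[of n] xy(1) by auto
    then have "d \<in> D" by (auto simp: D_def)
    then obtain k where k: "from_nat_into D k = d"
      using D(1) from_nat_into_surj by metis
    have "h x (int k) = h y (int k)" using xy(3) by simp
    then have "dist x d = dist y d" by (simp add: h_def k)
    then have "dist x y \<le> dist x d + dist x d" by (metis dist_triangle2)
    then show False using d(2) n by (simp add: dist_commute)
  qed
  obtain h' where h': "homeomorphism X (h ` X) h h'"
    using homeomorphism_compact[OF X(2) cont refl inj] by blast
  define T where "T = h \<circ> S \<circ> h'"
  have "homeomorphism (h ` X) (h ` X) T (h \<circ> (S' \<circ> h'))"
    unfolding T_def comp_assoc
    using homeomorphism_compose[OF homeomorphism_compose[OF homeomorphism_symD[OF h'] S'] h']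
    by (simp add: comp_assoc)
  then have "system (h ` X) T"
    using X cont by (auto simp: system_def compact_continuous_image)
  moreover have "conjugate X S (h ` X) T"
    using h' S' unfolding conjugate_def T_def
    by (metis comp_apply homeomorphism_apply1)
  ultimately show ?thesis by (rule that)
qed

type_synonym universal_system = "(int \<Rightarrow> real) set \<times> ((int \<Rightarrow> real) \<Rightarrow> int \<Rightarrow> real)"

definition common_two_AI_extension :: "universal_system \<Rightarrow> universal_system \<Rightarrow> bool"
  where "common_two_AI_extension Y1 Y2 \<longleftrightarrow>
    (\<exists>(X :: (int \<Rightarrow> real) set) S \<pi>1 \<pi>2.
      two_AI_factor X S (fst Y1) (snd Y1) \<pi>1 \<and> two_AI_factor X S (fst Y2) (snd Y2) \<pi>2)"

definition two_AI_equivalent :: "universal_system \<Rightarrow> universal_system \<Rightarrow> bool"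
  where "two_AI_equivalent = equivclp common_two_AI_extension"


section \<open>Denjoy systems\<close>

definition is_lift :: "(real \<Rightarrow> real) \<Rightarrow> (circle \<Rightarrow> circle) \<Rightarrow> bool"
  where "is_lift f F \<longleftrightarrow> continuous_on UNIV f \<and> (\<forall>x. to_circle (f x) = F (to_circle x))"

definition orientation_preserving_homeo :: "(circle \<Rightarrow> circle) \<Rightarrow> bool"
  where "orientation_preserving_homeo F \<longleftrightarrow>
    (\<exists>F'. homeomorphism UNIV UNIV F F') \<and> (\<exists>f. is_lift f F \<and> strict_mono f)"

definition has_rotation_number :: "(circle \<Rightarrow> circle) \<Rightarrow> circle \<Rightarrow> bool"
  where "has_rotation_number F \<alpha> \<longleftrightarrow>
    (\<exists>f r. is_lift f F \<and> (\<forall>x. (\<lambda>n. (f ^^ n) x / real n) \<longlonglongrightarrow> r) \<and> to_circle r = \<alpha>)"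

definition denjoy_homeo :: "circle \<Rightarrow> (circle \<Rightarrow> circle) \<Rightarrow> bool"
  where "denjoy_homeo \<alpha> F \<longleftrightarrow> orientation_preserving_homeo F \<and> has_rotation_number F \<alpha> \<and>
    irrational \<alpha> \<and> \<not> conjugate UNIV F UNIV (rotation \<alpha>)"

definition minimal_set :: "('a::topological_space \<Rightarrow> 'a) \<Rightarrow> 'a set \<Rightarrow> bool"
  where "minimal_set F M \<longleftrightarrow> M \<noteq> {} \<and> closed M \<and> F ` M = M \<and>
    (\<forall>N. N \<subseteq> M \<and> N \<noteq> {} \<and> closed N \<and> F ` N = N \<longrightarrow> N = M)"

text \<open>\<open>denjoy_system \<alpha> A D F\<close>: \<open>F\<close> is a Denjoy homeomorphism with invariants \<open>(\<alpha>, A)\<close> and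
  \<open>D\<close> is its minimal set. As \<open>H\<close> is only unique up to a rotation, \<open>A\<close> is the set of collapsed
  points for some choice of \<open>H\<close>.\<close>

definition denjoy_system :: "circle \<Rightarrow> circle set \<Rightarrow> circle set \<Rightarrow> (circle \<Rightarrow> circle) \<Rightarrow> bool"
  where "denjoy_system \<alpha> A D F \<longleftrightarrow> denjoy_homeo \<alpha> F \<and> minimal_set F D \<and>
    (\<exists>H. continuous_on UNIV H \<and> surj H \<and> H \<circ> F = rotation \<alpha> \<circ> H \<and>
      A = {a. \<exists>C\<in>components (- D). H ` closure C = {a}})"


section \<open>Sturmian systems\<close>

definition shift :: "(int \<Rightarrow> real) \<Rightarrow> int \<Rightarrow> real"
  where "shift x = (\<lambda>n. x (n + 1))"

definition sturmian_point :: "circle \<Rightarrow> int \<Rightarrow> real"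
  where "sturmian_point \<alpha> = (\<lambda>n. if frac (of_int n * coord \<alpha>) \<in> {0..<1 - coord \<alpha>} then 0 else 1)"

definition sturmian_space :: "circle \<Rightarrow> (int \<Rightarrow> real) set"
  where "sturmian_space \<alpha> = closure (orbit UNIV shift (sturmian_point \<alpha>))"

end

theory Submission
  imports Defs
begin

text \<open>Both a Denjoy system with invariants \<open>(\<alpha>, A)\<close> and a Sturmian system are the circle, rotated by
  \<open>\<alpha>\<close>, with each point of \<open>A\<close> split into two. The topology is recorded by a semiconjugacy \<open>H\<close>
  to the rotation together with continuous functions \<open>c t\<close>, for \<open>t \<in> A\<close>, with values in \<open>[0,1]\<close> that lift
  \<open>H - t\<close> and take the values \<open>0\<close> and \<open>1\<close> on the two points over \<open>t\<close>. If \<open>A' \<subseteq> A\<close>, gluing the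
  pairs over \<open>A - A'\<close> gives a factor map, which is continuous because all these functions are.

  The indicator of the arc from \<open>s\<close> to \<open>b\<close> is \<open>frac (b - s) - c s + c b\<close>. If \<open>b\<close> lies on the
  orbit of \<open>s\<close>, the difference \<open>c b - c s\<close> is a bounded coboundary, so every state maps the
  indicator to the length of the arc; for other \<open>b\<close> this follows by sandwiching. Hence, if
  \<open>m (b - s)\<close> is a multiple of the angle, then \<open>m\<close> times the indicator, minus a multiple of that of the
  arc from \<open>s\<close> to its successor, minus a constant, is infinitesimal. For \<open>s \<in> A'\<close> its index is
  \<open>\<plusminus>m\<close> on the orbit of \<open>b\<close> and \<open>0\<close> on all others.\<close>

section \<open>The circle\<close>

text \<open>The compensating arcs end at \<open>s\<close> and its successor, both in
  \<open>A'\<close>. These points stay split in the factor, so the arcs are invisible to the index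
  map, which sees only the fibres over \<open>A - A'\<close>. In the Denjoy case the obstacle is
  that the definition supplies merely some continuous semiconjugacy: neither its degree nor its
  monotonicity is given. Recurrence in the minimal set and the rotation number yield both. The
  circle is then cut at a point inside a gap. The cut coordinate is continuous on the minimal set
  because its jump is in the gap, and the two ends of the gap receive the values 0 and 1. In the
  Sturmian case a 0-1 sequence shows no coordinate at all. It is regarded as the sequence of
  increments of positions in \<open>[0,1]\<close> along an orbit; density of the orbit determines
  the positions from the increments. Asymptoticity and the finiteness of all index sums come from
  compactness: only finitely many fibres have diameter above a given bound.\<close>

lemma to_circle_eq_iff: "to_circle x = to_circle y \<longleftrightarrow> x - y \<in> \<int>"
  by (rule circle.abs_eq_iff)

lemma coord_to_circle [simp]: "coord (to_circle x) = frac x"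
  by (rule coord.abs_eq)

lemma to_circle_frac [simp]: "to_circle (frac x) = to_circle x"
  by (simp add: to_circle_eq_iff frac_def)

lemma to_circle_coord [simp]: "to_circle (coord t) = t"
  by transfer (simp add: frac_def)

lemma coord_bounds: "0 \<le> coord t" "coord t < 1"
  by (transfer; simp add: frac_lt_1)+

lemma to_circle_add: "to_circle (x + y) = to_circle x + to_circle y"
  by (simp add: plus_circle.abs_eq)

lemma to_circle_diff: "to_circle (x - y) = to_circle x - to_circle y"
  by (simp add: minus_circle.abs_eq)

lemma to_circle_minus: "to_circle (- x) = - to_circle x"
  by (simp add: uminus_circle.abs_eq)

lemma to_circle_0: "to_circle 0 = 0"
  by (simp add: zero_circle_def)

lemma to_circle_eq_0_iff: "to_circle x = 0 \<longleftrightarrow> x \<in> \<int>"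
  using to_circle_eq_iff[of x 0] by (simp add: to_circle_0)

lemma to_circle_of_int [simp]: "to_circle (of_int k) = 0"
  by (simp add: to_circle_eq_0_iff)

lemma scale_circle_to_circle: "scale_circle m (to_circle x) = to_circle (real m * x)"
  by (rule scale_circle.abs_eq)

lemma coord_eq_0_iff: "coord t = 0 \<longleftrightarrow> t = 0"
proof
  assume "coord t = 0"
  then show "t = 0" using to_circle_coord[of t] by (simp add: to_circle_0)
next
  assume "t = 0"
  then show "coord t = 0" using coord_to_circle[of 0] by (simp add: to_circle_0)
qed

lemma dist_to_circle_le: "dist (to_circle x) (to_circle y) \<le> \<bar>x - y\<bar>"
proof -
  have "dist (to_circle x) (to_circle y) = min (frac (x - y)) (1 - frac (x - y))"
    by (rule dist_circle.abs_eq)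
  also have "\<dots> \<le> \<bar>x - y\<bar>"
  proof (cases "x \<ge> y")
    case True
    then have "frac (x - y) \<le> x - y" by (simp add: frac_def)
    then show ?thesis using True by linarith
  next
    case False
    then have "\<lfloor>x - y\<rfloor> \<le> -1" by linarith
    then have "1 - frac (x - y) \<le> y - x" unfolding frac_def by linarith
    then show ?thesis using False by linarith
  qed
  finally show ?thesis .
qed

text \<open>Rounding \<open>x - y\<close> down or up gives the two candidate lifts of
  \<open>t\<close>; the nearer one realises the arc length. This turns estimates on the circle into
  estimates between real numbers.\<close>

lemma dist_to_circleE:
  obtains y' where "to_circle y' = t" "\<bar>x - y'\<bar> = dist (to_circle x) t"
proof -
  define y where "y = coord t"
  have t: "t = to_circle y" by (simp add: y_def)
  have d: "dist (to_circle x) (to_circle y) = min (frac (x - y)) (1 - frac (x - y))"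
    by (rule dist_circle.abs_eq)
  have "\<bar>x - (y + of_int \<lfloor>x - y\<rfloor>)\<bar> = frac (x - y)"
    "\<bar>x - (y + of_int (\<lfloor>x - y\<rfloor> + 1))\<bar> = 1 - frac (x - y)"
    unfolding frac_def by (simp_all, linarith+)
  then have "\<bar>x - (y + of_int \<lfloor>x - y\<rfloor>)\<bar> = dist (to_circle x) t
      \<or> \<bar>x - (y + of_int (\<lfloor>x - y\<rfloor> + 1))\<bar> = dist (to_circle x) t"
    unfolding t d by linarith
  moreover have "to_circle (y + of_int k) = t" for k
    by (simp add: t to_circle_eq_iff)
  ultimately show ?thesis using that by blast
qed

lemma continuous_on_to_circle: "continuous_on S to_circle"
proof -
  have "1-lipschitz_on S to_circle"
    by (rule lipschitz_onI) (use dist_to_circle_le in \<open>auto simp: dist_real_def\<close>)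
  then show ?thesis by (rule lipschitz_on_continuous_on)
qed

lemma continuous_on_to_circle_o [continuous_intros]:
  "continuous_on S f \<Longrightarrow> continuous_on S (\<lambda>x. to_circle (f x))"
  by (rule continuous_on_compose2[OF continuous_on_to_circle[of UNIV]]) auto

lemma surj_to_circle: "surj to_circle"
  by (rule surjI[of _ coord]) simp

lemma compact_UNIV_circle: "compact (UNIV :: circle set)"
proof -
  have "to_circle ` {0..1} = UNIV"
  proof -
    have "t \<in> to_circle ` {0..1}" for t
      by (rule image_eqI[of _ _ "coord t"]) (use coord_bounds[of t] in auto)
    then show ?thesis by blast
  qed
  moreover have "compact (to_circle ` {0..1})"
    by (intro compact_continuous_image continuous_on_to_circle compact_Icc)
  ultimately show ?thesis by simp
qed

lemma dist_circle_translate: "dist (s + u) (t + u) = dist s (t :: circle)"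
  by transfer simp

lemma tendsto_add_circle:
  fixes f g :: "'a \<Rightarrow> circle"
  assumes "(f \<longlongrightarrow> s) F" "(g \<longlongrightarrow> t) F"
  shows "((\<lambda>x. f x + g x) \<longlongrightarrow> s + t) F"
proof -
  have "dist (f x + g x) (s + t) \<le> dist (f x) s + dist (g x) t" for x
  proof -
    have "dist (f x + g x) (s + t) \<le> dist (f x + g x) (s + g x) + dist (s + g x) (s + t)"
      by (rule dist_triangle)
    also have "dist (s + g x) (s + t) = dist (g x) t"
      by (metis add.commute dist_circle_translate)
    finally show ?thesis by (simp add: dist_circle_translate)
  qed
  then have "\<forall>\<^sub>F x in F. norm (dist (f x + g x) (s + t)) \<le> dist (f x) s + dist (g x) t"
    by simp
  moreover have "((\<lambda>x. dist (f x) s + dist (g x) t) \<longlongrightarrow> 0) F"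
    using tendsto_add[OF assms[THEN tendsto_dist_iff[THEN iffD1]]] by simp
  ultimately show ?thesis
    unfolding tendsto_dist_iff[of _ "s + t"] by (rule Lim_null_comparison)
qed

lemma continuous_on_add_circle [continuous_intros]:
  fixes f g :: "'a::topological_space \<Rightarrow> circle"
  shows "continuous_on S f \<Longrightarrow> continuous_on S g \<Longrightarrow> continuous_on S (\<lambda>x. f x + g x)"
  unfolding continuous_on_def by (auto intro: tendsto_add_circle)

lemma continuous_on_diff_circle [continuous_intros]:
  fixes f :: "'a::topological_space \<Rightarrow> circle"
  shows "continuous_on S f \<Longrightarrow> continuous_on S (\<lambda>x. f x - t)"
  using continuous_on_add_circle[of S f "\<lambda>_. - t"] by simp

lemma coord_eqI: "to_circle x = t \<Longrightarrow> 0 \<le> x \<Longrightarrow> x < 1 \<Longrightarrow> coord t = x"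
  using coord_to_circle frac_eq by metis

lemma continuous_at_coord:
  assumes "t \<noteq> 0"
  shows "isCont coord t"
proof -
  define y where "y = coord t"
  have y: "0 < y" "y < 1" "t = to_circle y"
    using coord_bounds[of t] coord_eq_0_iff[of t] assms by (auto simp: y_def)
  show ?thesis
    unfolding continuous_at_eps_delta
  proof (intro allI impI)
    fix e :: real assume e: "e > 0"
    show "\<exists>d>0. \<forall>s. dist s t < d \<longrightarrow> dist (coord s) (coord t) < e"
    \<comment> \<open>The bounds \<open>y\<close> and \<open>1 - y\<close> keep the nearby lift of
      \<open>s\<close> inside the open unit interval, where it equals
      \<open>coord s\<close>.\<close>
    proof (intro exI[of _ "min e (min y (1 - y))"] conjI allI impI)
      fix s assume s: "dist s t < min e (min y (1 - y))"
      obtain x where x: "to_circle x = s" "\<bar>y - x\<bar> = dist (to_circle y) s"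
        by (rule dist_to_circleE)
      have "\<bar>y - x\<bar> < min e (min y (1 - y))" using s x y(3) by (simp add: dist_commute)
      moreover from this have "coord s = x" using x(1) y by (intro coord_eqI) auto
      ultimately show "dist (coord s) (coord t) < e"
        by (simp add: dist_real_def y_def[symmetric] abs_minus_commute)
    qed (use e y in auto)
  qed
qed

lemma irrational_rep:
  assumes "irrational (to_circle x)"
  shows "x \<notin> \<rat>"
  using assms by (auto simp: irrational_def frac_def)

lemma irrational_mult_Ints:
  fixes a :: real
  assumes "a \<notin> \<rat>" "of_int n * a \<in> \<int>"
  shows "n = 0"
proof (rule ccontr)
  assume "n \<noteq> 0"
  then have "a = (of_int n * a) / of_int n" by simp
  then show False using assms by (metis Ints_subset_Rats Rats_divide Rats_of_int subsetD)
qed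

lemma of_int_mult_irrational_inj:
  fixes a :: real
  assumes "a \<notin> \<rat>" "t + to_circle (of_int n * a) = t + to_circle (of_int k * a)"
  shows "n = k"
proof -
  have "of_int n * a - of_int k * a \<in> \<int>"
    using assms(2) by (simp add: to_circle_eq_iff)
  then have "of_int (n - k) * a \<in> \<int>" by (simp add: left_diff_distrib)
  from irrational_mult_Ints[OF assms(1) this] show ?thesis by simp
qed

text \<open>Supplies the orbit arcs slightly shorter and slightly longer than a given arc for the
  sandwich in \<open>state_arc\<close>.\<close>

lemma Kronecker_between:
  fixes a :: real
  assumes "a \<notin> \<rat>" "0 \<le> x" "x < y" "y \<le> 1"
  obtains k :: nat where "k > 0" "x < frac (real k * a)" "frac (real k * a) < y"
proof -
  obtain k :: nat where "k > 0" "\<bar>frac (real k * a) - (x + y) / 2\<bar> < (y - x) / 2"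
    by (rule Kronecker_approx_1_explicit[OF assms(1), of "(x + y) / 2" "(y - x) / 2"])
      (use assms in auto)
  then show ?thesis by (intro that) (auto simp: abs_less_iff field_simps)
qed

lemma rotation_orbit_dense:
  fixes a :: real
  assumes "a \<notin> \<rat>"
  shows "closure (range (\<lambda>k::nat. s + to_circle (real k * a))) = UNIV"
proof -
  have "t \<in> closure (range (\<lambda>k::nat. s + to_circle (real k * a)))" for t
    unfolding closure_approachable
  proof (intro allI impI)
    fix e :: real assume e: "e > 0"
    define y where "y = coord (t - s)"
    obtain k :: nat where k: "\<bar>frac (real k * a) - y\<bar> < e"
      by (rule Kronecker_approx_1_explicit[OF assms, of y e])
        (use e coord_bounds[of "t - s"] in \<open>auto simp: y_def\<close>)
    have "dist (s + to_circle (real k * a)) t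
        = dist (to_circle (real k * a) + s) ((t - s) + s)" by (simp add: add.commute)
    also have "\<dots> = dist (to_circle (frac (real k * a))) (to_circle y)"
      by (simp only: dist_circle_translate to_circle_frac y_def to_circle_coord)
    also have "\<dots> \<le> \<bar>frac (real k * a) - y\<bar>" by (rule dist_to_circle_le)
    finally show "\<exists>z\<in>range (\<lambda>k::nat. s + to_circle (real k * a)). dist z t < e"
      using k by (blast intro: le_less_trans)
  qed
  then show ?thesis by auto
qed

lemma rotation_power: "(rotation (to_circle (a::real)) ^^ n) t = t + to_circle (real n * a)"
  by (induction n) (auto simp: rotation_def to_circle_0 to_circle_add algebra_simps)

lemma inv_rotation: "inv_into UNIV (rotation \<alpha>) = rotation (- \<alpha>)"
  by (rule inv_equality) (auto simp: rotation_def)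

lemma zpow_rotation: "zpow UNIV (rotation (to_circle (a::real))) k t = t + to_circle (of_int k * a)"
proof (cases "k \<ge> 0")
  case True
  then show ?thesis by (simp add: zpow_def rotation_power)
next
  case False
  then show ?thesis
    using rotation_power[where a = "- a" and n = "nat (- k)" and t = t]
    by (simp add: zpow_def inv_rotation to_circle_minus)
qed

section \<open>Coinvariants and states\<close>

lemma CZ_simps [simp]:
  "carrier (CZ X) = {f. continuous_on X f \<and> (\<forall>x. x \<notin> X \<longrightarrow> f x = 0)}"
  "f \<otimes>\<^bsub>CZ X\<^esub> g = (\<lambda>x. f x + g x)"
  "\<one>\<^bsub>CZ X\<^esub> = (\<lambda>_. 0)"
  by (simp_all add: CZ_def)

lemma real_group_simps [simp]: "x \<otimes>\<^bsub>real_group\<^esub> y = x + y" "carrier real_group = UNIV"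
  by (simp_all add: real_group_def)

lemma continuous_on_uminus_int [continuous_intros]:
  fixes f :: "'a::topological_space \<Rightarrow> int"
  shows "continuous_on X f \<Longrightarrow> continuous_on X (\<lambda>x. - f x)"
  unfolding continuous_on_def tendsto_discrete by (auto elim: eventually_mono)

lemma continuous_on_diff_int [continuous_intros]:
  fixes f g :: "'a::topological_space \<Rightarrow> int"
  shows "continuous_on X f \<Longrightarrow> continuous_on X g \<Longrightarrow> continuous_on X (\<lambda>x. f x - g x)"
  using continuous_on_add[OF _ continuous_on_uminus_int, of X f g] by simp

lemma comm_group_CZ: "comm_group (CZ X)"
proof (rule comm_groupI)
  fix f assume f: "f \<in> carrier (CZ X)"
  show "\<exists>g\<in>carrier (CZ X). g \<otimes>\<^bsub>CZ X\<^esub> f = \<one>\<^bsub>CZ X\<^esub>"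
    by (rule bexI[of _ "\<lambda>x. - f x"]) (use f in \<open>auto intro!: continuous_intros\<close>)
qed (auto intro!: continuous_intros)

lemma inv_CZ: "f \<in> carrier (CZ X) \<Longrightarrow> inv\<^bsub>CZ X\<^esub> f = (\<lambda>x. - f x)"
  by (rule group.inv_equality[OF comm_group.axioms(2)[OF comm_group_CZ]])
    (auto intro!: continuous_intros)

lemma continuous_on_extend0: "continuous_on X f \<Longrightarrow> continuous_on X (extend0 X f)"
  by (rule continuous_on_eq) (auto simp: extend0_def)

lemma extend0_in_CZ: "continuous_on X f \<Longrightarrow> extend0 X f \<in> carrier (CZ X)"
  by (auto simp: continuous_on_extend0) (simp add: extend0_def)

lemma CZ_add: "f \<in> carrier (CZ X) \<Longrightarrow> g \<in> carrier (CZ X) \<Longrightarrow> (\<lambda>x. f x + g x) \<in> carrier (CZ X)"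
  by (auto intro!: continuous_intros)

lemma CZ_mult: "f \<in> carrier (CZ X) \<Longrightarrow> (\<lambda>x. k * f x) \<in> carrier (CZ X)"
  by (auto intro!: continuous_intros)

lemma CZ_sum: "(\<And>i. i \<in> I \<Longrightarrow> f i \<in> carrier (CZ X)) \<Longrightarrow> (\<lambda>x. \<Sum>i\<in>I. f i x) \<in> carrier (CZ X)"
  by (auto intro!: continuous_intros)

text \<open>The floor serves only as a cast to \<open>int\<close>. Integer values at distance below
  1 coincide, so the function is locally constant.\<close>

lemma continuous_on_floor_of_Ints:
  fixes g :: "'a::topological_space \<Rightarrow> real"
  assumes "continuous_on X g" "\<And>x. x \<in> X \<Longrightarrow> g x \<in> \<int>"
  shows "continuous_on X (\<lambda>x. \<lfloor>g x\<rfloor>)"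
  unfolding continuous_on_def tendsto_discrete
proof
  fix x assume x: "x \<in> X"
  have "\<forall>\<^sub>F y in at x within X. dist (g y) (g x) < 1"
    using assms(1) x unfolding continuous_on_def tendsto_iff by simp
  moreover have "\<forall>\<^sub>F y in at x within X. y \<in> X"
    by (simp add: eventually_at_filter)
  ultimately show "\<forall>\<^sub>F y in at x within X. \<lfloor>g y\<rfloor> = \<lfloor>g x\<rfloor>"
  proof eventually_elim
    case (elim y)
    then have "g y \<in> \<int>" "g x \<in> \<int>" using assms(2) x by auto
    with elim(1) show ?case by (auto simp: dist_real_def elim!: Ints_cases)
  qed
qed

locale dynamical_system =
  fixes X :: "'a::metric_space set" and S :: "'a \<Rightarrow> 'a"
  assumes sys: "system X S"
begin

lemma compact_X: "compact X" and X_nonempty: "X \<noteq> {}"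
  using sys by (auto simp: system_def)

lemma continuous_S: "continuous_on X S" and image_S: "S ` X = X" and inj_S: "inj_on S X"
proof -
  obtain S' where "homeomorphism X X S S'" using sys by (auto simp: system_def)
  then show "continuous_on X S" "S ` X = X" "inj_on S X"
    by (auto simp: homeomorphism_def inj_on_def) metis
qed

lemma S_in [simp]: "x \<in> X \<Longrightarrow> S x \<in> X"
  using image_S by blast

lemma inv_S_in [simp]: "x \<in> X \<Longrightarrow> inv_into X S x \<in> X"
  by (metis image_S inv_into_into)

lemma S_inv [simp]: "x \<in> X \<Longrightarrow> S (inv_into X S x) = x"
  by (metis f_inv_into_f image_S)

lemma inv_S [simp]: "x \<in> X \<Longrightarrow> inv_into X S (S x) = x"
  by (simp add: inj_S inv_into_f_f)

lemma funpow_in [simp]: "x \<in> X \<Longrightarrow> (S ^^ n) x \<in> X"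
  by (induction n) auto

lemma funpow_inv_in [simp]: "x \<in> X \<Longrightarrow> (inv_into X S ^^ n) x \<in> X"
  by (induction n) auto

lemma zpow_in [simp]: "x \<in> X \<Longrightarrow> zpow X S n x \<in> X"
  by (simp add: zpow_def)

lemma S_zpow:
  assumes "x \<in> X"
  shows "S (zpow X S n x) = zpow X S (n + 1) x"
proof (cases "n \<ge> 0")
  case True
  then have "nat (n + 1) = Suc (nat n)" by simp
  then show ?thesis using True by (simp add: zpow_def)
next
  case False
  then have e: "nat (- n) = Suc (nat (- (n + 1)))" by simp
  show ?thesis
  proof (cases "n = -1")
    case True then show ?thesis using assms by (simp add: zpow_def)
  next
    case n: False
    then show ?thesis using assms False
      unfolding zpow_def e by simp
  qed
qed

lemma system_funpow: "system X (S ^^ n)"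
proof -
  obtain S' where S': "homeomorphism X X S S'" using sys by (auto simp: system_def)
  have "\<exists>T. homeomorphism X X (S ^^ n) T"
  proof (induction n)
    case 0
    show ?case by (auto intro!: exI[of _ id] simp: homeomorphism_def)
  next
    case (Suc n)
    then obtain T where "homeomorphism X X (S ^^ n) T" by blast
    from homeomorphism_compose[OF this S'] have "homeomorphism X X (S ^^ Suc n) (T \<circ> S')" by simp
    then show ?case by blast
  qed
  then show ?thesis using sys by (auto simp: system_def)
qed

lemma continuous_on_o_S: "continuous_on X f \<Longrightarrow> continuous_on X (\<lambda>x. f (S x))"
  by (rule continuous_on_compose2[OF _ continuous_S]) auto

lemma extend0_o_S_in_CZ: "f \<in> carrier (CZ X) \<Longrightarrow> extend0 X (\<lambda>x. f (S x)) \<in> carrier (CZ X)"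
  by (rule extend0_in_CZ) (simp add: continuous_on_o_S)

lemma coboundary_in_CZ: "f \<in> carrier (CZ X) \<Longrightarrow> extend0 X (\<lambda>x. f x - f (S x)) \<in> carrier (CZ X)"
  by (rule extend0_in_CZ) (auto intro!: continuous_intros continuous_on_o_S)

lemma subgroup_coboundaries: "subgroup (coboundaries X S) (CZ X)"
proof (rule group.subgroupI[OF comm_group.axioms(2)[OF comm_group_CZ]])
  show "coboundaries X S \<subseteq> carrier (CZ X)"
    unfolding coboundaries_def using coboundary_in_CZ by auto
  show "coboundaries X S \<noteq> {}"
    unfolding coboundaries_def by (auto intro!: exI[of _ "\<lambda>_. 0"])
  fix h assume "h \<in> coboundaries X S"
  then obtain f where f: "f \<in> carrier (CZ X)" "h = extend0 X (\<lambda>x. f x - f (S x))"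
    unfolding coboundaries_def by blast
  show "inv\<^bsub>CZ X\<^esub> h \<in> coboundaries X S"
    unfolding f(2) inv_CZ[OF coboundary_in_CZ[OF f(1)]] coboundaries_def
    by (rule CollectI, rule exI[of _ "\<lambda>x. - f x"])
      (use f(1) in \<open>auto simp: extend0_def fun_eq_iff intro!: continuous_intros\<close>)
  fix h' assume "h' \<in> coboundaries X S"
  then obtain f' where f': "f' \<in> carrier (CZ X)" "h' = extend0 X (\<lambda>x. f' x - f' (S x))"
    unfolding coboundaries_def by blast
  show "h \<otimes>\<^bsub>CZ X\<^esub> h' \<in> coboundaries X S"
    unfolding f(2) f'(2) coboundaries_def
    by (rule CollectI, rule exI[of _ "\<lambda>x. f x + f' x"])
      (use f(1) f'(1) in \<open>auto simp: extend0_def fun_eq_iff intro!: continuous_intros\<close>)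
qed

lemma normal_coboundaries: "normal (coboundaries X S) (CZ X)"
  by (rule comm_group.subgroup_imp_normal[OF comm_group_CZ subgroup_coboundaries])

lemma carrier_coinvariants: "carrier (coinvariants X S) = cls X S ` carrier (CZ X)"
  by (auto simp: coinvariants_def FactGroup_def RCOSETS_def cls_def)

lemma cls_in [simp]: "f \<in> carrier (CZ X) \<Longrightarrow> cls X S f \<in> carrier (coinvariants X S)"
  unfolding carrier_coinvariants by blast

lemma cls_add:
  assumes "f \<in> carrier (CZ X)" "g \<in> carrier (CZ X)"
  shows "cls X S f \<otimes>\<^bsub>coinvariants X S\<^esub> cls X S g = cls X S (\<lambda>x. f x + g x)"
  using normal.rcos_sum[OF normal_coboundaries assms]
  by (simp add: coinvariants_def FactGroup_def cls_def)

lemma cls_eq: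
  "cls X S f = {\<lambda>x. extend0 X (\<lambda>x. g x - g (S x)) x + f x | g. g \<in> carrier (CZ X)}"
  by (auto simp: cls_def r_coset_def coboundaries_def)

text \<open>The difference of \<open>f\<close> and its composition with \<open>S\<close> is the
  coboundary of \<open>f\<close>. Invariance of states under the dynamics rests on this.\<close>

lemma cls_shift:
  assumes f: "f \<in> carrier (CZ X)"
  shows "cls X S (extend0 X (\<lambda>x. f (S x))) = cls X S f"
proof -
  have *: "extend0 X (\<lambda>x. f x - f (S x)) \<in> coboundaries X S"
    using f unfolding coboundaries_def by blast
  have "cls X S f = coboundaries X S #>\<^bsub>CZ X\<^esub>
      (extend0 X (\<lambda>x. f x - f (S x)) \<otimes>\<^bsub>CZ X\<^esub> extend0 X (\<lambda>x. f (S x)))"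
    unfolding cls_def using f by (auto simp: extend0_def fun_eq_iff intro!: arg_cong2[of _ _ _ _ "r_coset (CZ X)"])
  also have "\<dots> = (coboundaries X S #>\<^bsub>CZ X\<^esub> extend0 X (\<lambda>x. f x - f (S x)))
      #>\<^bsub>CZ X\<^esub> extend0 X (\<lambda>x. f (S x))"
    using group.coset_mult_assoc[OF comm_group.axioms(2)[OF comm_group_CZ]
        subgroup.subset[OF subgroup_coboundaries] coboundary_in_CZ[OF f] extend0_o_S_in_CZ[OF f]]
    by simp
  also have "coboundaries X S #>\<^bsub>CZ X\<^esub> extend0 X (\<lambda>x. f x - f (S x)) = coboundaries X S"
    by (rule subgroup.rcos_const[OF subgroup_coboundaries comm_group.axioms(2)[OF comm_group_CZ] *])
  finally show ?thesis by (simp add: cls_def)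
qed

section \<open>States: linearity, invariance and averages\<close>

context
  fixes \<tau> assumes \<tau>: "state X S \<tau>"
begin

lemma state_add:
  assumes "f \<in> carrier (CZ X)" "g \<in> carrier (CZ X)"
  shows "\<tau> (cls X S (\<lambda>x. f x + g x)) = \<tau> (cls X S f) + \<tau> (cls X S g)"
  using \<tau> assms cls_add[OF assms] unfolding state_def hom_def
  by (metis (mono_tags, lifting) cls_in mem_Collect_eq real_group_simps(1))

lemma state_zero: "\<tau> (cls X S (\<lambda>_. 0)) = 0"
  using state_add[of "\<lambda>_. 0" "\<lambda>_. 0"] by simp

lemma state_of_nat:
  assumes "f \<in> carrier (CZ X)"
  shows "\<tau> (cls X S (\<lambda>x. int n * f x)) = real n * \<tau> (cls X S f)"
proof (induction n)
  case 0
  show ?case by (simp add: state_zero)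
next
  case (Suc n)
  have "\<tau> (cls X S (\<lambda>x. f x + int n * f x)) = \<tau> (cls X S f) + \<tau> (cls X S (\<lambda>x. int n * f x))"
    by (intro state_add assms CZ_mult)
  then show ?case using Suc by (simp add: algebra_simps)
qed

lemma state_mult:
  assumes f: "f \<in> carrier (CZ X)"
  shows "\<tau> (cls X S (\<lambda>x. k * f x)) = of_int k * \<tau> (cls X S f)"
proof (cases "k \<ge> 0")
  case True
  then show ?thesis using state_of_nat[OF f, of "nat k"] by simp
next
  case False
  have "\<tau> (cls X S (\<lambda>x. k * f x + int (nat (- k)) * f x))
      = \<tau> (cls X S (\<lambda>x. k * f x)) + real (nat (- k)) * \<tau> (cls X S f)"
    by (simp only: state_add[OF CZ_mult[OF f] CZ_mult[OF f]] state_of_nat[OF f])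
  moreover have "(\<lambda>x. k * f x + int (nat (- k)) * f x) = (\<lambda>_. 0)"
    using False by auto
  ultimately show ?thesis using False by (simp add: state_zero)
qed

lemma state_sum:
  assumes "finite I" "\<And>i. i \<in> I \<Longrightarrow> f i \<in> carrier (CZ X)"
  shows "\<tau> (cls X S (\<lambda>x. \<Sum>i\<in>I. f i x)) = (\<Sum>i\<in>I. \<tau> (cls X S (f i)))"
  using assms
proof (induction I)
  case empty
  then show ?case by (simp add: state_zero)
next
  case (insert i I)
  have "\<tau> (cls X S (\<lambda>x. f i x + (\<Sum>j\<in>I. f j x)))
      = \<tau> (cls X S (f i)) + \<tau> (cls X S (\<lambda>x. \<Sum>j\<in>I. f j x))"
    by (intro state_add CZ_sum insert.prems) auto
  then show ?case using insert by simp
qed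

lemma state_const: "\<tau> (cls X S (extend0 X (\<lambda>_. k))) = of_int k"
proof -
  have "(\<lambda>x. k * extend0 X (\<lambda>_. 1) x) = extend0 X (\<lambda>_. k)"
    by (auto simp: extend0_def)
  then show ?thesis
    using state_mult[OF extend0_in_CZ, of "\<lambda>_. 1" k] \<tau> by (simp add: state_def)
qed

lemma state_mono:
  assumes f: "f \<in> carrier (CZ X)" and g: "g \<in> carrier (CZ X)" and le: "\<And>x. x \<in> X \<Longrightarrow> f x \<le> g x"
  shows "\<tau> (cls X S f) \<le> \<tau> (cls X S g)"
proof -
  have d: "(\<lambda>x. g x + (-1) * f x) \<in> carrier (CZ X)"
    by (intro CZ_add[OF g] CZ_mult[OF f])
  have "0 \<le> \<tau> (cls X S (\<lambda>x. g x + (-1) * f x))"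
    using \<tau> d le unfolding state_def by auto
  also have "\<dots> = \<tau> (cls X S g) - \<tau> (cls X S f)"
    by (subst state_add[OF g CZ_mult[OF f]], subst state_mult[OF f]) simp
  finally show ?thesis by simp
qed

lemma state_funpow:
  assumes f: "f \<in> carrier (CZ X)"
  shows "extend0 X (\<lambda>x. f ((S ^^ n) x)) \<in> carrier (CZ X)"
    and "\<tau> (cls X S (extend0 X (\<lambda>x. f ((S ^^ n) x)))) = \<tau> (cls X S f)"
proof -
  show c: "extend0 X (\<lambda>x. f ((S ^^ n) x)) \<in> carrier (CZ X)" for n
    by (rule extend0_in_CZ) (use f dynamical_system.continuous_on_o_S[of X "S ^^ n" f]
        system_funpow in \<open>auto simp: dynamical_system_def\<close>)
  show "\<tau> (cls X S (extend0 X (\<lambda>x. f ((S ^^ n) x)))) = \<tau> (cls X S f)"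
  proof (induction n)
    case 0
    have "extend0 X f = f" using f by (auto simp: extend0_def)
    then show ?case by simp
  next
    case (Suc n)
    have "extend0 X (\<lambda>x. f ((S ^^ Suc n) x)) = extend0 X (\<lambda>x. extend0 X (\<lambda>x. f ((S ^^ n) x)) (S x))"
      by (auto simp: extend0_def fun_eq_iff funpow_swap1)
    then show ?case using Suc cls_shift[OF c[of n]] by simp
  qed
qed

text \<open>By invariance the \<open>N\<close>-th orbit sum has state \<open>N\<close> times that of
  \<open>f\<close>, while positivity keeps it within a fixed distance of \<open>N * \<beta>\<close>.
  Letting \<open>N\<close> grow leaves only one possible value.\<close>

lemma state_eq_mean:
  assumes f: "f \<in> carrier (CZ X)"
    and bound: "\<And>N x. x \<in> X \<Longrightarrow> \<bar>of_int (\<Sum>n<N. f ((S ^^ n) x)) - real N * \<beta>\<bar> \<le> C"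
  shows "\<tau> (cls X S f) = \<beta>"
proof -
  define t where "t = \<tau> (cls X S f)"
  have *: "\<bar>real N * (t - \<beta>)\<bar> \<le> C + 1" for N
  proof -
    let ?g = "\<lambda>x. \<Sum>n<N. extend0 X (\<lambda>x. f ((S ^^ n) x)) x"
    have g: "?g \<in> carrier (CZ X)" by (intro CZ_sum state_funpow f)
    have tg: "\<tau> (cls X S ?g) = real N * t"
      by (subst state_sum) (simp_all add: state_funpow[OF f, simplified] t_def f[simplified])
    have gx: "\<bar>of_int (?g x) - real N * \<beta>\<bar> \<le> C" if "x \<in> X" for x
      using bound[OF that, of N] that by (simp add: extend0_def)
    \<comment> \<open>The orbit sum is integer valued, so its real bounds can be rounded to integer
      constants, whose states are known from \<open>state_const\<close>.\<close>
    have "\<tau> (cls X S (extend0 X (\<lambda>_. \<lceil>real N * \<beta> - C\<rceil>))) \<le> \<tau> (cls X S ?g)"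
    proof (rule state_mono[OF extend0_in_CZ g])
      fix x assume x: "x \<in> X"
      have "real N * \<beta> - C \<le> of_int (?g x)" using gx[OF x] by linarith
      then show "extend0 X (\<lambda>_. \<lceil>real N * \<beta> - C\<rceil>) x \<le> ?g x"
        using x by (subst extend0_def) (simp only: if_True ceiling_le_iff)
    qed simp
    moreover have "\<tau> (cls X S ?g) \<le> \<tau> (cls X S (extend0 X (\<lambda>_. \<lfloor>real N * \<beta> + C\<rfloor>)))"
    proof (rule state_mono[OF g extend0_in_CZ])
      fix x assume x: "x \<in> X"
      have "of_int (?g x) \<le> real N * \<beta> + C" using gx[OF x] by linarith
      then show "?g x \<le> extend0 X (\<lambda>_. \<lfloor>real N * \<beta> + C\<rfloor>) x"
        using x by (subst (2) extend0_def) (simp only: if_True le_floor_iff)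
    qed simp
    ultimately show ?thesis unfolding state_const tg right_diff_distrib by linarith
  qed
  have "t = \<beta>"
  proof (rule ccontr)
    assume "t \<noteq> \<beta>"
    then obtain N :: nat where "C + 1 < real N * \<bar>t - \<beta>\<bar>"
      using reals_Archimedean3[of "\<bar>t - \<beta>\<bar>"] by auto
    then show False using *[of N] by (simp add: abs_mult)
  qed
  then show ?thesis by (simp add: t_def)
qed

end

lemma Inf_subgroup_iff:
  "f \<in> carrier (CZ X) \<Longrightarrow> cls X S f \<in> Inf_subgroup X S \<longleftrightarrow> (\<forall>\<tau>. state X S \<tau> \<longrightarrow> \<tau> (cls X S f) = 0)"
  by (auto simp: Inf_subgroup_def)

lemma zero_in_Inf: "cls X S (\<lambda>_. 0) \<in> Inf_subgroup X S"
  by (subst Inf_subgroup_iff) (auto simp: state_zero)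

end

section \<open>Almost one-to-one extensions of rotations\<close>

text \<open>\<open>Sum_any\<close> defaults to 0 on an infinite support, so both finiteness
  hypotheses matter.\<close>

lemma Sum_any_minus:
  fixes f g :: "'b \<Rightarrow> int"
  assumes "finite {n. f n \<noteq> 0}" "finite {n. g n \<noteq> 0}"
  shows "Sum_any (\<lambda>n. f n - g n) = Sum_any f - Sum_any g"
proof -
  let ?N = "{n. f n \<noteq> 0} \<union> {n. g n \<noteq> 0}"
  have fin: "finite ?N" using assms by simp
  have "Sum_any (\<lambda>n. f n - g n) = (\<Sum>n\<in>?N. f n - g n)"
    by (rule Sum_any.expand_superset[OF fin]) auto
  also have "\<dots> = sum f ?N - sum g ?N" by (rule sum_subtractf)
  also have "sum f ?N = Sum_any f" by (rule Sum_any.expand_superset[OF fin, symmetric]) auto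
  also have "sum g ?N = Sum_any g" by (rule Sum_any.expand_superset[OF fin, symmetric]) auto
  finally show ?thesis .
qed

text \<open>One component of the index map, evaluated on a single function instead of on a coset;
  \<open>index_map_cls\<close> relates the two.\<close>

definition jump_sum :: "'a set \<Rightarrow> ('a \<Rightarrow> 'a) \<Rightarrow> 'a \<Rightarrow> 'a \<Rightarrow> ('a \<Rightarrow> int) \<Rightarrow> int"
  where "jump_sum X S x x' f = Sum_any (\<lambda>n. f (zpow X S n x) - f (zpow X S n x'))"

lemma jump_sum_linear:
  fixes f :: "'i \<Rightarrow> 'a \<Rightarrow> int"
  assumes "finite I" "\<And>i. i \<in> I \<Longrightarrow> finite {n. f i (zpow X S n x) \<noteq> f i (zpow X S n x')}"
  shows "jump_sum X S x x' (\<lambda>z. \<Sum>i\<in>I. k i * f i z) = (\<Sum>i\<in>I. k i * jump_sum X S x x' (f i))"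
  using assms
proof (induction I)
  case empty
  show ?case by (simp add: jump_sum_def)
next
  case (insert i I)
  let ?d = "\<lambda>j n. f j (zpow X S n x) - f j (zpow X S n x')"
  have "{n. (\<Sum>j\<in>I. k j * ?d j n) \<noteq> 0} \<subseteq> (\<Union>j\<in>I. {n. f j (zpow X S n x) \<noteq> f j (zpow X S n x')})"
  proof
    fix n assume "n \<in> {n. (\<Sum>j\<in>I. k j * ?d j n) \<noteq> 0}"
    then obtain j where "j \<in> I" "k j * ?d j n \<noteq> 0" by (auto elim: sum.not_neutral_contains_not_neutral)
    then show "n \<in> (\<Union>j\<in>I. {n. f j (zpow X S n x) \<noteq> f j (zpow X S n x')})" by auto
  qed
  then have fin: "finite {n. (\<Sum>j\<in>I. k j * ?d j n) \<noteq> 0}"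
    by (rule finite_subset) (use insert in auto)
  have fini: "finite {n. ?d i n \<noteq> 0}" using insert.prems[of i] by simp
  have finki: "finite {n. k i * ?d i n \<noteq> 0}" by (rule finite_subset[OF _ fini]) auto
  have "jump_sum X S x x' (\<lambda>z. \<Sum>j\<in>insert i I. k j * f j z)
      = Sum_any (\<lambda>n. k i * ?d i n + (\<Sum>j\<in>I. k j * ?d j n))"
    unfolding jump_sum_def using insert.hyps
    by (intro Sum_any.cong) (simp add: algebra_simps sum_subtractf)
  also have "\<dots> = Sum_any (\<lambda>n. k i * ?d i n) + Sum_any (\<lambda>n. \<Sum>j\<in>I. k j * ?d j n)"
    by (rule Sum_any.distrib[OF finki fin])
  also have "Sum_any (\<lambda>n. k i * ?d i n) = k i * jump_sum X S x x' (f i)"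
    unfolding jump_sum_def by (rule Sum_any_right_distrib[OF fini, symmetric])
  also have "Sum_any (\<lambda>n. \<Sum>j\<in>I. k j * ?d j n) = jump_sum X S x x' (\<lambda>z. \<Sum>j\<in>I. k j * f j z)"
    unfolding jump_sum_def by (intro Sum_any.cong) (simp add: algebra_simps sum_subtractf)
  finally show ?case using insert by simp
qed

text \<open>Adding the coboundary of \<open>g\<close> changes the sum by the difference of a sum
  over all integers and its shift by one, which vanishes. Hence \<open>jump_sum\<close> is constant
  on the coset and \<open>the_elem\<close> is applied to a singleton.\<close>

lemma (in dynamical_system) index_map_cls:
  assumes f: "f \<in> carrier (CZ X)" and y: "y \<in> R" "p y \<in> X" "q y \<in> X"
    and fin: "\<And>g. g \<in> carrier (CZ X) \<Longrightarrow> finite {n. g (zpow X S n (p y)) \<noteq> g (zpow X S n (q y))}"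
  shows "index_map X S R p q (cls X S f) y = jump_sum X S (p y) (q y) f"
proof -
  have "jump_sum X S (p y) (q y) (\<lambda>x. extend0 X (\<lambda>x. g x - g (S x)) x + f x)
      = jump_sum X S (p y) (q y) f" if g: "g \<in> carrier (CZ X)" for g
  proof -
    let ?d = "\<lambda>f n. f (zpow X S n (p y)) - f (zpow X S n (q y))"
    have fg: "finite {n. ?d g n \<noteq> 0}" using fin[OF g] by simp
    have "{n. ?d g (n + 1) \<noteq> 0} = (\<lambda>n. n - 1) ` {n. ?d g n \<noteq> 0}"
    proof (intro Set.set_eqI iffI)
      fix n assume "n \<in> {n. ?d g (n + 1) \<noteq> 0}"
      then show "n \<in> (\<lambda>n. n - 1) ` {n. ?d g n \<noteq> 0}" by (intro image_eqI[of _ _ "n + 1"]) auto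
    qed auto
    then have fg': "finite {n. ?d g (n + 1) \<noteq> 0}" using fg by simp
    have ff: "finite {n. ?d f n \<noteq> 0}" using fin[OF f] by simp
    have fd: "finite {n. ?d g n - ?d g (n + 1) \<noteq> 0}"
      by (rule finite_subset[OF _ finite_UnI[OF fg fg']]) auto
    have "bij (\<lambda>n::int. n + 1)" by (rule bij_betw_byWitness[where f' = "\<lambda>n. n - 1"]) auto
    then have shift: "Sum_any (\<lambda>n. ?d g (n + 1)) = Sum_any (?d g)"
      by (rule Sum_any.reindex_cong[symmetric]) (auto simp: fun_eq_iff)
    have "jump_sum X S (p y) (q y) (\<lambda>x. extend0 X (\<lambda>x. g x - g (S x)) x + f x)
        = Sum_any (\<lambda>n. (?d g n - ?d g (n + 1)) + ?d f n)"
      unfolding jump_sum_def using y by (intro Sum_any.cong) (simp add: extend0_def S_zpow)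
    also have "\<dots> = (Sum_any (?d g) - Sum_any (\<lambda>n. ?d g (n + 1))) + Sum_any (?d f)"
      by (subst Sum_any.distrib[OF fd ff], subst Sum_any_minus[OF fg fg']) (rule refl)
    also have "\<dots> = jump_sum X S (p y) (q y) f" unfolding shift jump_sum_def by simp
    finally show ?thesis .
  qed
  then have "jump_sum X S (p y) (q y) h = jump_sum X S (p y) (q y) f" if "h \<in> cls X S f" for h
    using that unfolding cls_eq by blast
  moreover have "cls X S f \<noteq> {}"
    unfolding cls_eq using CZ_mult[OF f, of 0] by blast
  ultimately have "jump_sum X S (p y) (q y) ` cls X S f = {jump_sum X S (p y) (q y) f}"
    by (simp add: image_constant_conv cong: image_cong)
  then show ?thesis using y(1) unfolding index_map_def jump_sum_def by simp
qed

text \<open>\<open>H\<close> together with the functions \<open>c t\<close> separates the points of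
  a compact space, hence fixes its topology. \<open>separated\<close> confines nontrivial fibres to
  points of \<open>A\<close>, and \<open>to_circle_c\<close> leaves only 0 and 1 as values of
  \<open>c (H x)\<close> at \<open>x\<close>, so no fibre has more than two points.\<close>

locale split_system = dynamical_system X S
  for X :: "'a::metric_space set" and S :: "'a \<Rightarrow> 'a" +
  fixes a :: real and A :: "circle set" and H :: "'a \<Rightarrow> circle" and c :: "circle \<Rightarrow> 'a \<Rightarrow> real"
  assumes irr: "a \<notin> \<rat>"
    and continuous_H: "continuous_on X H"
    and H_S: "x \<in> X \<Longrightarrow> H (S x) = H x + to_circle a"
    and A_invariant: "t + to_circle a \<in> A \<longleftrightarrow> t \<in> A"
    and continuous_c: "t \<in> A \<Longrightarrow> continuous_on X (c t)"
    and c_ge_0: "t \<in> A \<Longrightarrow> x \<in> X \<Longrightarrow> 0 \<le> c t x"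
    and c_le_1: "t \<in> A \<Longrightarrow> x \<in> X \<Longrightarrow> c t x \<le> 1"
    and to_circle_c: "t \<in> A \<Longrightarrow> x \<in> X \<Longrightarrow> to_circle (c t x) = H x - t"
    and c_S: "t \<in> A \<Longrightarrow> x \<in> X \<Longrightarrow> c (t + to_circle a) (S x) = c t x"
    and separated: "x \<in> X \<Longrightarrow> y \<in> X \<Longrightarrow> H x = H y \<Longrightarrow> x \<noteq> y \<Longrightarrow> H x \<in> A \<and> c (H x) x \<noteq> c (H x) y"
    and c_0_ex: "t \<in> A \<Longrightarrow> \<exists>x\<in>X. c t x = 0"
    and c_1_ex: "t \<in> A \<Longrightarrow> \<exists>x\<in>X. c t x = 1"
begin

lemma H_zpow:
  assumes x: "x \<in> X"
  shows "H (zpow X S n x) = H x + to_circle (of_int n * a)"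
proof (induction n rule: int_induct[where k = 0])
  case base
  show ?case by (simp add: zpow_def to_circle_0)
next
  case (step1 i)
  then show ?case
    using H_S[of "zpow X S i x"] x
    by (simp add: S_zpow[symmetric] distrib_right to_circle_add add.assoc)
next
  case (step2 i)
  have "H (zpow X S (i - 1) x) + to_circle a = H (zpow X S i x)"
    using H_S[of "zpow X S (i - 1) x"] x by (simp add: S_zpow)
  also have "\<dots> = (H x + to_circle (of_int (i - 1) * a)) + to_circle a"
    unfolding step2 by (simp add: add.assoc to_circle_add[symmetric] algebra_simps)
  finally show ?case by simp
qed

lemma A_invariant_int: "t + to_circle (of_int n * a) \<in> A \<longleftrightarrow> t \<in> A"
proof (induction n rule: int_induct[where k = 0])
  case base
  show ?case by (simp add: to_circle_0)
next
  case (step1 i)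
  then show ?case
    using A_invariant[of "t + to_circle (of_int i * a)"]
    by (simp add: distrib_right to_circle_add add.assoc)
next
  case (step2 i)
  have "t + to_circle (of_int i * a) = t + to_circle (of_int (i - 1) * a) + to_circle a"
    by (simp add: add.assoc to_circle_add[symmetric] algebra_simps)
  then show ?case using step2(2) A_invariant[of "t + to_circle (of_int (i - 1) * a)"] by metis
qed

lemma c_zpow:
  assumes t: "t \<in> A" and x: "x \<in> X"
  shows "c (t + to_circle (of_int n * a)) (zpow X S n x) = c t x"
proof (induction n rule: int_induct[where k = 0])
  case base
  show ?case by (simp add: zpow_def to_circle_0)
next
  case (step1 i)
  then show ?case
    using c_S[of "t + to_circle (of_int i * a)" "zpow X S i x"] x t
    by (simp add: S_zpow[symmetric] distrib_right to_circle_add add.assoc A_invariant_int)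
next
  case (step2 i)
  have "t + to_circle (of_int i * a) = t + to_circle (of_int (i - 1) * a) + to_circle a"
    by (simp add: add.assoc to_circle_add[symmetric] algebra_simps)
  moreover have "c (t + to_circle (of_int (i - 1) * a) + to_circle a) (zpow X S i x)
      = c (t + to_circle (of_int (i - 1) * a)) (zpow X S (i - 1) x)"
    using c_S[of "t + to_circle (of_int (i - 1) * a)" "zpow X S (i - 1) x"] x t
    by (simp only: S_zpow A_invariant_int zpow_in diff_add_cancel)
  ultimately show ?case using step2(2) by metis
qed

text \<open>A lift to \<open>[0,1]\<close> is ambiguous only at the integers, that is, over
  \<open>t\<close>. Elsewhere \<open>c t\<close> depends on \<open>H x\<close> alone and cannot
  distinguish the points of a fibre.\<close>

lemma c_off:
  assumes "t \<in> A" "x \<in> X" "H x \<noteq> t"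
  shows "c t x = coord (H x - t)"
proof -
  have "c t x \<noteq> 1"
    using to_circle_c[OF assms(1,2)] assms(3) to_circle_of_int[of 1] by auto
  then show ?thesis
    using c_ge_0[OF assms(1,2)] c_le_1[OF assms(1,2)] to_circle_c[OF assms(1,2)]
    by (intro coord_eqI[symmetric]) auto
qed

lemma c_at:
  assumes "H x \<in> A" "x \<in> X"
  shows "c (H x) x = 0 \<or> c (H x) x = 1"
proof -
  have "c (H x) x \<in> \<int>"
    using to_circle_c[OF assms] by (simp add: to_circle_eq_0_iff)
  then obtain k where k: "c (H x) x = of_int k" by (auto elim: Ints_cases)
  with c_ge_0[OF assms] c_le_1[OF assms] have "k = 0 \<or> k = 1" by auto
  with k show ?thesis by auto
qed

lemma H_eqI: "t \<in> A \<Longrightarrow> x \<in> X \<Longrightarrow> c t x \<in> \<int> \<Longrightarrow> H x = t"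
  using to_circle_c[of t x] by (simp add: to_circle_eq_0_iff[symmetric])

section \<open>Fibres of the semiconjugacy\<close>

lemma surj_H: "H ` X = UNIV"
proof -
  obtain x where x: "x \<in> X" using X_nonempty by blast
  have "closed (H ` X)"
    by (intro compact_imp_closed compact_continuous_image continuous_H compact_X)
  moreover have "range (\<lambda>k::nat. H x + to_circle (real k * a)) \<subseteq> H ` X"
  proof safe
    fix k :: nat
    show "H x + to_circle (real k * a) \<in> H ` X"
      using H_zpow[OF x, of "int k"] x by (metis zpow_in image_eqI of_int_of_nat_eq)
  qed
  ultimately have "closure (range (\<lambda>k::nat. H x + to_circle (real k * a))) \<subseteq> H ` X"
    by (rule closure_minimal[rotated])
  then show ?thesis unfolding rotation_orbit_dense[OF irr] by auto
qed

text \<open>Infinitely many such pairs would accumulate at a pair of distinct points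
  \<open>x\<close>, \<open>y\<close> in one fibre. By \<open>c_off\<close>, the function
  \<open>c (H x)\<close> agrees on the approximating pairs, so it agrees on the limit pair, against
  \<open>separated\<close>.\<close>

lemma finite_far_fibres:
  assumes "e > 0"
  shows "finite {t. \<exists>x\<in>X. \<exists>y\<in>X. H x = t \<and> H y = t \<and> e \<le> dist x y}" (is "finite ?P")
proof (rule ccontr)
  assume "infinite ?P"
  from infinite_countable_subset[OF this] obtain t :: "nat \<Rightarrow> circle"
    where t: "inj t" "range t \<subseteq> ?P"
    by (elim exE conjE) (rule that)
  have "\<forall>n. \<exists>z. z \<in> X \<times> X \<and> H (fst z) = t n \<and> H (snd z) = t n \<and> e \<le> dist (fst z) (snd z)"
  proof
    fix n
    have "t n \<in> ?P" using t(2) by blast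
    then obtain x y where "x \<in> X" "y \<in> X" "H x = t n" "H y = t n" "e \<le> dist x y" by blast
    then show "\<exists>z. z \<in> X \<times> X \<and> H (fst z) = t n \<and> H (snd z) = t n \<and> e \<le> dist (fst z) (snd z)"
      by (intro exI[of _ "(x, y)"]) simp
  qed
  then obtain z where z: "\<And>n. z n \<in> X \<times> X" "\<And>n. H (fst (z n)) = t n" "\<And>n. H (snd (z n)) = t n"
    "\<And>n. e \<le> dist (fst (z n)) (snd (z n))"
    by metis
  have "compact (X \<times> X)" by (intro compact_Times compact_X)
  then obtain l r where l: "l \<in> X \<times> X" "strict_mono r" "(z \<circ> r) \<longlonglongrightarrow> l"
    using z(1) unfolding compact_def by blast
  define x y where "x = fst l" and "y = snd l"
  have xy: "x \<in> X" "y \<in> X" using l(1) by (auto simp: x_def y_def)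
  have lx: "(\<lambda>n. fst (z (r n))) \<longlonglongrightarrow> x" and ly: "(\<lambda>n. snd (z (r n))) \<longlonglongrightarrow> y"
    using l(3) by (auto simp: x_def y_def o_def intro: tendsto_fst tendsto_snd)
  have lim: "(\<lambda>n. f (fst (z (r n)))) \<longlonglongrightarrow> f x" "(\<lambda>n. f (snd (z (r n)))) \<longlonglongrightarrow> f y"
    if "continuous_on X f" for f :: "'a \<Rightarrow> 'b::topological_space"
    using z(1) by (auto intro!: continuous_on_tendsto_compose[OF that lx xy(1)]
        continuous_on_tendsto_compose[OF that ly xy(2)] eventuallyI simp: mem_Times_iff)
  have "H x = H y"
    using LIMSEQ_unique lim[OF continuous_H] unfolding z by blast
  moreover have "e \<le> dist x y"
    by (rule Lim_bounded2[OF tendsto_dist[OF lx ly], of 0]) (use z(4) in auto)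
  then have "x \<noteq> y" using assms by auto
  ultimately have s: "H x \<in> A" "c (H x) x \<noteq> c (H x) y" using separated[OF xy] by auto
  \<comment> \<open>Since \<open>t\<close> is injective, at most one approximating pair lies over
    the limit point, where \<open>c_off\<close> does not apply.\<close>
  obtain N where N: "\<And>n. n \<ge> N \<Longrightarrow> t (r n) \<noteq> H x"
  proof (cases "\<exists>n. t (r n) = H x")
    case True
    then obtain n where "t (r n) = H x" by blast
    then have "t (r k) \<noteq> H x" if "k \<ge> Suc n" for k
      using that t(1) l(2) by (metis injD le_imp_less_Suc less_irrefl not_less_eq strict_mono_eq)
    then show ?thesis by (rule that)
  next
    case False
    then show ?thesis using that[of 0] by blast
  qed
  have "c (H x) (fst (z (r n))) = c (H x) (snd (z (r n)))" if "n \<ge> N" for n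
    using N[OF that] z(1)[of "r n"] z(2,3)[of "r n"] s(1) c_off by (auto simp: mem_Times_iff)
  then have "\<forall>\<^sub>F n in sequentially. c (H x) (fst (z (r n))) = c (H x) (snd (z (r n)))"
    unfolding eventually_sequentially by blast
  from tendsto_cong[OF this] lim(1)[OF continuous_c[OF s(1)]]
  have "(\<lambda>n. c (H x) (snd (z (r n)))) \<longlonglongrightarrow> c (H x) x" by simp
  with lim(2)[OF continuous_c[OF s(1)]] have "c (H x) x = c (H x) y" by (rule LIMSEQ_unique[rotated])
  with s(2) show False by simp
qed

text \<open>By uniform continuity, points with different integer values are a definite distance
  apart, which reduces the claim to \<open>finite_far_fibres\<close>.\<close>

lemma finite_jumps:
  fixes f :: "'a \<Rightarrow> int"
  assumes "continuous_on X f"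
  shows "finite {t. \<exists>x\<in>X. \<exists>y\<in>X. H x = t \<and> H y = t \<and> f x \<noteq> f y}"
proof -
  have "continuous_on X (\<lambda>x. real_of_int (f x))"
    using assms unfolding continuous_on_def tendsto_discrete
    by (auto intro!: tendsto_eventually elim: eventually_mono)
  then have "uniformly_continuous_on X (\<lambda>x. real_of_int (f x))"
    using compact_X by (rule compact_uniformly_continuous)
  then obtain d where d: "d > 0"
    "\<And>x y. x \<in> X \<Longrightarrow> y \<in> X \<Longrightarrow> dist y x < d \<Longrightarrow> dist (real_of_int (f y)) (real_of_int (f x)) < 1"
    unfolding uniformly_continuous_on_def by (meson zero_less_one)
  show ?thesis
  proof (rule finite_subset[OF _ finite_far_fibres[OF d(1)]], safe)
    fix x y assume *: "x \<in> X" "y \<in> X" "H y = H x" "f x \<noteq> f y"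
    have "d \<le> dist x y"
    proof (rule ccontr)
      assume "\<not> d \<le> dist x y"
      then have "dist (real_of_int (f x)) (real_of_int (f y)) < 1" using d(2)[of y x] * by simp
      then show False using *(4) by (simp add: dist_real_def)
    qed
    then show "\<exists>xa\<in>X. \<exists>ya\<in>X. H xa = H x \<and> H ya = H x \<and> d \<le> dist xa ya" using * by blast
  qed
qed

lemma finite_orbit_in:
  assumes "finite P"
  shows "finite {n. t + to_circle (of_int n * a) \<in> P}"
proof (rule finite_imageD)
  show "finite ((\<lambda>n. t + to_circle (of_int n * a)) ` {n. t + to_circle (of_int n * a) \<in> P})"
    by (rule finite_subset[OF _ assms]) auto
  show "inj_on (\<lambda>n. t + to_circle (of_int n * a)) {n. t + to_circle (of_int n * a) \<in> P}"
    by (rule inj_onI) (rule of_int_mult_irrational_inj[OF irr])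
qed

lemma finite_jumps_orbit:
  assumes f: "f \<in> carrier (CZ X)" and x: "x \<in> X" "x' \<in> X" "H x = H x'"
  shows "finite {n. f (zpow X S n x) \<noteq> f (zpow X S n x')}"
proof -
  have "continuous_on X f" using f by simp
  from finite_orbit_in[OF finite_jumps[OF this], of "H x"]
  show ?thesis
  proof (rule rev_finite_subset, intro subsetI CollectI)
    fix n assume n: "n \<in> {n. f (zpow X S n x) \<noteq> f (zpow X S n x')}"
    show "\<exists>z\<in>X. \<exists>z'\<in>X. H z = H x + to_circle (of_int n * a)
        \<and> H z' = H x + to_circle (of_int n * a) \<and> f z \<noteq> f z'"
      by (rule bexI[where x = "zpow X S n x"], rule bexI[where x = "zpow X S n x'"])
        (use n in \<open>simp_all only: x(1,2) x(3)[symmetric] H_zpow zpow_in mem_Collect_eq simp_thms not_False_eq_True\<close>)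
  qed
qed

text \<open>An orbit of an irrational rotation visits each point at most once, so it meets the
  finitely many fibres of diameter at least \<open>e\<close> only finitely often.\<close>

lemma asymptotic_fibre:
  assumes x: "x \<in> X" "x' \<in> X" "H x = H x'"
  shows "asymptotic X S x x'"
proof -
  have fin: "finite {n. e \<le> dist (zpow X S n x) (zpow X S n x')}" if "e > 0" for e
    using finite_orbit_in[OF finite_far_fibres[OF that], of "H x"]
  proof (rule rev_finite_subset, intro subsetI CollectI)
    fix n assume n: "n \<in> {n. e \<le> dist (zpow X S n x) (zpow X S n x')}"
    show "\<exists>z\<in>X. \<exists>z'\<in>X. H z = H x + to_circle (of_int n * a)
        \<and> H z' = H x + to_circle (of_int n * a) \<and> e \<le> dist z z'"
      by (rule bexI[where x = "zpow X S n x"], rule bexI[where x = "zpow X S n x'"])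
        (use n in \<open>simp_all only: x(1,2) x(3)[symmetric] H_zpow zpow_in mem_Collect_eq simp_thms not_False_eq_True\<close>)
  qed
  have top: "\<forall>\<^sub>F n in at_top. dist (zpow X S n x) (zpow X S n x') < e"
    and bot: "\<forall>\<^sub>F n in at_bot. dist (zpow X S n x) (zpow X S n x') < e" if "e > 0" for e
  proof -
    obtain M where M: "\<And>n. e \<le> dist (zpow X S n x) (zpow X S n x') \<Longrightarrow> \<bar>n\<bar> < M"
    proof -
      \<comment> \<open>The inserted 0 keeps the maximum defined when no far index exists.\<close>
      let ?F = "insert 0 (abs ` {n. e \<le> dist (zpow X S n x) (zpow X S n x')})"
      have "\<bar>n\<bar> \<le> Max ?F" if "e \<le> dist (zpow X S n x) (zpow X S n x')" for n
        using fin[OF \<open>e > 0\<close>] that by (intro Max_ge) auto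
      then show ?thesis using that[of "Max ?F + 1"] by fastforce
    qed
    show "\<forall>\<^sub>F n in at_top. dist (zpow X S n x) (zpow X S n x') < e"
      unfolding eventually_at_top_linorder
      by (rule exI[of _ M]) (use M in \<open>force simp: not_le[symmetric]\<close>)
    show "\<forall>\<^sub>F n in at_bot. dist (zpow X S n x) (zpow X S n x') < e"
      unfolding eventually_at_bot_linorder
      by (rule exI[of _ "- M"]) (use M in \<open>force simp: not_le[symmetric]\<close>)
  qed
  then show ?thesis
    unfolding asymptotic_def tendsto_iff by simp
qed

section \<open>Arc indicators and their states\<close>

definition arc :: "circle \<Rightarrow> circle \<Rightarrow> 'a \<Rightarrow> int"
  where "arc s b = extend0 X (\<lambda>x. \<lfloor>coord (b - s) - c s x + c b x\<rfloor>)"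

text \<open>Modulo 1 the two lifts cancel against the length. The floor in \<open>arc\<close> is
  therefore only a change of type.\<close>

lemma arc_Ints:
  assumes "s \<in> A" "b \<in> A" "x \<in> X"
  shows "coord (b - s) - c s x + c b x \<in> \<int>"
  using to_circle_c[OF assms(1,3)] to_circle_c[OF assms(2,3)]
  by (simp add: to_circle_eq_0_iff[symmetric] to_circle_add to_circle_diff)

lemma of_int_arc:
  assumes "s \<in> A" "b \<in> A" "x \<in> X"
  shows "of_int (arc s b x) = coord (b - s) - c s x + c b x"
  using arc_Ints[OF assms] assms(3) by (simp add: arc_def extend0_def)

lemma arc_in_CZ:
  assumes "s \<in> A" "b \<in> A"
  shows "arc s b \<in> carrier (CZ X)"
  unfolding arc_def
  by (intro extend0_in_CZ continuous_on_floor_of_Ints arc_Ints assms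
      continuous_intros continuous_c)

text \<open>Integrality does the work: a violation would have size at least 1, but the lifts can
  compensate by at most 1 and the lengths differ strictly in the other direction.\<close>

lemma arc_mono:
  assumes "s \<in> A" "b \<in> A" "b' \<in> A" "x \<in> X" "coord (b - s) < coord (b' - s)"
  shows "arc s b x \<le> arc s b' x"
proof (rule ccontr)
  assume "\<not> ?thesis"
  then have "of_int (arc s b x) \<ge> of_int (arc s b' x) + (1::real)" by linarith
  then have "coord (b - s) + c b x \<ge> coord (b' - s) + c b' x + 1"
    using assms by (simp add: of_int_arc)
  then show False using c_ge_0[OF assms(3,4)] c_le_1[OF assms(2,4)] assms(5) by linarith
qed

text \<open>Raising the shift by one adds a telescoping sum, whose two remaining terms differ by at
  most 1.\<close>

lemma shift_sum_bound:
  fixes u :: "nat \<Rightarrow> real"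
  assumes "\<And>n. 0 \<le> u n" "\<And>n. u n \<le> 1"
  shows "\<bar>\<Sum>n<N. u n - u (n + k)\<bar> \<le> real k"
proof (induction k)
  case 0
  show ?case by simp
next
  case (Suc k)
  have "(\<Sum>n<N. u n - u (n + Suc k)) = (\<Sum>n<N. (u n - u (n + k)) + (u (n + k) - u (Suc n + k)))"
    by (intro sum.cong) auto
  also have "\<dots> = (\<Sum>n<N. u n - u (n + k)) + (u k - u (N + k))"
    by (subst sum.distrib, subst sum_lessThan_telescope'[where f = "\<lambda>n. u (n + k)"]) simp
  finally show ?case
    using Suc assms(1)[of k] assms(1)[of "N + k"] assms(2)[of k] assms(2)[of "N + k"] by linarith
qed

lemma state_arc_orbit:
  assumes \<tau>: "state X S \<tau>" and s: "s \<in> A"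
  shows "\<tau> (cls X S (arc s (s + to_circle (real k * a)))) = frac (real k * a)"
proof (rule state_eq_mean[OF \<tau>, where C = "real k"])
  let ?b = "s + to_circle (real k * a)"
  have b: "?b \<in> A" using A_invariant_int[of s "int k"] s by simp
  show "arc s ?b \<in> carrier (CZ X)" by (rule arc_in_CZ[OF s b])
  fix N x assume x: "x \<in> X"
  have z: "(S ^^ n) x = zpow X S (int n) x" for n by (simp add: zpow_def)
  define u where "u n = c ?b ((S ^^ n) x)" for n
  have u: "0 \<le> u n" "u n \<le> 1" for n
    unfolding u_def using c_ge_0 c_le_1 b x by auto
  \<comment> \<open>By equivariance, \<open>c s\<close> at time \<open>n\<close> is
    \<open>c ?b\<close> at time \<open>n + k\<close>. The arc minus its length is thus a difference
    of \<open>u\<close> with its shift by \<open>k\<close>, whose sums stay bounded by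
    \<open>k\<close>.\<close>
  have "c s ((S ^^ n) x) = u (n + k)" for n
  proof -
    have "c (s + to_circle (of_int (int k) * a)) (zpow X S (int k) ((S ^^ n) x)) = c s ((S ^^ n) x)"
      by (rule c_zpow[OF s]) (simp add: x)
    then show ?thesis by (simp add: u_def zpow_def funpow_add add.commute[of n k])
  qed
  then have "of_int (\<Sum>n<N. arc s ?b ((S ^^ n) x)) = (\<Sum>n<N. frac (real k * a) + (u n - u (n + k)))"
    using s b x by (auto simp: of_int_arc u_def intro!: sum.cong)
  also have "\<dots> = real N * frac (real k * a) + (\<Sum>n<N. u n - u (n + k))"
    by (simp add: sum.distrib)
  finally show "\<bar>of_int (\<Sum>n<N. arc s ?b ((S ^^ n) x)) - real N * frac (real k * a)\<bar> \<le> real k"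
    using shift_sum_bound[where u = u and N = N and k = k, OF u] by simp
qed

lemma state_arc:
  assumes \<tau>: "state X S \<tau>" and s: "s \<in> A" and b: "b \<in> A" and sb: "s \<noteq> b"
  shows "\<tau> (cls X S (arc s b)) = coord (b - s)"
proof -
  let ?\<beta> = "coord (b - s)" and ?v = "\<tau> (cls X S (arc s b))"
  have \<beta>: "0 < ?\<beta>" "?\<beta> < 1"
    using coord_bounds[of "b - s"] coord_eq_0_iff[of "b - s"] sb by auto
  have orb: "s + to_circle (real k * a) \<in> A" for k using A_invariant_int[of s "int k"] s by simp
  have lower: "frac (real k * a) \<le> ?v" if "frac (real k * a) < ?\<beta>" for k :: nat
    unfolding state_arc_orbit[OF \<tau> s, symmetric]
    by (intro state_mono[OF \<tau>] arc_in_CZ arc_mono s b orb) (use that in auto)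
  have upper: "?v \<le> frac (real k * a)" if "?\<beta> < frac (real k * a)" for k :: nat
    unfolding state_arc_orbit[OF \<tau> s, symmetric]
    by (intro state_mono[OF \<tau>] arc_in_CZ arc_mono s b orb) (use that in auto)
  have "\<not> ?v < ?\<beta>"
  proof
    assume "?v < ?\<beta>"
    \<comment> \<open>An orbit arc of length strictly between the supposed state and
      \<open>?\<beta>\<close> contradicts monotonicity. The truncation at 0 places the interval
      inside the unit interval, as Kronecker density requires.\<close>
    then obtain k :: nat where "max 0 ?v < frac (real k * a)" "frac (real k * a) < ?\<beta>"
      using Kronecker_between[OF irr, of "max 0 ?v" ?\<beta>] \<beta> by auto
    then show False using lower[of k] by simp
  qed
  moreover have "\<not> ?\<beta> < ?v"
  proof
    assume "?\<beta> < ?v"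
    then obtain k :: nat where "?\<beta> < frac (real k * a)" "frac (real k * a) < min 1 ?v"
      using Kronecker_between[OF irr, of ?\<beta> "min 1 ?v"] \<beta> by auto
    then show False using upper[of k] by simp
  qed
  ultimately show ?thesis by simp
qed

lemma infinitesimal_arc_combination:
  assumes s: "s \<in> A" and b: "b \<in> A" and sb: "s \<noteq> b"
    and k: "scale_circle m (b - s) = to_circle (of_int k * a)"
  obtains g where "g \<in> carrier (CZ X)" "\<And>\<tau>. state X S \<tau> \<Longrightarrow> \<tau> (cls X S g) = 0"
    "\<And>x x'. x \<in> X \<Longrightarrow> x' \<in> X \<Longrightarrow> H x = H x' \<Longrightarrow> H x \<noteq> s \<Longrightarrow> H x \<noteq> s + to_circle a \<Longrightarrow>
      of_int (g x - g x') = real m * (c b x - c b x')"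
proof -
  let ?\<beta> = "coord (b - s)" and ?s = "s + to_circle a"
  have s': "?s \<in> A" using A_invariant s by simp
  have "to_circle (real m * ?\<beta> - of_int k * frac a) = 0"
  proof -
    have "to_circle (of_int k * frac a) = to_circle (of_int k * a)"
      by (simp add: to_circle_eq_iff frac_def right_diff_distrib)
    moreover have "to_circle (real m * ?\<beta>) = scale_circle m (b - s)"
      by (simp only: scale_circle_to_circle[symmetric] to_circle_coord)
    ultimately show ?thesis using k by (simp add: to_circle_diff)
  qed
  then obtain p where p: "real m * ?\<beta> - of_int k * frac a = of_int p"
    unfolding to_circle_eq_0_iff by (auto elim: Ints_cases)
  \<comment> \<open>The multiple of the successor arc removes the part \<open>k * frac a\<close> of
    \<open>m * ?\<beta>\<close>, and the constant removes the integer \<open>p\<close> that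
    remains.\<close>
  define g where "g = (\<lambda>x. int m * arc s b x + (- k * arc s ?s x + extend0 X (\<lambda>_. - p) x))"
  note CZ = CZ_mult[OF arc_in_CZ[OF s b]] CZ_mult[OF arc_in_CZ[OF s s']]
    extend0_in_CZ[OF continuous_on_const]
  show ?thesis
  proof (rule that)
    show "g \<in> carrier (CZ X)" unfolding g_def by (intro CZ_add CZ)
    fix \<tau> assume \<tau>: "state X S \<tau>"
    have "\<tau> (cls X S (arc s ?s)) = frac a"
      using state_arc_orbit[OF \<tau> s, of 1] by simp
    then have "\<tau> (cls X S g) = real m * ?\<beta> + (of_int (- k) * frac a + of_int (- p))"
      unfolding g_def
      by (subst state_add[OF \<tau> CZ(1) CZ_add[OF CZ(2,3)]], subst state_add[OF \<tau> CZ(2,3)])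
        (simp only: state_mult[OF \<tau> arc_in_CZ[OF s b]] state_mult[OF \<tau> arc_in_CZ[OF s s']]
          state_const[OF \<tau>] state_arc[OF \<tau> s b sb] of_int_of_nat_eq)
    then show "\<tau> (cls X S g) = 0" using p by simp
  next
    fix x x' assume x: "x \<in> X" "x' \<in> X" "H x = H x'" "H x \<noteq> s" "H x \<noteq> ?s"
    \<comment> \<open>Off the fibres over \<open>s\<close> and its successor these terms depend only
      on the common value of \<open>H\<close>, so a jump of \<open>g\<close> comes from
      \<open>c b\<close> alone.\<close>
    have "c s x = c s x'" "c ?s x = c ?s x'"
      using c_off[OF s x(1)] c_off[OF s x(2)] c_off[OF s' x(1)] c_off[OF s' x(2)] x(3-5) by simp_all
    then show "of_int (g x - g x') = real m * (c b x - c b x')"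
      using x by (simp add: g_def of_int_arc s s' b extend0_def algebra_simps)
  qed
qed

end

section \<open>Factor maps between such extensions\<close>

locale split_pair = ext: split_system X S a A H c + fac: split_system Y T a A' K d
  for X :: "'a::metric_space set" and S a A H c and Y :: "'b::metric_space set" and T A' K d +
  assumes A'_subset: "A' \<subseteq> A"
begin

text \<open>Only \<open>t = H x\<close> imposes a real condition; for other \<open>t\<close> both
  sides are the same coordinate by \<open>c_off\<close>. If \<open>H x\<close> is in
  \<open>A'\<close>, the required value 0 or 1 is attained over that point. Uniqueness is
  \<open>separated\<close> in \<open>Y\<close>.\<close>

lemma factor_value_ex1:
  assumes x: "x \<in> X"
  shows "\<exists>!y. y \<in> Y \<and> K y = H x \<and> (\<forall>t\<in>A'. d t y = c t x)"
proof -
  have *: "d t y = c t x" if "t \<in> A'" "y \<in> Y" "K y = H x" "H x \<noteq> t" for t y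
    using that x A'_subset fac.c_off[of t y] ext.c_off[of t x] by auto
  have "\<exists>y. y \<in> Y \<and> K y = H x \<and> (\<forall>t\<in>A'. d t y = c t x)"
  proof (cases "H x \<in> A'")
    case True
    have "c (H x) x = 0 \<or> c (H x) x = 1" using ext.c_at x True A'_subset by blast
    then obtain y where y: "y \<in> Y" "d (H x) y = c (H x) x"
      using fac.c_0_ex[OF True] fac.c_1_ex[OF True] by metis
    then have "K y = H x"
      using fac.H_eqI[OF True y(1)] \<open>c (H x) x = 0 \<or> c (H x) x = 1\<close> by auto
    then show ?thesis using y * by metis
  next
    case False
    obtain y where "y \<in> Y" "K y = H x" using fac.surj_H by (metis UNIV_I imageE)
    then show ?thesis using * False by metis
  qed
  moreover have "y = y'" if "y \<in> Y" "K y = H x" "\<forall>t\<in>A'. d t y = c t x"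
    "y' \<in> Y" "K y' = H x" "\<forall>t\<in>A'. d t y' = c t x" for y y'
    using fac.separated[of y y'] that by metis
  ultimately show ?thesis by (intro ex_ex1I) blast+
qed

definition factor :: "'a \<Rightarrow> 'b"
  where "factor x = (THE y. y \<in> Y \<and> K y = H x \<and> (\<forall>t\<in>A'. d t y = c t x))"

lemma factor:
  assumes "x \<in> X"
  shows "factor x \<in> Y" "K (factor x) = H x" "\<And>t. t \<in> A' \<Longrightarrow> d t (factor x) = c t x"
  using theI'[OF factor_value_ex1[OF assms]] unfolding factor_def by blast+

lemma factor_eqI:
  assumes "x \<in> X" "y \<in> Y" "K y = H x" "\<And>t. t \<in> A' \<Longrightarrow> d t y = c t x"
  shows "factor x = y"
  unfolding factor_def using the1_equality[OF factor_value_ex1[OF assms(1)]] assms by blast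

text \<open>Compactness of \<open>Y\<close> gives limit points of the images. Each satisfies the
  equations that characterise \<open>factor x\<close>, since these pass to limits, and so there is
  only one.\<close>

lemma continuous_factor: "continuous_on X factor"
  unfolding continuous_on_sequentially
proof (intro allI ballI impI)
  fix u x assume x: "x \<in> X" and ux: "(\<forall>n. u n \<in> X) \<and> u \<longlonglongrightarrow> x"
  show "(factor \<circ> u) \<longlonglongrightarrow> factor x"
  proof (rule ccontr)
    assume "\<not> ?thesis"
    then obtain e where e: "e > 0" "\<exists>\<^sub>F n in sequentially. e \<le> dist (factor (u n)) (factor x)"
      unfolding tendsto_iff by (auto simp: not_eventually not_less)
    have "infinite {n. e \<le> dist (factor (u n)) (factor x)}"
      using e(2) by (simp add: cofinite_eq_sequentially[symmetric] frequently_cofinite)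
    from infinite_enumerate[OF this] obtain r :: "nat \<Rightarrow> nat"
      where r: "strict_mono r" "\<And>n. e \<le> dist (factor (u (r n))) (factor x)"
      by auto
    have "\<forall>n. factor (u (r n)) \<in> Y" using factor(1) ux by blast
    then obtain y s where y: "y \<in> Y" and s: "strict_mono s" "((\<lambda>n. factor (u (r n))) \<circ> s) \<longlonglongrightarrow> y"
      using fac.compact_X unfolding compact_def by metis
    have uX: "u n \<in> X" for n using ux by blast
    have lu: "(\<lambda>n. u (r (s n))) \<longlonglongrightarrow> x"
      using LIMSEQ_subseq_LIMSEQ[OF _ strict_mono_o[OF r(1) s(1)], of u x] ux by (simp add: o_def)
    have lf: "(\<lambda>n. factor (u (r (s n)))) \<longlonglongrightarrow> y" using s(2) by (simp add: o_def)
    have eq: "g y = f x" if "continuous_on X f" "continuous_on Y g" "\<And>n. g (factor (u n)) = f (u n)"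
      for f :: "'a \<Rightarrow> 'c::t2_space" and g
    proof -
      have "(\<lambda>n. f (u (r (s n)))) \<longlonglongrightarrow> f x"
        by (rule continuous_on_tendsto_compose[OF that(1) lu x]) (simp add: uX)
      moreover have "(\<lambda>n. g (factor (u (r (s n))))) \<longlonglongrightarrow> g y"
        by (rule continuous_on_tendsto_compose[OF that(2) lf y]) (simp add: uX factor(1))
      ultimately show ?thesis unfolding that(3) by (rule LIMSEQ_unique[rotated])
    qed
    have "factor x = y"
    proof (rule factor_eqI[OF x y])
      show "K y = H x"
        by (rule eq[OF ext.continuous_H fac.continuous_H]) (simp add: factor(2) uX)
      show "d t y = c t x" if "t \<in> A'" for t
        by (rule eq[OF ext.continuous_c fac.continuous_c]) (use that A'_subset in \<open>auto simp: factor(3) uX\<close>)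
    qed
    moreover have "e \<le> dist y (factor x)"
      by (rule Lim_bounded2[OF tendsto_dist[OF lf tendsto_const], of 0]) (use r(2) in auto)
    ultimately show False using e(1) by simp
  qed
qed

lemma factor_S:
  assumes x: "x \<in> X"
  shows "factor (S x) = T (factor x)"
proof (rule factor_eqI)
  show "K (T (factor x)) = H (S x)"
    using fac.H_S ext.H_S x factor by simp
  fix t assume t: "t \<in> A'"
  define s where "s = t - to_circle a"
  have t': "t = s + to_circle a" by (simp add: s_def)
  have s: "s \<in> A'" using fac.A_invariant[of s] t t' by simp
  then show "d t (T (factor x)) = c t (S x)"
    unfolding t' using fac.c_S[OF s factor(1)[OF x]] ext.c_S[of s x] factor(3)[OF x s] x A'_subset by auto
qed (use x factor(1) in auto)

lemma factor_image: "factor ` X = Y"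
proof (intro equalityI subsetI)
  fix y assume y: "y \<in> Y"
  show "y \<in> factor ` X"
  proof (cases "K y \<in> A'")
    case True
    then have A: "K y \<in> A" using A'_subset by blast
    have "d (K y) y = 0 \<or> d (K y) y = 1" using fac.c_at y True by blast
    then obtain x where x: "x \<in> X" "c (K y) x = d (K y) y"
      using ext.c_0_ex[OF A] ext.c_1_ex[OF A] by metis
    then have "H x = K y"
      using ext.H_eqI[OF A x(1)] \<open>d (K y) y = 0 \<or> d (K y) y = 1\<close> by auto
    then have "factor x = y"
      using fac.separated[of "factor x" y] factor[OF x(1)] x y True by metis
    then show ?thesis using x by blast
  next
    case False
    obtain x where x: "x \<in> X" "H x = K y" using ext.surj_H by (metis UNIV_I imageE)
    then have "factor x = y"
      using fac.separated[of "factor x" y] factor[OF x(1)] y False by metis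
    then show ?thesis using x by blast
  qed
qed (use factor(1) in auto)

lemma factor_map_factor: "factor_map X S Y T factor"
  unfolding factor_map_def
  using ext.sys fac.sys continuous_factor factor_image factor_S by blast

text \<open>Glued points share their value of \<open>H\<close> and are told apart by
  \<open>c (H x)\<close>. Over \<open>A'\<close> the factor preserves this function, so no gluing
  happens there.\<close>

lemma nontrivial_fibres_factor:
  assumes "y \<in> nontrivial_fibres X Y factor"
  shows "y \<in> Y" "K y \<in> A - A'"
proof -
  obtain x x' where x: "y \<in> Y" "x \<in> X" "x' \<in> X" "x \<noteq> x'" "factor x = y" "factor x' = y"
    using assms unfolding nontrivial_fibres_def by blast
  then have "H x = K y" "H x' = K y" using factor(2)[of x] factor(2)[of x'] by auto
  then have "K y \<in> A" "c (K y) x \<noteq> c (K y) x'"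
    using ext.separated[of x x'] x by auto
  then show "K y \<in> A - A'" "y \<in> Y" using factor(3)[of x "K y"] factor(3)[of x' "K y"] x by auto
qed

lemma inj_K: "y \<in> Y \<Longrightarrow> y' \<in> Y \<Longrightarrow> K y = K y' \<Longrightarrow> K y \<notin> A' \<Longrightarrow> y = y'"
  using fac.separated by blast

lemma two_A_factor_factor:
  assumes "countable A"
  shows "two_A_factor X S Y T factor"
  unfolding two_A_factor_def
proof (intro conjI ballI factor_map_factor)
  let ?N = "nontrivial_fibres X Y factor"
  have "countable (K ` ?N)"
    by (rule countable_subset[OF _ assms]) (use nontrivial_fibres_factor in blast)
  moreover have "inj_on K ?N"
    by (rule inj_onI) (use inj_K nontrivial_fibres_factor in blast)
  ultimately show "countable ?N" by (rule countable_image_inj_on)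
  fix y assume y: "y \<in> ?N"
  then obtain x x' where x: "x \<in> X" "x' \<in> X" "x \<noteq> x'" "factor x = y" "factor x' = y"
    unfolding nontrivial_fibres_def by blast
  have H: "H x = K y" "H x' = K y" using x factor(2)[of x] factor(2)[of x'] by auto
  have A: "K y \<in> A" using nontrivial_fibres_factor[OF y] by blast
  have c01: "c (K y) z = 0 \<or> c (K y) z = 1" if "z \<in> X" "factor z = y" for z
    using ext.c_at[of z] that A factor(2)[of z] by auto
  \<comment> \<open>\<open>c (K y)\<close> takes only two values on the fibre and is injective
    there, so three distinct points are impossible.\<close>
  have "z = x \<or> z = x'" if z: "z \<in> X" "factor z = y" for z
  proof (rule ccontr)
    assume "\<not> ?thesis"
    moreover have "H z = K y" using z factor(2)[of z] by auto
    ultimately have "c (K y) z \<noteq> c (K y) x" "c (K y) z \<noteq> c (K y) x'" "c (K y) x \<noteq> c (K y) x'"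
      using ext.separated[of z x] ext.separated[of z x'] ext.separated[of x x'] z x H by auto
    then show False using c01[OF z] c01[OF x(1,4)] c01[OF x(2,5)] by auto
  qed
  then have "{z \<in> X. factor z = y} = {x, x'}" using x by auto
  moreover have "asymptotic X S x x'"
    by (rule ext.asymptotic_fibre[OF x(1,2)]) (simp add: H)
  ultimately show "\<exists>x x'. x \<noteq> x' \<and> {z \<in> X. factor z = y} = {x, x'} \<and> asymptotic X S x x'"
    using x(3) by (intro exI conjI)
qed

lemma infinitesimal_for_factor:
  assumes tors: "\<And>b. b \<in> A - A' \<Longrightarrow> \<exists>s\<in>A'. \<exists>k. scale_circle m (b - s) = to_circle (of_int k * a)"
    and m: "m > 0"
    and R: "orbit_representatives Y T (nontrivial_fibres X Y factor) R"
    and pq: "\<And>y. y \<in> R \<Longrightarrow> p y \<noteq> q y \<and> {z \<in> X. factor z = y} = {p y, q y}"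
  shows "infinitesimal_for X S R p q"
proof -
  let ?I = "index_map X S R p q"
  have R_fib: "R \<subseteq> nontrivial_fibres X Y factor" using R by (simp add: orbit_representatives_def)
  have RY: "y \<in> Y" "K y \<in> A" "K y \<notin> A'" if "y \<in> R" for y
    using nontrivial_fibres_factor[of y] R_fib that by auto
  have X: "p y \<in> X" "q y \<in> X" and fpq: "factor (p y) = y" "factor (q y) = y" if "y \<in> R" for y
    using pq[OF that] by auto
  have H: "H (p y) = K y" "H (q y) = K y" if "y \<in> R" for y
    using factor(2)[OF X(1)[OF that]] factor(2)[OF X(2)[OF that]] fpq[OF that] by auto
  have fin: "finite {n. g (zpow X S n (p y)) \<noteq> g (zpow X S n (q y))}"
    if "g \<in> carrier (CZ X)" "y \<in> R" for g y
    using ext.finite_jumps_orbit[OF that(1) X[OF that(2)]] H[OF that(2)] by simp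
  have I: "?I (cls X S f) y = jump_sum X S (p y) (q y) f" if "f \<in> carrier (CZ X)" "y \<in> R" for f y
    by (rule ext.index_map_cls[where f = f and y = y and R = R and p = p and q = q])
      (simp_all only: that X fin)
  have I0: "?I u y = 0" if "y \<notin> R" for u y
    using that by (simp add: index_map_def)
  \<comment> \<open>\<open>K\<close> is injective away from \<open>A'\<close>, so a rotation
    carrying \<open>K y\<close> to \<open>K y'\<close> lifts to the orbit of \<open>y\<close> in
    \<open>Y\<close>. Uniqueness of representatives and irrationality finish.\<close>
  have orbit_unique: "n = 0 \<and> y = y'"
    if y: "y \<in> R" "y' \<in> R" and eq: "K y + to_circle (of_int n * a) = K y'" for y y' n
  proof -
    have "K (zpow Y T n y) = K y'" using fac.H_zpow[OF RY(1)[OF y(1)]] eq by simp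
    then have "zpow Y T n y = y'" using inj_K[of "zpow Y T n y" y'] RY y by simp
    then have "y' \<in> orbit Y T y" by (auto simp: orbit_def)
    moreover have "y \<in> orbit Y T y"
      unfolding orbit_def by (rule CollectI, rule exI[of _ 0]) (simp add: zpow_def)
    moreover have "\<exists>!r. r \<in> R \<and> r \<in> orbit Y T y"
      using R R_fib y(1) by (auto simp: orbit_representatives_def)
    ultimately have "y = y'" using y by blast
    moreover from this have "K y + to_circle (of_int n * a) = K y + to_circle (of_int 0 * a)"
      using eq by (simp add: to_circle_0)
    then have "n = 0" by (rule of_int_mult_irrational_inj[OF ext.irr])
    ultimately show ?thesis by simp
  qed
  \<comment> \<open>The sign records which of the two points over \<open>y\<close> was listed first;
    since its square is 1, multiplying by it again cancels it.\<close>
  define \<sigma> :: "'b \<Rightarrow> int" where "\<sigma> y = (if c (K y) (p y) < c (K y) (q y) then - 1 else 1)" for y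
  have \<sigma>: "of_int (\<sigma> y) = c (K y) (p y) - c (K y) (q y)" "\<sigma> y * \<sigma> y = 1" if "y \<in> R" for y
  proof -
    have "c (K y) (p y) \<noteq> c (K y) (q y)"
      using ext.separated[OF X[OF that]] H[OF that] pq[OF that] by auto
    then have "(c (K y) (p y) = 0 \<and> c (K y) (q y) = 1) \<or> (c (K y) (p y) = 1 \<and> c (K y) (q y) = 0)"
      using ext.c_at[of "p y"] ext.c_at[of "q y"] X[OF that] H[OF that] RY(2)[OF that] by auto
    then show "of_int (\<sigma> y) = c (K y) (p y) - c (K y) (q y)" "\<sigma> y * \<sigma> y = 1"
      by (auto simp: \<sigma>_def)
  qed
  have "\<exists>g. g \<in> carrier (CZ X) \<and> (\<forall>\<tau>. state X S \<tau> \<longrightarrow> \<tau> (cls X S g) = 0) \<and>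
      (\<forall>y\<in>R. jump_sum X S (p y) (q y) g = (if y = y' then int m * \<sigma> y else 0))"
    if y': "y' \<in> R" for y'
  proof -
    obtain s k where s: "s \<in> A'" "scale_circle m (K y' - s) = to_circle (of_int k * a)"
      using tors[of "K y'"] RY[OF y'] by blast
    have sA: "s \<in> A" "s \<noteq> K y'" using s A'_subset RY[OF y'] by auto
    obtain g where g: "g \<in> carrier (CZ X)" "\<And>\<tau>. state X S \<tau> \<Longrightarrow> \<tau> (cls X S g) = 0"
      "\<And>x x'. x \<in> X \<Longrightarrow> x' \<in> X \<Longrightarrow> H x = H x' \<Longrightarrow> H x \<noteq> s \<Longrightarrow> H x \<noteq> s + to_circle a \<Longrightarrow>
        of_int (g x - g x') = real m * (c (K y') x - c (K y') x')"
      using ext.infinitesimal_arc_combination[OF sA(1) RY(2)[OF y'] sA(2) s(2)] by blast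
    have "jump_sum X S (p y) (q y) g = (if y = y' then int m * \<sigma> y else 0)" if y: "y \<in> R" for y
    proof -
      have "g (zpow X S n (p y)) - g (zpow X S n (q y)) = (if n = 0 then (if y = y' then int m * \<sigma> y else 0) else 0)"
        (is "?l n = ?r n") for n
      proof -
        let ?x = "zpow X S n (p y)" and ?x' = "zpow X S n (q y)"
        have x: "?x \<in> X" "?x' \<in> X" using X[OF y] by auto
        have Hx: "H ?x = K y + to_circle (of_int n * a)" "H ?x' = K y + to_circle (of_int n * a)"
          using X[OF y] H[OF y] ext.H_zpow by auto
        \<comment> \<open>\<open>A'\<close> is invariant and misses \<open>K y\<close>, so the orbit
          avoids \<open>s\<close> and its successor and the compensating arcs contribute
          nothing.\<close>
        have "H ?x \<notin> A'" using fac.A_invariant_int[of "K y" n] RY(3)[OF y] by (simp only: Hx simp_thms)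
        moreover have "s + to_circle a \<in> A'" using s(1) fac.A_invariant[of s] by (simp only: simp_thms)
        ultimately have ne: "H ?x \<noteq> s" "H ?x \<noteq> s + to_circle a" using s(1) by metis+
        have "of_int (?l n) = real m * (c (K y') ?x - c (K y') ?x')"
          by (rule g(3)[OF x _ ne]) (simp only: Hx)
        also have "\<dots> = of_int (?r n)"
        proof (cases "K y + to_circle (of_int n * a) = K y'")
          case True
          then have n: "n = 0" "y = y'" using orbit_unique[OF y y'] by blast+
          then show ?thesis using \<sigma>(1)[OF y] by (simp add: zpow_def)
        next
          case False
          then have "\<not> (n = 0 \<and> y = y')" by (auto simp: to_circle_0)
          moreover have "c (K y') ?x = c (K y') ?x'"
            using ext.c_off[OF RY(2)[OF y'] x(1)] ext.c_off[OF RY(2)[OF y'] x(2)] Hx False by simp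
          ultimately show ?thesis by auto
        qed
        finally show ?thesis by linarith
      qed
      then show ?thesis unfolding jump_sum_def by simp
    qed
    then show ?thesis using g(1,2) by blast
  qed
  then obtain g where g: "\<And>y. y \<in> R \<Longrightarrow> g y \<in> carrier (CZ X)"
    "\<And>y \<tau>. y \<in> R \<Longrightarrow> state X S \<tau> \<Longrightarrow> \<tau> (cls X S (g y)) = 0"
    "\<And>y y'. y' \<in> R \<Longrightarrow> y \<in> R \<Longrightarrow> jump_sum X S (p y) (q y) (g y') = (if y = y' then int m * \<sigma> y else 0)"
    by metis
  \<comment> \<open>A nonzero index forces a jump of \<open>f\<close> somewhere over the orbit of
    \<open>K y\<close>. Distinct representatives have disjoint orbits, so choosing one jump for each
    injects them into the finite set \<open>P\<close>.\<close>
  have finI: "finite {y. ?I u y \<noteq> 0}" if "u \<in> carrier (coinvariants X S)" for u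
  proof -
    obtain f where f: "f \<in> carrier (CZ X)" "u = cls X S f"
      using \<open>u \<in> carrier (coinvariants X S)\<close> unfolding ext.carrier_coinvariants by blast
    define P where "P = {t. \<exists>x\<in>X. \<exists>y\<in>X. H x = t \<and> H y = t \<and> f x \<noteq> f y}"
    have "\<exists>n. K y + to_circle (of_int n * a) \<in> P" if "?I u y \<noteq> 0" for y
    proof -
      have y: "y \<in> R" using I0 that by blast
      then have "jump_sum X S (p y) (q y) f \<noteq> 0" using I[OF f(1)] that f(2) by simp
      then obtain n where "f (zpow X S n (p y)) - f (zpow X S n (q y)) \<noteq> 0"
        unfolding jump_sum_def by (rule Sum_any.not_neutral_obtains_not_neutral)
      then have "K y + to_circle (of_int n * a) \<in> P"
        unfolding P_def
        by (intro CollectI bexI[of _ "zpow X S n (p y)"] bexI[of _ "zpow X S n (q y)"])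
          (use X[OF y] H[OF y] ext.H_zpow in auto)
      then show ?thesis ..
    qed
    then obtain n where n: "\<And>y. ?I u y \<noteq> 0 \<Longrightarrow> K y + to_circle (of_int (n y) * a) \<in> P" by metis
    let ?h = "\<lambda>y. K y + to_circle (of_int (n y) * a)"
    have "finite (?h ` {y. ?I u y \<noteq> 0})"
    proof (rule finite_subset)
      show "finite P" unfolding P_def using ext.finite_jumps f(1) by simp
    qed (use n in blast)
    moreover have "inj_on ?h {y. ?I u y \<noteq> 0}"
    proof (rule inj_onI)
      fix y y' assume y: "y \<in> {y. ?I u y \<noteq> 0}" "y' \<in> {y. ?I u y \<noteq> 0}" and eq: "?h y = ?h y'"
      have "K y + to_circle (of_int (n y - n y') * a) = ?h y - to_circle (of_int (n y') * a)"
        by (simp add: left_diff_distrib to_circle_diff)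
      also have "\<dots> = K y'" unfolding eq by simp
      finally show "y = y'" using orbit_unique I0 y by blast
    qed
    ultimately show ?thesis by (rule finite_imageD)
  qed
  have "\<exists>n>0. (\<lambda>y. int n * ?I u y) \<in> ?I ` Inf_subgroup X S" if u: "u \<in> carrier (coinvariants X S)" for u
  proof (intro exI[of _ m] conjI m)
    define Q where "Q = {y. ?I u y \<noteq> 0}"
    have Q: "finite Q" "Q \<subseteq> R" using finI[OF u] I0 by (auto simp: Q_def)
    \<comment> \<open>The function \<open>g y\<close> has index \<open>m * \<sigma> y\<close> at
      \<open>y\<close> and 0 at the other representatives, so these coefficients give exactly
      \<open>m\<close> times the index of \<open>u\<close>.\<close>
    define G where "G = (\<lambda>x. \<Sum>y\<in>Q. (?I u y * \<sigma> y) * g y x)"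
    have gQ: "(\<lambda>x. (?I u y * \<sigma> y) * g y x) \<in> carrier (CZ X)" if "y \<in> Q" for y
      by (rule CZ_mult) (use g(1) Q that in blast)
    have G: "G \<in> carrier (CZ X)" unfolding G_def by (rule CZ_sum) (rule gQ)
    have "\<tau> (cls X S G) = 0" if \<tau>: "state X S \<tau>" for \<tau>
    proof -
      have "\<tau> (cls X S G) = (\<Sum>y\<in>Q. \<tau> (cls X S (\<lambda>x. (?I u y * \<sigma> y) * g y x)))"
        unfolding G_def by (rule ext.state_sum[OF \<tau> Q(1) gQ])
      also have "\<dots> = 0"
      proof (rule sum.neutral, rule ballI)
        fix y assume "y \<in> Q"
        then have "y \<in> R" using Q by blast
        then show "\<tau> (cls X S (\<lambda>x. (?I u y * \<sigma> y) * g y x)) = 0"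
          by (subst ext.state_mult[OF \<tau> g(1)]) (simp_all add: g(2)[OF _ \<tau>])
      qed
      finally show ?thesis .
    qed
    then have "cls X S G \<in> Inf_subgroup X S" using ext.Inf_subgroup_iff[OF G] by blast
    moreover have "?I (cls X S G) y = int m * ?I u y" for y
    proof (cases "y \<in> R")
      case True
      have "?I (cls X S G) y = jump_sum X S (p y) (q y) G" by (rule I[OF G True])
      also have "\<dots> = (\<Sum>y'\<in>Q. (?I u y' * \<sigma> y') * jump_sum X S (p y) (q y) (g y'))"
        unfolding G_def by (rule jump_sum_linear[OF Q(1)], rule fin[OF g(1) True]) (use Q in blast)
      also have "\<dots> = (\<Sum>y'\<in>Q. if y = y' then (?I u y * \<sigma> y) * (int m * \<sigma> y) else 0)"
        by (rule sum.cong) (use Q g(3)[OF _ True] in auto)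
      also have "\<dots> = (if y \<in> Q then (?I u y * \<sigma> y) * (int m * \<sigma> y) else 0)"
        by (simp add: Q(1))
      also have "(?I u y * \<sigma> y) * (int m * \<sigma> y) = int m * ?I u y * (\<sigma> y * \<sigma> y)" by (simp only: mult_ac)
      also have "\<dots> = int m * ?I u y" using \<sigma>(2)[OF True] by simp
      finally show ?thesis by (simp add: Q_def)
    next
      case False
      then show ?thesis by (simp add: I0)
    qed
    ultimately show "(\<lambda>y. int m * ?I u y) \<in> ?I ` Inf_subgroup X S"
      by (intro image_eqI[of _ _ "cls X S G"]) auto
  qed
  then show ?thesis using finI unfolding infinitesimal_for_def Let_def by blast
qed

theorem two_AI_factor_factor:
  assumes "countable A" "m > 0"
    and "\<And>b. b \<in> A - A' \<Longrightarrow> \<exists>s\<in>A'. \<exists>k. scale_circle m (b - s) = to_circle (of_int k * a)"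
  shows "two_AI_factor X S Y T factor"
  unfolding two_AI_factor_def
  using two_A_factor_factor[OF assms(1)] infinitesimal_for_factor[OF assms(3,2)] by blast

end

text \<open>There are no nontrivial fibres, so the only set of representatives is empty and the
  index map vanishes. This provides the second leg of a common extension.\<close>

lemma two_AI_factor_id:
  assumes "system X S"
  shows "two_AI_factor X S X S id"
proof -
  interpret dynamical_system X S by unfold_locales (rule assms)
  have B: "nontrivial_fibres X X id = {}" by (auto simp: nontrivial_fibres_def)
  have "infinitesimal_for X S {} p q" for p q
  proof -
    have I: "index_map X S {} p q u = (\<lambda>_. 0)" for u by (auto simp: index_map_def)
    then show ?thesis
      unfolding infinitesimal_for_def Let_def using zero_in_Inf by (auto simp: I image_iff)
  qed
  then show ?thesis
    using assms unfolding two_AI_factor_def two_A_factor_def factor_map_def B orbit_representatives_def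
    by (auto intro: continuous_on_id)
qed

text \<open>Passing to a power multiplies the angle but leaves the split points alone, so the same
  \<open>A\<close>, \<open>H\<close> and \<open>c\<close> serve; \<open>A\<close> merely breaks into
  more orbits.\<close>

lemma (in split_system) split_system_funpow:
  assumes "m > 0"
  shows "split_system X (S ^^ m) (real m * a) A H c"
proof -
  have z: "(S ^^ m) x = zpow X S (int m) x" for x by (simp add: zpow_def)
  show ?thesis
  proof unfold_locales
    show "system X (S ^^ m)" by (rule system_funpow)
    show "real m * a \<notin> \<rat>"
    proof
      assume "real m * a \<in> \<rat>"
      then have "real m * a / real m \<in> \<rat>" by (rule Rats_divide) simp
      then show False using irr assms by simp
    qed
    show "H ((S ^^ m) x) = H x + to_circle (real m * a)" if "x \<in> X" for x
      using H_zpow[OF that, of "int m"] by (simp add: z)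
    show "t + to_circle (real m * a) \<in> A \<longleftrightarrow> t \<in> A" for t
      using A_invariant_int[of t "int m"] by simp
    show "c (t + to_circle (real m * a)) ((S ^^ m) x) = c t x" if "t \<in> A" "x \<in> X" for t x
      using c_zpow[OF that, of "int m"] by (simp add: z)
  qed (fact continuous_H continuous_c c_ge_0 c_le_1 to_circle_c separated c_0_ex c_1_ex | use separated in blast)+
qed

section \<open>Sturmian systems\<close>

lemma compact_unit_cube: "compact (PiE UNIV (\<lambda>_::'i. {0..1::real}))"
proof -
  have "compactin (product_topology (\<lambda>_::'i. euclidean) UNIV) (PiE UNIV (\<lambda>_. {0..1::real}))"
    by (simp add: compactin_PiE)
  then show ?thesis by (simp add: euclidean_product_topology)
qed

lemma inv_shift: "inv_into UNIV shift = (\<lambda>x n. x (n - 1))"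
  by (rule inv_equality) (auto simp: shift_def)

lemma zpow_shift: "zpow UNIV shift k x = (\<lambda>n. x (n + k))"
proof -
  have "(shift ^^ j) x = (\<lambda>n. x (n + int j))" for j
    by (induction j) (auto simp: shift_def algebra_simps)
  moreover have "((\<lambda>x n. x (n - 1)) ^^ j) x = (\<lambda>n. x (n - int j))" for j
    by (induction j) (auto simp: algebra_simps)
  ultimately show ?thesis by (simp add: zpow_def inv_shift)
qed

lemma continuous_on_coordinate: "continuous_on S (\<lambda>x. x i :: 'b::topological_space)"
  by (rule continuous_on_subset[OF continuous_on_product_coordinates]) simp

lemma continuous_on_translate:
  "continuous_on S (\<lambda>x n. x (n + k :: int) :: 'b::topological_space)"
  by (intro continuous_on_coordinatewise_then_product continuous_on_coordinate)

section \<open>Coordinate sequences and their 0-1 coding\<close>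

context
  fixes a :: real assumes irr: "a \<notin> \<rat>"
begin

definition coords :: "circle \<Rightarrow> int \<Rightarrow> real"
  where "coords t = (\<lambda>n. coord (t + to_circle (of_int n * a)))"

text \<open>A model of the circle split along the orbit of 0. The closure adds limits from the left,
  in which a coordinate that would be 0 equals 1.\<close>

definition coords_space :: "(int \<Rightarrow> real) set"
  where "coords_space = closure (range (\<lambda>k. coords (to_circle (of_int k * a))))"

text \<open>Since \<open>frac u + frac a - frac (u + a)\<close> is \<open>1\<close> if \<open>frac u \<ge> 1 - frac a\<close> and \<open>0\<close> otherwise,
  \<open>coding\<close> reads off the itinerary of a point from its orbit.\<close>

definition coding :: "(int \<Rightarrow> real) \<Rightarrow> int \<Rightarrow> real"
  where "coding x = (\<lambda>n. frac a + x n - x (n + 1))"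

lemma coords_translate: "(\<lambda>n. coords t (n + k)) = coords (t + to_circle (of_int k * a))"
  by (auto simp: coords_def fun_eq_iff distrib_right to_circle_add algebra_simps)

lemma coding_translate: "coding (\<lambda>n. x (n + k)) = (\<lambda>n. coding x (n + k))"
  by (auto simp: coding_def fun_eq_iff algebra_simps)

lemma coding_coords_0: "coding (coords 0) = sturmian_point (to_circle a)"
proof
  fix n
  let ?u = "of_int n * a"
  have "of_int n * frac a = ?u - of_int (n * \<lfloor>a\<rfloor>)"
    by (simp add: frac_def algebra_simps)
  then have 1: "frac (of_int n * frac a) = frac ?u"
    using frac_cong[of "of_int n * frac a" ?u] by simp
  have 2: "frac (of_int (n + 1) * a) = (if frac ?u + frac a < 1 then frac ?u + frac a else frac ?u + frac a - 1)"
    by (simp add: distrib_right frac_add)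
  show "coding (coords 0) n = sturmian_point (to_circle a) n"
    unfolding coding_def coords_def sturmian_point_def coord_to_circle add_0 1 2
    by (auto simp: not_less)
qed

lemma translate_coords_space:
  assumes "x \<in> coords_space"
  shows "(\<lambda>n. x (n + k)) \<in> coords_space"
proof -
  have "(\<lambda>x n. x (n + k)) ` coords_space \<subseteq> coords_space"
    unfolding coords_space_def
  proof (rule image_closure_subset[OF continuous_on_translate closed_closure])
    show "(\<lambda>x n. x (n + k)) ` range (\<lambda>k. coords (to_circle (of_int k * a)))
        \<subseteq> closure (range (\<lambda>k. coords (to_circle (of_int k * a))))"
    proof safe
      fix j
      have "(\<lambda>n. coords (to_circle (of_int j * a)) (n + k)) = coords (to_circle (of_int (j + k) * a))"
        by (simp add: coords_translate distrib_right to_circle_add)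
      also have "\<dots> \<in> range (\<lambda>k. coords (to_circle (of_int k * a)))" by (rule rangeI)
      finally show "(\<lambda>n. coords (to_circle (of_int j * a)) (n + k))
          \<in> closure (range (\<lambda>k. coords (to_circle (of_int k * a))))"
        by (rule subsetD[OF closure_subset])
    qed
  qed
  then show ?thesis using assms by blast
qed

lemma coords_space_subset_cube: "coords_space \<subseteq> PiE UNIV (\<lambda>_. {0..1})"
  unfolding coords_space_def
proof (rule closure_minimal)
  show "range (\<lambda>k. coords (to_circle (of_int k * a))) \<subseteq> PiE UNIV (\<lambda>_. {0..1})"
    by (auto simp: coords_def coord_bounds less_imp_le)
  show "closed (PiE UNIV (\<lambda>_::int. {0..1::real}))"
    by (rule compact_imp_closed[OF compact_unit_cube])
qed

lemma coords_space_bounds: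
  assumes "x \<in> coords_space"
  shows "0 \<le> x n" "x n \<le> 1"
  using coords_space_subset_cube assms by (auto simp: PiE_iff)

lemma compact_coords_space: "compact coords_space"
proof -
  have "compact (PiE UNIV (\<lambda>_::int. {0..1::real}) \<inter> coords_space)"
    by (rule compact_Int_closed[OF compact_unit_cube]) (simp add: coords_space_def)
  then show ?thesis using coords_space_subset_cube by (simp add: Int_absorb1)
qed

text \<open>The condition is closed and holds on the defining orbit. It says that the coordinate at
  0 already determines all others modulo 1.\<close>

lemma to_circle_coords_space:
  assumes "x \<in> coords_space"
  shows "to_circle (x n) = to_circle (x 0) + to_circle (of_int n * a)"
proof -
  have "coords_space \<subseteq> {x. to_circle (x n) = to_circle (x 0) + to_circle (of_int n * a)}"
    unfolding coords_space_def
  proof (rule closure_minimal)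
    show "closed {x. to_circle (x n) = to_circle (x 0) + to_circle (of_int n * a)}"
      by (intro closed_Collect_eq continuous_intros continuous_on_coordinate)
  qed (auto simp: coords_def to_circle_0)
  then show ?thesis using assms by blast
qed

lemma continuous_coding: "continuous_on S coding"
  unfolding coding_def
  by (intro continuous_on_coordinatewise_then_product continuous_intros continuous_on_coordinate)

text \<open>Equal codings keep \<open>x n - y n\<close> constant. If this constant \<open>e\<close>
  were positive, \<open>y n\<close> could never exceed \<open>1 - e\<close>, since
  \<open>x n\<close> is at most 1; but density of the rotation orbit brings some \<open>y k\<close>
  within \<open>e / 2\<close> of \<open>1 - e / 2\<close>, hence above \<open>1 - e\<close>.\<close>

lemma coding_offset_nonpos:
  assumes x: "x \<in> coords_space" and y: "y \<in> coords_space" and eq: "coding x = coding y"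
  shows "x 0 \<le> y 0"
proof (rule ccontr)
  define e where "e = x 0 - y 0"
  assume "\<not> ?thesis"
  then have e: "0 < e" "e \<le> 1"
    using coords_space_bounds[OF x, of 0] coords_space_bounds[OF y, of 0] by (auto simp: e_def)
  have step: "x (n + 1) - y (n + 1) = x n - y n" for n
    using fun_cong[OF eq, of n] by (simp add: coding_def)
  have diff: "x (int n) - y (int n) = e" for n
    by (induction n) (use step[of "int _"] in \<open>auto simp: e_def add.commute\<close>)
  have "to_circle (1 - e / 2) \<in> closure (range (\<lambda>k::nat. to_circle (y 0) + to_circle (real k * a)))"
    by (simp add: rotation_orbit_dense[OF irr])
  then obtain k :: nat where "dist (to_circle (y 0) + to_circle (real k * a)) (to_circle (1 - e / 2)) < e / 2"
    unfolding closure_approachable using half_gt_zero[OF e(1)] by (auto dest!: spec[of _ "e / 2"])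
  then have k: "dist (to_circle (1 - e / 2)) (to_circle (y (int k))) < e / 2"
    using to_circle_coords_space[OF y, of "int k"] by (simp add: dist_commute)
  obtain z where z: "to_circle z = to_circle (y (int k))"
    "\<bar>(1 - e / 2) - z\<bar> = dist (to_circle (1 - e / 2)) (to_circle (y (int k)))"
    by (rule dist_to_circleE)
  have z': "1 - e < z" "z < 1" using k z(2) by linarith+
  then have "coord (to_circle (y (int k))) = z" using z(1) e by (intro coord_eqI) auto
  then have "frac (y (int k)) = z" by simp
  moreover have "y (int k) \<le> 1 - e"
    using diff[of k] coords_space_bounds[OF x, of "int k"] by linarith
  moreover have "y (int k) = frac (y (int k))"
    using calculation(2) coords_space_bounds[OF y, of "int k"] e by (intro frac_eq[THEN iffD2, symmetric]) auto
  ultimately show False using z' by linarith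
qed

lemma inj_coding: "inj_on coding coords_space"
proof (rule inj_onI)
  fix x y assume xy: "x \<in> coords_space" "y \<in> coords_space" "coding x = coding y"
  show "x = y"
  proof
    fix n
    have "coding (\<lambda>j. x (j + n)) = coding (\<lambda>j. y (j + n))" using xy(3) by (simp add: coding_translate)
    then show "x n = y n"
      using coding_offset_nonpos[OF translate_coords_space[OF xy(1)] translate_coords_space[OF xy(2)]]
        coding_offset_nonpos[OF translate_coords_space[OF xy(2)] translate_coords_space[OF xy(1)]]
      by (metis add_0 order_antisym)
  qed
qed

lemma orbit_sturmian_point:
  "orbit UNIV shift (sturmian_point (to_circle a)) = coding ` range (\<lambda>k. coords (to_circle (of_int k * a)))"
proof -
  have "zpow UNIV shift k (sturmian_point (to_circle a)) = coding (coords (to_circle (of_int k * a)))" for k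
    using coords_translate[of 0 k] coding_translate[of "coords 0" k]
    by (simp add: zpow_shift coding_coords_0)
  then show ?thesis unfolding orbit_def by auto
qed

lemma coding_coords_space: "coding ` coords_space = sturmian_space (to_circle a)"
proof
  show "coding ` coords_space \<subseteq> sturmian_space (to_circle a)"
    unfolding coords_space_def sturmian_space_def orbit_sturmian_point
    by (rule image_closure_subset[OF continuous_coding closed_closure closure_subset])
  have "closed (coding ` coords_space)"
    by (intro compact_imp_closed compact_continuous_image continuous_coding compact_coords_space)
  moreover have "coding ` range (\<lambda>k. coords (to_circle (of_int k * a))) \<subseteq> coding ` coords_space"
    unfolding coords_space_def by (rule image_mono[OF closure_subset])
  ultimately show "sturmian_space (to_circle a) \<subseteq> coding ` coords_space"
    unfolding sturmian_space_def orbit_sturmian_point by (rule closure_minimal[rotated])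
qed

section \<open>The inverse coding and the split structure\<close>

definition decode :: "(int \<Rightarrow> real) \<Rightarrow> int \<Rightarrow> real"
  where "decode = the_inv_into coords_space coding"

lemma decode_in: "y \<in> sturmian_space (to_circle a) \<Longrightarrow> decode y \<in> coords_space"
  and coding_decode: "y \<in> sturmian_space (to_circle a) \<Longrightarrow> coding (decode y) = y"
  unfolding decode_def coding_coords_space[symmetric]
  by (rule the_inv_into_into[OF inj_coding _ subset_refl], assumption)
    (rule f_the_inv_into_f[OF inj_coding])

lemma decode_coding: "x \<in> coords_space \<Longrightarrow> decode (coding x) = x"
  unfolding decode_def by (rule the_inv_into_f_f[OF inj_coding])

lemma continuous_decode: "continuous_on (sturmian_space (to_circle a)) decode"
  unfolding decode_def coding_coords_space[symmetric]
  by (rule continuous_on_inv_into[OF continuous_coding compact_coords_space inj_coding])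

lemma translate_sturmian_space:
  assumes "y \<in> sturmian_space (to_circle a)"
  shows "(\<lambda>n. y (n + k)) \<in> sturmian_space (to_circle a)"
    and "decode (\<lambda>n. y (n + k)) = (\<lambda>n. decode y (n + k))"
proof -
  have "coding (\<lambda>n. decode y (n + k)) = (\<lambda>n. y (n + k))"
    by (simp add: coding_translate coding_decode[OF assms])
  moreover have "(\<lambda>n. decode y (n + k)) \<in> coords_space"
    by (rule translate_coords_space[OF decode_in[OF assms]])
  ultimately show "(\<lambda>n. y (n + k)) \<in> sturmian_space (to_circle a)"
    "decode (\<lambda>n. y (n + k)) = (\<lambda>n. decode y (n + k))"
    using coding_coords_space decode_coding by (metis imageI, metis)
qed

lemma system_sturmian: "system (sturmian_space (to_circle a)) shift"
  unfolding system_def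
proof (intro conjI exI)
  let ?X = "sturmian_space (to_circle a)"
  show "compact ?X"
    unfolding coding_coords_space[symmetric]
    by (intro compact_continuous_image continuous_coding compact_coords_space)
  show "?X \<noteq> {}"
    unfolding sturmian_space_def orbit_sturmian_point by auto
  have sub: "shift ` ?X \<subseteq> ?X" "(\<lambda>x n. x (n + - 1)) ` ?X \<subseteq> ?X"
    using translate_sturmian_space(1) by (auto simp: shift_def simp del: add_uminus_conv_diff)
  have "homeomorphism ?X ?X shift (\<lambda>x n. x (n + - 1))"
  proof (rule homeomorphismI)
    show "continuous_on ?X shift" unfolding shift_def by (rule continuous_on_translate)
    show "continuous_on ?X (\<lambda>x n. x (n + - 1))" by (rule continuous_on_translate)
  qed (use sub in \<open>auto simp: shift_def\<close>)
  then show "homeomorphism ?X ?X shift (\<lambda>x n. x (n + - 1))" .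
qed

definition orbit_index :: "circle \<Rightarrow> int"
  where "orbit_index t = (THE k. to_circle (of_int k * a) = t)"

lemma orbit_index: "orbit_index (to_circle (of_int k * a)) = k"
  unfolding orbit_index_def
  by (rule the_equality) (use of_int_mult_irrational_inj[OF irr, of 0] in auto)

text \<open>\<open>coord\<close> itself never takes the value 1. It is a limit of fractional parts
  along the orbit, and compactness makes the limit an actual coordinate.\<close>

lemma exists_coords_0_eq_1: "\<exists>x\<in>coords_space. x 0 = 1"
proof -
  have "closed ((\<lambda>x. x 0) ` coords_space)"
    by (intro compact_imp_closed compact_continuous_image compact_coords_space
        continuous_on_coordinate)
  moreover have "range (\<lambda>n. frac (real n * a)) \<subseteq> (\<lambda>x. x 0) ` coords_space"
  proof safe
    fix n :: nat
    have "coords (to_circle (of_int (int n) * a)) \<in> coords_space"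
      unfolding coords_space_def by (rule subsetD[OF closure_subset]) (rule rangeI)
    then show "frac (real n * a) \<in> (\<lambda>x. x 0) ` coords_space"
      by (rule rev_image_eqI) (simp add: coords_def to_circle_0)
  qed
  ultimately have "closure (range (\<lambda>n. frac (real n * a))) \<subseteq> (\<lambda>x. x 0) ` coords_space"
    by (rule closure_minimal[rotated])
  then have "1 \<in> (\<lambda>x. x 0) ` coords_space" unfolding Kronecker_approx_1[OF irr] by auto
  then show ?thesis by force
qed

text \<open>For \<open>t\<close> the \<open>k\<close>-th point of the orbit of 0, the coordinate
  with index \<open>- k\<close> is the position \<open>k\<close> steps earlier, which modulo 1 is
  the position relative to \<open>t\<close>.\<close>

theorem split_system_sturmian:
  "split_system (sturmian_space (to_circle a)) shift a (range (\<lambda>k. to_circle (of_int k * a)))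
    (\<lambda>y. to_circle (decode y 0)) (\<lambda>t y. decode y (- orbit_index t))"
proof unfold_locales
  let ?X = "sturmian_space (to_circle a)" and ?A = "range (\<lambda>k. to_circle (of_int k * a))"
  have cont: "continuous_on ?X (\<lambda>y. decode y n)" for n
    by (rule continuous_on_product_then_coordinatewise[OF continuous_decode])
  show "system ?X shift" by (rule system_sturmian)
  show "a \<notin> \<rat>" by (rule irr)
  show "continuous_on ?X (\<lambda>y. to_circle (decode y 0))"
    by (intro continuous_intros cont)
  have dec_shift: "decode (shift y) = (\<lambda>n. decode y (n + 1))" if "y \<in> ?X" for y
    unfolding shift_def by (rule translate_sturmian_space(2)[OF that])
  show "to_circle (decode (shift y) 0) = to_circle (decode y 0) + to_circle a" if "y \<in> ?X" for y
    using to_circle_coords_space[OF decode_in[OF that], of 1] by (simp add: dec_shift[OF that])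
  have A: "to_circle (of_int k * a) + to_circle a = to_circle (of_int (k + 1) * a)" for k
    by (simp add: distrib_right to_circle_add)
  show "t + to_circle a \<in> ?A \<longleftrightarrow> t \<in> ?A" for t
  proof
    assume "t + to_circle a \<in> ?A"
    then obtain k where "t + to_circle a = to_circle (of_int k * a)" by auto
    then have "t = to_circle (of_int (k - 1) * a)"
      by (simp add: left_diff_distrib to_circle_diff algebra_simps)
    then show "t \<in> ?A" by (rule range_eqI)
  next
    assume "t \<in> ?A"
    then obtain k where "t = to_circle (of_int k * a)" by auto
    then show "t + to_circle a \<in> ?A" using A[of k] by (intro range_eqI[of _ _ "k + 1"]) simp
  qed
  show "continuous_on ?X (\<lambda>y. decode y (- orbit_index t))" for t by (rule cont)
  show "0 \<le> decode y (- orbit_index t)" "decode y (- orbit_index t) \<le> 1" if "y \<in> ?X" for t y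
    using coords_space_bounds[OF decode_in[OF that]] by auto
  show "to_circle (decode y (- orbit_index t)) = to_circle (decode y 0) - t"
    if "t \<in> ?A" "y \<in> ?X" for t y
    using to_circle_coords_space[OF decode_in[OF that(2)], of "- orbit_index t"] that(1)
    by (auto simp: orbit_index to_circle_minus)
  show "decode (shift y) (- orbit_index (t + to_circle a)) = decode y (- orbit_index t)"
    if "t \<in> ?A" "y \<in> ?X" for t y
    using that(1) by (auto simp: dec_shift[OF that(2)] A orbit_index simp del: of_int_add)
  show "\<exists>y\<in>?X. decode y (- orbit_index t) = 0" if "t \<in> ?A" for t
  proof -
    obtain k where t: "t = to_circle (of_int k * a)" using \<open>t \<in> ?A\<close> by auto
    have x: "coords t \<in> coords_space"
      unfolding coords_space_def t by (rule subsetD[OF closure_subset]) (rule rangeI)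
    have "coords t (- k) = 0"
      by (simp add: coords_def t to_circle_add[symmetric] coord_eq_0_iff to_circle_minus)
    then show ?thesis
      using x coding_coords_space decode_coding[OF x] by (intro bexI[of _ "coding (coords t)"]) (auto simp: t orbit_index)
  qed
  show "\<exists>y\<in>?X. decode y (- orbit_index t) = 1" if "t \<in> ?A" for t
  proof -
    obtain k where t: "t = to_circle (of_int k * a)" using \<open>t \<in> ?A\<close> by auto
    obtain x where x: "x \<in> coords_space" "x 0 = 1" using exists_coords_0_eq_1 by blast
    have x': "(\<lambda>n. x (n + k)) \<in> coords_space" by (rule translate_coords_space[OF x(1)])
    show ?thesis
      using x' coding_coords_space decode_coding[OF x'] x(2)
      by (intro bexI[of _ "coding (\<lambda>n. x (n + k))"]) (auto simp: t orbit_index)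
  qed
  show "to_circle (decode x 0) \<in> ?A \<and>
      decode x (- orbit_index (to_circle (decode x 0))) \<noteq> decode y (- orbit_index (to_circle (decode x 0)))"
    if xy: "x \<in> ?X" "y \<in> ?X" "to_circle (decode x 0) = to_circle (decode y 0)" "x \<noteq> y" for x y
  proof -
    have "decode x \<noteq> decode y" using coding_decode xy by metis
    then obtain n where n: "decode x n \<noteq> decode y n" by blast
    have "to_circle (decode x n) = to_circle (decode y n)"
      using to_circle_coords_space[OF decode_in[OF xy(1)], of n]
        to_circle_coords_space[OF decode_in[OF xy(2)], of n] xy(3) by simp
    then have fr: "frac (decode x n) = frac (decode y n)" using coord_to_circle by metis
    \<comment> \<open>Two different numbers in \<open>[0,1]\<close> that agree modulo 1 are 0 and 1.
      Hence the orbit passes through 0 at time \<open>n\<close>, which places the base point on the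
      orbit of 0.\<close>
    have "decode x n = 1 \<or> decode y n = 1"
    proof (rule ccontr)
      assume "\<not> ?thesis"
      then have "frac (decode x n) = decode x n" "frac (decode y n) = decode y n"
        using coords_space_bounds[OF decode_in[OF xy(1)], of n]
          coords_space_bounds[OF decode_in[OF xy(2)], of n] by (auto simp: frac_eq less_le)
      then show False using fr n by simp
    qed
    then have "frac (decode x n) = 0" using fr by (metis frac_1)
    then have "to_circle (decode x n) = 0" by (simp add: to_circle_eq_0_iff)
    then have "to_circle (decode x 0) + to_circle (of_int n * a) = 0"
      using to_circle_coords_space[OF decode_in[OF xy(1)], of n] by simp
    then have t: "to_circle (decode x 0) = to_circle (of_int (- n) * a)"
      by (simp add: to_circle_minus eq_neg_iff_add_eq_0)
    show ?thesis unfolding t orbit_index using n by (intro conjI rangeI) simp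
  qed
qed

end

text \<open>A single elementary step suffices: the system with the \<open>m\<close>-th power of the
  shift extends itself by the identity and the other system by \<open>factor\<close>. The torsion
  condition holds with \<open>s = 0\<close>.\<close>

theorem sturmian_two_AI_equivalent:
  assumes irr: "irrational \<alpha>" and m: "m > 0"
  shows "two_AI_equivalent (sturmian_space (scale_circle m \<alpha>), shift) (sturmian_space \<alpha>, shift ^^ m)"
proof -
  define a where "a = coord \<alpha>"
  have \<alpha>: "\<alpha> = to_circle a" "a \<notin> \<rat>" using irr by (auto simp: a_def irrational_def)
  have m\<alpha>: "scale_circle m \<alpha> = to_circle (real m * a)" by (simp add: \<alpha> scale_circle_to_circle)
  note X = split_system.split_system_funpow[OF split_system_sturmian[OF \<alpha>(2)] m]
  have irrm: "real m * a \<notin> \<rat>" using X by (simp add: split_system_def split_system_axioms_def)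
  let ?A = "range (\<lambda>k. to_circle (of_int k * a))" and ?A' = "range (\<lambda>k. to_circle (of_int k * (real m * a)))"
  have sub: "?A' \<subseteq> ?A"
  proof safe
    fix k
    have "to_circle (of_int k * (real m * a)) = to_circle (of_int (k * int m) * a)" by (simp add: mult.assoc)
    then show "to_circle (of_int k * (real m * a)) \<in> ?A" by (rule range_eqI)
  qed
  interpret split_pair "sturmian_space \<alpha>" "shift ^^ m" "real m * a" ?A
    "\<lambda>y. to_circle (decode a y 0)" "\<lambda>t y. decode a y (- orbit_index a t)"
    "sturmian_space (scale_circle m \<alpha>)" shift ?A'
    "\<lambda>y. to_circle (decode (real m * a) y 0)" "\<lambda>t y. decode (real m * a) y (- orbit_index (real m * a) t)"
    using X split_system_sturmian[OF irrm] sub unfolding m\<alpha> unfolding \<alpha>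
    by (auto simp: split_pair_def split_pair_axioms_def)
  have "two_AI_factor (sturmian_space \<alpha>) (shift ^^ m) (sturmian_space (scale_circle m \<alpha>)) shift factor"
  proof (rule two_AI_factor_factor[OF _ m])
    show "\<exists>s\<in>?A'. \<exists>k. scale_circle m (b - s) = to_circle (of_int k * (real m * a))" if "b \<in> ?A - ?A'" for b
    proof -
      obtain k where b: "b = to_circle (of_int k * a)" using \<open>b \<in> ?A - ?A'\<close> by auto
      have "0 \<in> ?A'" by (rule range_eqI[of _ _ 0]) (simp add: to_circle_0)
      moreover have "scale_circle m (b - 0) = to_circle (of_int k * (real m * a))"
        by (simp add: b scale_circle_to_circle mult.left_commute)
      ultimately show ?thesis by blast
    qed
  qed auto
  moreover have "two_AI_factor (sturmian_space \<alpha>) (shift ^^ m) (sturmian_space \<alpha>) (shift ^^ m) id"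
    by (rule two_AI_factor_id[OF ext.sys])
  ultimately have "common_two_AI_extension (sturmian_space (scale_circle m \<alpha>), shift) (sturmian_space \<alpha>, shift ^^ m)"
    unfolding common_two_AI_extension_def fst_conv snd_conv by blast
  then show ?thesis unfolding two_AI_equivalent_def by (rule r_into_equivclp)
qed

section \<open>Lifts of semiconjugacies to rotations\<close>

lemma continuous_on_circleI:
  fixes f :: "circle \<Rightarrow> 'b::metric_space"
  assumes "continuous_on UNIV (\<lambda>x. f (to_circle x))"
  shows "continuous_on UNIV f"
  unfolding continuous_on_iff
proof (intro ballI allI impI)
  fix t :: circle and e :: real assume "e > 0"
  then obtain d where d: "d > 0" "\<And>x. dist x (coord t) < d \<Longrightarrow> dist (f (to_circle x)) (f (to_circle (coord t))) < e"
    using assms unfolding continuous_on_iff by (meson UNIV_I)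
  show "\<exists>d>0. \<forall>s\<in>UNIV. dist s t < d \<longrightarrow> dist (f s) (f t) < e"
  proof (intro exI[of _ d] conjI ballI impI d(1))
    fix s assume s: "dist s t < d"
    obtain x where x: "to_circle x = s" "\<bar>coord t - x\<bar> = dist (to_circle (coord t)) s"
      by (rule dist_to_circleE)
    have "dist x (coord t) < d" using s x(2) by (simp add: dist_real_def dist_commute abs_minus_commute)
    from d(2)[OF this] show "dist (f s) (f t) < e" by (simp add: x(1))
  qed
qed

text \<open>In complex coordinates the map from the contractible real line has a continuous
  logarithm; its imaginary part divided by \<open>2 * pi\<close> is the lift.\<close>

lemma circle_map_lift_ex:
  assumes "continuous_on UNIV H"
  obtains h where "is_lift h H"
proof -
  define \<iota> where "\<iota> t = cis (2 * pi * coord t)" for t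
  have \<iota>: "\<iota> (to_circle x) = cis (2 * pi * x)" for x
  proof -
    have "cis (2 * pi * x) = cis (2 * pi * frac x) * cis (2 * pi * of_int \<lfloor>x\<rfloor>)"
      by (simp add: cis_mult frac_def algebra_simps)
    also have "cis (2 * pi * of_int \<lfloor>x\<rfloor>) = 1" by (rule cis_multiple_2pi) simp
    finally show ?thesis by (simp add: \<iota>_def)
  qed
  have "continuous_on UNIV \<iota>"
    by (rule continuous_on_circleI) (simp add: \<iota>, intro continuous_intros)
  then have "continuous_on UNIV (\<lambda>x. \<iota> (H (to_circle x)))"
    using continuous_on_compose2[OF assms continuous_on_to_circle[of UNIV]]
    by (auto intro: continuous_on_compose2)
  moreover have "contractible (UNIV :: real set)" by (rule convex_imp_contractible) simp
  ultimately obtain g where g: "continuous_on UNIV g" "\<And>x. \<iota> (H (to_circle x)) = exp (g x)"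
    by (rule continuous_logarithm_on_contractible) (auto simp: \<iota>_def)
  have "to_circle (Im (g x) / (2 * pi)) = H (to_circle x)" for x
  proof -
    have "exp (Re (g x)) = 1"
      using arg_cong[OF g(2)[of x], of norm] by (simp add: \<iota>_def)
    then have "cis (Im (g x)) = cis (2 * pi * coord (H (to_circle x)))"
      using g(2)[of x] by (simp add: \<iota>_def exp_eq_polar)
    then have "sin (Im (g x)) = sin (2 * pi * coord (H (to_circle x)))
        \<and> cos (Im (g x)) = cos (2 * pi * coord (H (to_circle x)))"
      by (simp add: complex_eq_iff)
    then obtain n :: int where "Im (g x) = 2 * pi * coord (H (to_circle x)) + 2 * pi * of_int n"
      unfolding sin_cos_eq_iff by auto
    then have "Im (g x) / (2 * pi) = coord (H (to_circle x)) + of_int n"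
      by (simp add: field_simps)
    then show ?thesis by (simp add: to_circle_add)
  qed
  then have "is_lift (\<lambda>x. Im (g x) / (2 * pi)) H"
    unfolding is_lift_def using g(1) by (auto intro!: continuous_intros)
  then show ?thesis by (rule that)
qed

lemma continuous_Ints_const:
  fixes g :: "real \<Rightarrow> real"
  assumes "continuous_on UNIV g" "\<And>x. g x \<in> \<int>"
  obtains k :: int where "\<And>x. g x = of_int k"
proof -
  obtain k where k: "g 0 = of_int k" using assms(2)[of 0] by (auto elim: Ints_cases)
  have "g x = g 0" for x
  proof (rule ccontr)
    assume "g x \<noteq> g 0"
    moreover have "connected (range g)"
      by (rule connected_continuous_image[OF assms(1) connected_UNIV])
    ultimately have "uncountable (range g)" by (intro connected_uncountable[of _ "g x" "g 0"]) auto
    moreover have "countable (range g)"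
      by (rule countable_subset[of _ \<int>]) (use assms(2) in \<open>auto simp: Ints_def\<close>)
    ultimately show False by blast
  qed
  then show ?thesis using k that by metis
qed

text \<open>\<open>E\<close> stands for the preimage in the line of the minimal set, and
  \<open>recurrent\<close> is what minimality provides. The condition \<open>n > 0\<close> there
  guarantees that \<open>h\<close> moves by a nonzero amount.\<close>

locale semiconjugacy_lift =
  fixes f h :: "real \<Rightarrow> real" and r :: real and E :: "real set"
  assumes strict_mono_f: "strict_mono f"
    and continuous_f: "continuous_on UNIV f"
    and f_1: "f (x + 1) = f x + 1"
    and continuous_h: "continuous_on UNIV h"
    and h_1: "h (x + 1) = h x + 1"
    and h_f: "h (f x) = h x + r"
    and r_irrational: "r \<notin> \<rat>"
    and rotation_number: "(\<lambda>n. (f ^^ n) x / real n) \<longlonglongrightarrow> r"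
    and closed_E: "closed E"
    and E_nonempty: "E \<noteq> {}"
    and E_1: "x + 1 \<in> E \<longleftrightarrow> x \<in> E"
    and E_f: "f x \<in> E \<longleftrightarrow> x \<in> E"
    and recurrent: "z \<in> E \<Longrightarrow> w \<in> E \<Longrightarrow> e > 0 \<Longrightarrow> \<exists>n>0. \<exists>p::int. \<bar>(f ^^ n) z + of_int p - w\<bar> < e"
begin

lemma f_int: "f (x + of_int p) = f x + of_int p"
proof (induction p rule: int_induct[where k = 0])
  case (step1 i)
  then show ?case using f_1[of "x + of_int i"] by (simp add: add.assoc)
next
  case (step2 i)
  then show ?case using f_1[of "x + of_int (i - 1)"] by simp
qed simp

lemma h_int: "h (x + of_int p) = h x + of_int p"
proof (induction p rule: int_induct[where k = 0])
  case (step1 i)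
  then show ?case using h_1[of "x + of_int i"] by (simp add: add.assoc)
next
  case (step2 i)
  then show ?case using h_1[of "x + of_int (i - 1)"] by simp
qed simp

lemma E_int: "x + of_int p \<in> E \<longleftrightarrow> x \<in> E"
proof (induction p rule: int_induct[where k = 0])
  case (step1 i)
  then show ?case using E_1[of "x + of_int i"] by (simp add: add.assoc)
next
  case (step2 i)
  then show ?case using E_1[of "x + of_int (i - 1)"] by simp
qed simp

lemma funpow_int: "(f ^^ n) (x + of_int p) = (f ^^ n) x + of_int p"
  by (induction n) (auto simp: f_int)

lemma h_funpow: "h ((f ^^ n) x) = h x + real n * r"
  by (induction n) (auto simp: h_f algebra_simps)

lemma E_funpow: "(f ^^ n) x \<in> E \<longleftrightarrow> x \<in> E"
  by (induction n) (auto simp: E_f)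

lemma strict_mono_funpow: "strict_mono (f ^^ n)"
  using strict_mono_f by (induction n) (auto simp: strict_mono_def)

lemma surj_f: "surj f"
proof -
  have "\<exists>x. f x = y" for y
  proof -
    define k where "k = \<lfloor>y - f 0\<rfloor>"
    have "f (of_int k) \<le> y" "y \<le> f (of_int k + 1)"
      using f_int[of 0 k] f_int[of 0 "k + 1"] unfolding k_def by (simp_all, linarith+)
    then show ?thesis
      using IVT'[of f "of_int k" y "of_int k + 1"] continuous_on_subset[OF continuous_f] by auto
  qed
  then show ?thesis by (metis surjI)
qed

lemma surj_funpow: "surj (f ^^ n)"
proof (induction n)
  case (Suc n)
  from comp_surj[OF this surj_f] show ?case by (simp only: funpow.simps)
qed simp

section \<open>Monotonicity of the semiconjugacy from recurrence\<close>

lemma translation_nonzero: "n > 0 \<Longrightarrow> real n * r + of_int p \<noteq> 0"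
proof
  assume n: "n > 0" and "real n * r + of_int p = 0"
  then have "of_int (int n) * r = of_int (- p)" by simp
  then have "of_int (int n) * r \<in> \<int>" by simp
  from irrational_mult_Ints[OF r_irrational this] show False using n by simp
qed

lemma no_periodic: "n > 0 \<Longrightarrow> (f ^^ n) z + of_int p \<noteq> z"
proof
  assume n: "n > 0" and eq: "(f ^^ n) z + of_int p = z"
  from arg_cong[OF eq, of h] have "real n * r + of_int p = 0"
    by (simp add: h_int h_funpow)
  then show False using translation_nonzero[OF n] by blast
qed

text \<open>As \<open>f\<close> is increasing, the inequality at \<open>z\<close> iterates: after
  \<open>n * k\<close> steps the point plus \<open>k * p\<close> is still at least \<open>z\<close>.
  Dividing by \<open>n * k\<close> bounds the rotation number below by \<open>- p / n\<close>, and
  irrationality excludes equality.\<close>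

lemma translation_pos:
  assumes n: "n > 0" and z: "(f ^^ n) z + of_int p > z"
  shows "real n * r + of_int p > 0"
proof -
  have ge: "(f ^^ (n * k)) z + of_int (int k * p) \<ge> z" for k
  proof (induction k)
    case (Suc k)
    have "(f ^^ (n * Suc k)) z + of_int (int (Suc k) * p)
        = (f ^^ n) ((f ^^ (n * k)) z + of_int (int k * p)) + of_int p"
      by (simp only: funpow_int mult_Suc_right funpow_add comp_apply) (simp add: algebra_simps)
    also have "\<dots> \<ge> (f ^^ n) z + of_int p"
      using Suc strict_mono_less_eq[OF strict_mono_funpow] by simp
    finally show ?case using z by simp
  qed simp
  have "strict_mono (\<lambda>k. n * Suc k)" using n by (auto simp: strict_mono_def)
  from LIMSEQ_subseq_LIMSEQ[OF rotation_number this]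
  have lim: "(\<lambda>k. (f ^^ (n * Suc k)) z / real (n * Suc k)) \<longlonglongrightarrow> r" by (simp add: o_def)
  have "(\<lambda>k. z / real n * inverse (real (Suc k)) - of_int p / real n) \<longlonglongrightarrow> z / real n * 0 - of_int p / real n"
    by (intro tendsto_intros LIMSEQ_inverse_real_of_nat)
  moreover have "z / real n * inverse (real (Suc k)) - of_int p / real n \<le> (f ^^ (n * Suc k)) z / real (n * Suc k)" for k
  proof -
    have "z / real n * inverse (real (Suc k)) - of_int p / real n = (z - of_int (int (Suc k) * p)) / real (n * Suc k)"
    proof -
      have "(z - of_int (int (Suc k) * p)) / real (n * Suc k)
          = (z - real (Suc k) * of_int p) / (real n * real (Suc k))"
        by (simp only: of_int_mult of_int_of_nat_eq of_nat_mult)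
      also have "\<dots> = z / real n * inverse (real (Suc k)) - of_int p / real n"
        using n by (simp add: field_simps del: of_nat_Suc)
      finally show ?thesis by simp
    qed
    also have "\<dots> \<le> (f ^^ (n * Suc k)) z / real (n * Suc k)"
      using ge[of "Suc k"] by (intro divide_right_mono) linarith+
    finally show ?thesis .
  qed
  ultimately have "z / real n * 0 - of_int p / real n \<le> r"
    by (intro LIMSEQ_le[OF _ lim]) auto
  then have "real n * r + of_int p \<ge> 0" using n by (simp add: field_simps)
  then show ?thesis using translation_nonzero[OF n, of p] by linarith
qed

text \<open>Some translated iterate of \<open>u\<close> lies so near \<open>v\<close> that it is to
  the right of \<open>u\<close>, so \<open>translation_pos\<close> raises its \<open>h\<close>-value
  above \<open>h u\<close>. If \<open>h v\<close> were smaller than \<open>h u\<close>, continuity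
  at \<open>v\<close> would put that value below \<open>h u\<close>.\<close>

lemma h_mono_on_E:
  assumes u: "u \<in> E" and v: "v \<in> E" and uv: "u < v"
  shows "h u \<le> h v"
proof (rule ccontr)
  assume "\<not> ?thesis"
  then have "0 < h u - h v" by simp
  then obtain d where d: "d > 0" "\<And>y. dist y v < d \<Longrightarrow> dist (h y) (h v) < h u - h v"
    using continuous_h unfolding continuous_on_iff by (meson UNIV_I)
  obtain n and p :: int where n: "n > 0" "\<bar>(f ^^ n) u + of_int p - v\<bar> < min d (v - u)"
    using recurrent[OF u v, of "min d (v - u)"] d(1) uv by auto
  define y where "y = (f ^^ n) u + of_int p"
  have "y > u" using n(2) by (auto simp: y_def)
  then have "h y > h u" using translation_pos[OF n(1)] by (simp add: y_def h_int h_funpow)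
  moreover have "dist (h y) (h v) < h u - h v"
    by (rule d(2)) (use n(2) in \<open>simp add: y_def dist_real_def\<close>)
  then have "h y < h u" by (simp add: dist_real_def abs_less_iff)
  ultimately show False by simp
qed

lemma h_uniformly_continuous:
  assumes "e > 0"
  obtains d where "d > 0" "\<And>x y. \<bar>x - y\<bar> < d \<Longrightarrow> \<bar>h x - h y\<bar> < e"
proof -
  have "uniformly_continuous_on {-1..2} h"
    by (intro compact_uniformly_continuous continuous_on_subset[OF continuous_h]) auto
  then obtain d where d: "d > 0"
    "\<And>x y. x \<in> {-1..2} \<Longrightarrow> y \<in> {-1..2} \<Longrightarrow> dist y x < d \<Longrightarrow> dist (h y) (h x) < e"
    using assms unfolding uniformly_continuous_on_def by meson
  show ?thesis
  proof (rule that[of "min d 1"])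
    fix x y :: real assume xy: "\<bar>x - y\<bar> < min d 1"
    define p where "p = - \<lfloor>x\<rfloor>"
    have "0 \<le> x + of_int p" "x + of_int p < 1" unfolding p_def by (simp_all, linarith)
    then have "dist (h (y + of_int p)) (h (x + of_int p)) < e"
      using xy by (intro d(2)) (auto simp: dist_real_def)
    then show "\<bar>h x - h y\<bar> < e" by (simp add: h_int dist_real_def abs_minus_commute)
  qed (use d(1) in simp)
qed

text \<open>The iterates of a gap are pairwise disjoint modulo \<open>1\<close>, so their lengths cannot stay
  bounded below.\<close>

lemma gap_shrinks:
  assumes a: "a \<in> E" and gap: "{a<..<b} \<inter> E = {}" and e: "e > 0"
  shows "\<exists>n. (f ^^ n) b - (f ^^ n) a < e"
proof (rule ccontr)
  assume "\<not> ?thesis"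
  then have big: "(f ^^ n) b - (f ^^ n) a \<ge> e" for n by (meson not_less)
  \<comment> \<open>Left ends of the iterated gaps, reduced to the unit interval.\<close>
  define P where "P n = (f ^^ n) a + of_int (- \<lfloor>(f ^^ n) a\<rfloor>)" for n
  have P01: "0 \<le> P n" "P n < 1" for n unfolding P_def by (simp_all, linarith)
  have PE: "P n \<in> E" for n unfolding P_def E_int E_funpow by (rule a)
  \<comment> \<open>The interval of length \<open>e\<close> to the right of \<open>P n\<close> lies
    in a translate of an iterated gap, whereas \<open>P k\<close> belongs to
    \<open>E\<close>.\<close>
  have not_between: False if "P n < P k" "P k < P n + e" for n k
  proof -
    obtain y where y: "(f ^^ n) y = P k - of_int (- \<lfloor>(f ^^ n) a\<rfloor>)"
      using surj_funpow[of n] by (metis surjE)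
    then have "(f ^^ n) a < (f ^^ n) y" "(f ^^ n) y < (f ^^ n) b"
      using that big[of n] by (auto simp: P_def)
    then have "y \<in> {a<..<b}" using strict_mono_less[OF strict_mono_funpow[of n]] by auto
    moreover have "(f ^^ n) y + of_int (- \<lfloor>(f ^^ n) a\<rfloor>) \<in> E" using y PE[of k] by simp
    then have "y \<in> E" unfolding E_int E_funpow .
    ultimately show False using gap by blast
  qed
  \<comment> \<open>Pigeonhole on cells of width \<open>e\<close>: two left ends in one cell are
    closer than \<open>e\<close>.\<close>
  have "\<lfloor>P n / e\<rfloor> \<in> {0..\<lfloor>1 / e\<rfloor>}" for n
  proof -
    have "P n / e \<le> 1 / e" using P01(2)[of n] e by (intro divide_right_mono) auto
    then show ?thesis using P01(1)[of n] e by (simp add: floor_mono)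
  qed
  then have "(\<lambda>n. \<lfloor>P n / e\<rfloor>) ` UNIV \<subseteq> {0..\<lfloor>1 / e\<rfloor>}"
    by (rule image_subsetI)
  then have fin: "finite ((\<lambda>n. \<lfloor>P n / e\<rfloor>) ` UNIV)" by (rule finite_subset) simp
  have "\<not> inj (\<lambda>n. \<lfloor>P n / e\<rfloor>)"
  proof
    assume "inj (\<lambda>n. \<lfloor>P n / e\<rfloor>)"
    from finite_imageD[OF fin this] show False by simp
  qed
  then obtain i j where ij: "i \<noteq> j" "\<lfloor>P i / e\<rfloor> = \<lfloor>P j / e\<rfloor>" unfolding inj_def by blast
  define n k where "n = min i j" and "k = max i j"
  have nk: "n < k" "\<lfloor>P n / e\<rfloor> = \<lfloor>P k / e\<rfloor>"
    using ij by (auto simp: n_def k_def min_def max_def)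
  then have "\<bar>P n / e - P k / e\<bar> < 1" by linarith
  then have close: "\<bar>P n - P k\<bar> < e" using e by (simp add: diff_divide_distrib[symmetric] divide_less_eq)
  have "P n \<noteq> P k"
  proof
    assume eq: "P n = P k"
    have "(f ^^ (k - n)) ((f ^^ n) a) = (f ^^ k) a"
      using nk(1) funpow_add[of "k - n" n f] by simp
    then have "(f ^^ (k - n)) ((f ^^ n) a) + of_int (\<lfloor>(f ^^ n) a\<rfloor> - \<lfloor>(f ^^ k) a\<rfloor>) = (f ^^ n) a"
      using eq by (simp add: P_def)
    moreover have "k - n > 0" using nk(1) by simp
    ultimately show False using no_periodic by blast
  qed
  then show False using not_between[of n k] not_between[of k n] close by linarith
qed

text \<open>The difference of \<open>h\<close> at two points does not change along their orbits,
  while the images of the gap become shorter than any modulus of continuity.\<close>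

lemma gap_constant:
  assumes a: "a \<in> E" and gap: "{a<..<b} \<inter> E = {}" and x: "a \<le> x" "x \<le> b"
  shows "h x = h a"
proof (rule ccontr)
  assume "h x \<noteq> h a"
  then have "\<bar>h x - h a\<bar> > 0" by simp
  then obtain d where d: "d > 0" "\<And>u v. \<bar>u - v\<bar> < d \<Longrightarrow> \<bar>h u - h v\<bar> < \<bar>h x - h a\<bar>"
    by (rule h_uniformly_continuous) blast
  obtain n where n: "(f ^^ n) b - (f ^^ n) a < d" using gap_shrinks[OF a gap d(1)] by blast
  have "(f ^^ n) a \<le> (f ^^ n) x" "(f ^^ n) x \<le> (f ^^ n) b"
    using x strict_mono_less_eq[OF strict_mono_funpow[of n]] by auto
  then have "\<bar>(f ^^ n) x - (f ^^ n) a\<bar> < d" using n by linarith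
  from d(2)[OF this] show False by (simp add: h_funpow)
qed

lemma left_end:
  obtains a where "a \<in> E" "a \<le> x" "{a<..x} \<inter> E = {}"
proof -
  let ?S = "E \<inter> {..x}"
  obtain z where "z \<in> E" using E_nonempty by blast
  then have "z + of_int \<lfloor>x - z\<rfloor> \<in> ?S" using E_int by (simp, linarith)
  then have ne: "?S \<noteq> {}" by blast
  have bdd: "bdd_above ?S" by (rule bdd_aboveI[of _ x]) simp
  have "Sup ?S \<in> ?S"
    by (rule closed_contains_Sup[OF ne bdd]) (intro closed_Int closed_E closed_atMost)
  moreover have "{Sup ?S<..x} \<inter> E = {}"
    using cSup_upper[OF _ bdd] by (auto simp: not_less[symmetric])
  ultimately show ?thesis by (intro that[of "Sup ?S"]) auto
qed

lemma right_end:
  obtains b where "b \<in> E" "x \<le> b" "{x..<b} \<inter> E = {}"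
proof -
  let ?S = "E \<inter> {x..}"
  obtain z where "z \<in> E" using E_nonempty by blast
  then have "z + of_int (\<lfloor>x - z\<rfloor> + 1) \<in> ?S" using E_int[of z "\<lfloor>x - z\<rfloor> + 1"] by (simp, linarith)
  then have ne: "?S \<noteq> {}" by blast
  have bdd: "bdd_below ?S" by (rule bdd_belowI[of _ x]) simp
  have "Inf ?S \<in> ?S"
    by (rule closed_contains_Inf[OF ne bdd]) (intro closed_Int closed_E closed_atLeast)
  moreover have "{x..<Inf ?S} \<inter> E = {}"
    using cInf_lower[OF _ bdd] by (auto simp: not_less[symmetric])
  ultimately show ?thesis by (intro that[of "Inf ?S"]) auto
qed

lemma gapE:
  assumes "x \<notin> E"
  obtains a b where "a \<in> E" "b \<in> E" "a < x" "x < b" "{a<..<b} \<inter> E = {}"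
    "\<And>y. a \<le> y \<Longrightarrow> y \<le> b \<Longrightarrow> h y = h x"
proof -
  obtain a where a: "a \<in> E" "a \<le> x" "{a<..x} \<inter> E = {}" by (rule left_end)
  obtain b where b: "b \<in> E" "x \<le> b" "{x..<b} \<inter> E = {}" by (rule right_end)
  have ab: "a < x" "x < b" using a b assms by (auto simp: less_le)
  have gap: "{a<..<b} \<inter> E = {}"
  proof -
    have "{a<..<b} \<subseteq> {a<..x} \<union> {x..<b}" by auto
    then show ?thesis using a(3) b(3) by blast
  qed
  have "h y = h x" if "a \<le> y" "y \<le> b" for y
    using gap_constant[OF a(1) gap that] gap_constant[OF a(1) gap, of x] ab by simp
  then show ?thesis using that a b ab gap by blast
qed

text \<open>Either both points lie in one gap, where \<open>h\<close> is constant, or each can be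
  moved to the end of its gap facing the other without changing \<open>h\<close>. This reduces the
  claim to points of \<open>E\<close>.\<close>

lemma mono_h: "mono h"
proof (rule monoI)
  fix x y :: real assume xy: "x \<le> y"
  show "h x \<le> h y"
  proof (cases "{x..y} \<inter> E = {}")
    case True
    then have "x \<notin> E" using xy by auto
    then obtain a b where ab: "a \<in> E" "b \<in> E" "a < x" "x < b"
      "\<And>y. a \<le> y \<Longrightarrow> y \<le> b \<Longrightarrow> h y = h x"
      using gapE by metis
    have "b \<notin> {x..y}" using True ab(2) by blast
    then have "h y = h x" using ab(3,4) xy by (intro ab(5)) auto
    then show ?thesis by simp
  next
    case False
    have x': "\<exists>x'\<in>E. x \<le> x' \<and> h x' = h x \<and> {x..<x'} \<inter> E = {}"
    proof (cases "x \<in> E")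
      case False
      then obtain a b where ab: "b \<in> E" "a < x" "x < b" "{a<..<b} \<inter> E = {}"
        "\<And>y. a \<le> y \<Longrightarrow> y \<le> b \<Longrightarrow> h y = h x" by (rule gapE) blast
      have "{x..<b} \<subseteq> {a<..<b}" using ab(2) by auto
      then have "{x..<b} \<inter> E = {}" using ab(4) by blast
      moreover have "h b = h x" using ab(2,3) by (intro ab(5)) auto
      ultimately show ?thesis using ab(1,3) less_imp_le by blast
    qed auto
    have y': "\<exists>y'\<in>E. y' \<le> y \<and> h y' = h y \<and> {y'<..y} \<inter> E = {}"
    proof (cases "y \<in> E")
      case False
      then obtain a b where ab: "a \<in> E" "a < y" "y < b" "{a<..<b} \<inter> E = {}"
        "\<And>z. a \<le> z \<Longrightarrow> z \<le> b \<Longrightarrow> h z = h y" by (rule gapE) blast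
      have "{a<..y} \<subseteq> {a<..<b}" using ab(3) by auto
      then have "{a<..y} \<inter> E = {}" using ab(4) by blast
      moreover have "h a = h y" using ab(2,3) by (intro ab(5)) auto
      ultimately show ?thesis using ab(1,2) less_imp_le by blast
    qed auto
    from x' obtain x' where x': "x' \<in> E" "x \<le> x'" "h x' = h x" "{x..<x'} \<inter> E = {}" by blast
    from y' obtain y' where y': "y' \<in> E" "y' \<le> y" "h y' = h y" "{y'<..y} \<inter> E = {}" by blast
    obtain z where z: "z \<in> E" "x \<le> z" "z \<le> y" using False by auto
    have "x' \<le> z" using x'(4) z by (force simp: disjoint_iff)
    moreover have "z \<le> y'" using y'(4) z by (force simp: disjoint_iff)
    ultimately have "h x' \<le> h y'" using h_mono_on_E[OF x'(1) y'(1)] by (cases "x' = y'") auto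
    then show ?thesis using x'(3) y'(3) by simp
  qed
qed

text \<open>A translated iterate of \<open>z\<close> returns into the plateau and has the same
  \<open>h\<close>-value, although \<open>h\<close> must have moved by a nonzero amount.\<close>

lemma E_not_in_plateau:
  assumes z: "z \<in> E" and uv: "u < z" "z < v" "h u = h v"
  shows False
proof -
  obtain n and p :: int where n: "n > 0" "\<bar>(f ^^ n) z + of_int p - z\<bar> < min (z - u) (v - z)"
    using recurrent[OF z z, of "min (z - u) (v - z)"] uv by auto
  define y where "y = (f ^^ n) z + of_int p"
  have "u \<le> y" "y \<le> v" using n(2) by (auto simp: y_def)
  then have "h y = h u" using monoD[OF mono_h, of u y] monoD[OF mono_h, of y v] uv(3) by simp
  moreover have "h z = h u" using monoD[OF mono_h, of u z] monoD[OF mono_h, of z v] uv by simp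
  ultimately have "real n * r + of_int p = 0" by (simp add: y_def h_int h_funpow)
  then show False using translation_nonzero[OF n(1)] by blast
qed

text \<open>The circle cut open at \<open>e\<close> and measured by \<open>h\<close>. For
  \<open>e\<close> in a gap of \<open>E\<close> this becomes the function \<open>c t\<close> with
  \<open>t\<close> the image of \<open>h e\<close>.\<close>

definition cut :: "real \<Rightarrow> real \<Rightarrow> real"
  where "cut e x = h (e + frac (x - e)) - h e"

lemma cut_bounds: "0 \<le> cut e x" "cut e x \<le> 1"
  using monoD[OF mono_h, of e "e + frac (x - e)"] monoD[OF mono_h, of "e + frac (x - e)" "e + 1"]
    h_1[of e] frac_ge_0[of "x - e"] frac_lt_1[of "x - e"] by (auto simp: cut_def)

lemma cut_Ints: "cut e x - (h x - h e) \<in> \<int>"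
proof -
  have "e + frac (x - e) = x + of_int (- \<lfloor>x - e\<rfloor>)" by (simp add: frac_def)
  then have "cut e x - (h x - h e) = of_int (- \<lfloor>x - e\<rfloor>)"
    by (simp add: cut_def h_int[of x "- \<lfloor>x - e\<rfloor>", simplified])
  then show ?thesis by simp
qed

lemma cut_eqI:
  assumes "y - x \<in> \<int>" "e \<le> y" "y < e + 1"
  shows "cut e x = h y - h e"
proof -
  have "(x - e) - (y - e) = - (y - x)" by simp
  then have "(x - e) - (y - e) \<in> \<int>" using Ints_minus[OF assms(1)] by simp
  then have "frac (x - e) = frac (y - e)" by (rule frac_cong)
  also have "\<dots> = y - e" using assms by (simp add: frac_eq)
  finally show ?thesis by (simp add: cut_def)
qed

lemma representative_in_E:
  assumes "x \<in> E" "e \<notin> E"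
  shows "e + frac (x - e) \<in> E" "e < e + frac (x - e)" "e + frac (x - e) < e + 1"
    "e + frac (x - e) - x \<in> \<int>"
proof -
  have eq: "e + frac (x - e) = x + of_int (- \<lfloor>x - e\<rfloor>)" by (simp add: frac_def)
  show *: "e + frac (x - e) \<in> E" unfolding eq E_int by (rule assms(1))
  then show "e < e + frac (x - e)" using assms(2) frac_ge_0[of "x - e"] by (cases "frac (x - e) = 0") auto
  show "e + frac (x - e) < e + 1" using frac_lt_1[of "x - e"] by simp
  show "e + frac (x - e) - x \<in> \<int>" unfolding eq by simp
qed

lemma cut_translate: "cut (e + of_int p) x = cut e x"
proof -
  have "frac (x - (e + of_int p)) = frac (x - e)" by (rule frac_cong) simp
  moreover have "e + of_int p + frac (x - e) = (e + frac (x - e)) + of_int p" by simp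
  ultimately show ?thesis unfolding cut_def by (simp only: h_int)
qed

text \<open>No point of \<open>E\<close> lies between the two base points, since \<open>h\<close> is
  constant there. So one representative of \<open>x\<close> serves both cuts.\<close>

lemma cut_same_gap_le:
  assumes x: "x \<in> E" and e: "e \<notin> E" "e' \<notin> E" "e \<le> e'" "h e = h e'"
  shows "cut e x = cut e' x"
proof -
  define y where "y = e + frac (x - e)"
  note y = representative_in_E[OF x e(1), folded y_def]
  have "e' < y"
  proof (rule ccontr)
    assume "\<not> e' < y"
    then have "y < e'" using y(1) e(2) by (cases "y = e'") auto
    then show False using E_not_in_plateau[OF y(1,2) _ e(4)] by blast
  qed
  then have "cut e' x = h y - h e'" using y e(3) by (intro cut_eqI) auto
  also have "h y - h e' = cut e x" by (simp add: cut_def y_def e(4))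
  finally show ?thesis by simp
qed

text \<open>Makes the choice of the base point immaterial, including its translates by
  integers.\<close>

lemma cut_same_gap:
  assumes x: "x \<in> E" and e: "e \<notin> E" "e' \<notin> E" "h e - h e' \<in> \<int>"
  shows "cut e x = cut e' x"
proof -
  obtain p where p: "h e - h e' = of_int p" using e(3) by (auto elim: Ints_cases)
  have e'': "e' + of_int p \<notin> E" "h (e' + of_int p) = h e"
    unfolding E_int h_int using e(2) p by (blast, linarith)
  have "cut e x = cut (e' + of_int p) x"
  proof (cases "e \<le> e' + of_int p")
    case True
    show ?thesis by (rule cut_same_gap_le[OF x e(1) e''(1) True e''(2)[symmetric]])
  next
    case False
    then have "e' + of_int p \<le> e" by simp
    from cut_same_gap_le[OF x e''(1) e(1) this e''(2)] show ?thesis by (rule sym)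
  qed
  then show ?thesis by (simp only: cut_translate)
qed

lemma cut_f:
  assumes x: "x \<in> E" and e: "e \<notin> E"
  shows "cut (f e) (f x) = cut e x"
proof -
  define y where "y = e + frac (x - e)"
  note y = representative_in_E[OF x e, folded y_def]
  obtain p where p: "y - x = of_int p" using y(4) by (auto elim: Ints_cases)
  then have "y = x + of_int p" by simp
  then have "f y - f x \<in> \<int>" by (simp add: f_int)
  moreover have "f e < f y" "f y < f e + 1"
    using strict_mono_less[OF strict_mono_f] y(2,3) f_1[of e] by (metis, metis)
  ultimately have "cut (f e) (f x) = h (f y) - h (f e)" by (intro cut_eqI) auto
  also have "\<dots> = cut e x" by (simp add: h_f cut_def y_def)
  finally show ?thesis .
qed

lemma cut_separates:
  assumes xy: "x \<in> E" "y \<in> E" "h x = h y" "x < y"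
  obtains e where "e \<notin> E" "h e = h x" "cut e x = 1" "cut e y = 0"
proof -
  \<comment> \<open>The midpoint lies inside a plateau, hence in a gap. Seen from it,
    \<open>y\<close> comes first, and \<open>x\<close> only after a full turn, as
    \<open>x + 1\<close>.\<close>
  define e where "e = (x + y) / 2"
  have e: "x < e" "e < y" using xy(4) by (auto simp: e_def)
  have "e \<notin> E" using E_not_in_plateau[OF _ e xy(3)] by blast
  have he: "h e = h x" using monoD[OF mono_h, of x e] monoD[OF mono_h, of e y] e xy(3) by simp
  have "y < x + 1"
  proof (rule ccontr)
    assume "\<not> y < x + 1"
    then have "h (x + 1) \<le> h y" by (intro monoD[OF mono_h]) simp
    then show False using xy(3) h_1[of x] by simp
  qed
  then have "cut e x = h (x + 1) - h e" "cut e y = h y - h e"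
    using e by (intro cut_eqI; simp)+
  then show ?thesis using that[OF \<open>e \<notin> E\<close> he] he xy(3) h_1[of x] by simp
qed

text \<open>The right end of the gap has value 0, and the left end, met again after a full turn, has
  value 1.\<close>

lemma cut_attains:
  assumes "e \<notin> E"
  shows "\<exists>x\<in>E. cut e x = 0" "\<exists>x\<in>E. cut e x = 1"
proof -
  obtain a b where ab: "a \<in> E" "b \<in> E" "a < e" "e < b" "\<And>y. a \<le> y \<Longrightarrow> y \<le> b \<Longrightarrow> h y = h e"
    using gapE[OF assms] by metis
  have "h a = h e" "h b = h e" using ab(3,4) by (intro ab(5); simp)+
  have "b < a + 1"
  proof (rule ccontr)
    assume "\<not> b < a + 1"
    then have "h (a + 1) \<le> h b" by (intro monoD[OF mono_h]) simp
    then show False using h_1[of a] \<open>h a = h e\<close> \<open>h b = h e\<close> by simp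
  qed
  then have "cut e b = h b - h e" "cut e a = h (a + 1) - h e"
    using ab(3,4) by (intro cut_eqI; simp)+
  then show "\<exists>x\<in>E. cut e x = 0" "\<exists>x\<in>E. cut e x = 1"
    using ab(1,2) \<open>h a = h e\<close> \<open>h b = h e\<close> h_1[of a] by (intro bexI[of _ b], simp_all, intro bexI[of _ a], simp_all)
qed

text \<open>Every gap contains a rational point with the same value of \<open>h\<close>.\<close>

lemma countable_h_gaps: "countable (h ` (- E))"
proof (rule countable_subset)
  show "h ` (- E) \<subseteq> h ` \<rat>"
  proof safe
    fix x assume "x \<notin> E"
    then obtain a b where ab: "a < x" "x < b" "\<And>y. a \<le> y \<Longrightarrow> y \<le> b \<Longrightarrow> h y = h x"
      using gapE by metis
    obtain q where "q \<in> \<rat>" "a < q" "q < b" using Rats_dense_in_real[of a b] ab by auto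
    moreover from this have "h x = h q" using ab(3)[of q] by simp
    ultimately show "h x \<in> h ` \<rat>" by (intro image_eqI)
  qed
  show "countable (h ` \<rat>)" by (intro countable_image countable_rat)
qed

end

section \<open>Denjoy systems\<close>

text \<open>The intersection of the closures of the forward tails of the orbit of \<open>z\<close>
  is nonempty, closed and invariant, so by minimality it is all of \<open>D\<close>. The tail
  starting at time 1 gives \<open>n > 0\<close>.\<close>

lemma minimal_set_recurrent:
  fixes F :: "circle \<Rightarrow> circle"
  assumes homeo: "homeomorphism UNIV UNIV F F'" and min: "minimal_set F D"
    and z: "z \<in> D" and w: "w \<in> D" and e: "e > 0"
  shows "\<exists>n>0. dist ((F ^^ n) z) w < e"
proof -
  have F: "continuous_on UNIV F" "continuous_on UNIV F'" "\<And>x. F' (F x) = x" "\<And>x. F (F' x) = x"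
    using homeo by (auto simp: homeomorphism_def)
  have D: "closed D" "F ` D = D"
    and Dmin: "\<And>N. N \<subseteq> D \<Longrightarrow> N \<noteq> {} \<Longrightarrow> closed N \<Longrightarrow> F ` N = N \<Longrightarrow> N = D"
    using min unfolding minimal_set_def by blast+
  define Orb where "Orb k = (\<lambda>n. (F ^^ n) z) ` {k..}" for k
  define N where "N = (\<Inter>k. closure (Orb k))"
  have FOrb: "F ` Orb k = Orb (Suc k)" for k
  proof -
    have "F ` Orb k = (\<lambda>n. (F ^^ n) z) ` (Suc ` {k..})" by (simp add: Orb_def image_image)
    also have "Suc ` {k..} = {Suc k..}" using image_add_atLeast[of 1 k] by simp
    finally show ?thesis by (simp add: Orb_def)
  qed
  have F'Orb: "F' ` Orb (Suc k) = Orb k" for k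
    unfolding FOrb[symmetric] image_image F(3) by simp
  have anti: "Orb (Suc k) \<subseteq> Orb k" for k unfolding Orb_def by (rule image_mono) auto
  have orb: "(F ^^ n) z \<in> D" for n by (induction n) (use z D(2) in auto)
  have ND: "N \<subseteq> D"
  proof -
    have "closure (Orb 0) \<subseteq> D" by (rule closure_minimal[OF _ D(1)]) (use orb in \<open>auto simp: Orb_def\<close>)
    then show ?thesis unfolding N_def by blast
  qed
  have "N \<noteq> {}"
  proof -
    obtain l r where l: "strict_mono r" "((\<lambda>n. (F ^^ n) z) \<circ> r) \<longlonglongrightarrow> l"
      using compact_UNIV_circle unfolding compact_def by (metis UNIV_I)
    have "l \<in> closure (Orb k)" for k
    proof (rule closed_sequentially[OF closed_closure])
      show "(\<lambda>n. (F ^^ (r (n + k))) z) \<longlonglongrightarrow> l"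
        using LIMSEQ_ignore_initial_segment[OF l(2), of k] by (simp add: o_def)
      show "(F ^^ (r (n + k))) z \<in> closure (Orb k)" for n
      proof (rule subsetD[OF closure_subset])
        have "n + k \<le> r (n + k)" by (rule seq_suble[OF l(1)])
        then show "(F ^^ (r (n + k))) z \<in> Orb k" unfolding Orb_def by (intro imageI) simp
      qed
    qed
    then show ?thesis unfolding N_def by blast
  qed
  moreover have "closed N" unfolding N_def by (intro closed_INT ballI closed_closure)
  moreover have "F ` N = N"
  proof -
    have 1: "F ` closure (Orb k) \<subseteq> closure (Orb k)" for k
      by (rule image_closure_subset[OF continuous_on_subset[OF F(1) subset_UNIV] closed_closure])
        (use FOrb[of k] anti[of k] closure_subset[of "Orb k"] in blast)
    have 2: "F' ` closure (Orb (Suc k)) \<subseteq> closure (Orb k)" for k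
      by (rule image_closure_subset[OF continuous_on_subset[OF F(2) subset_UNIV] closed_closure])
        (use F'Orb[of k] closure_subset[of "Orb k"] in blast)
    have "F x \<in> N" if "x \<in> N" for x using that 1 unfolding N_def by blast
    moreover have "F' x \<in> N" if "x \<in> N" for x using that 2 unfolding N_def by blast
    then have "x \<in> F ` N" if "x \<in> N" for x using that F(4)[of x] by (metis imageI)
    ultimately show ?thesis by blast
  qed
  ultimately have "N = D" using Dmin ND by blast
  then have "w \<in> closure (Orb 1)" using w unfolding N_def by blast
  then obtain y where y: "y \<in> Orb 1" "dist y w < e" using e unfolding closure_approachable by blast
  obtain n where "n \<ge> 1" "y = (F ^^ n) z" using y(1) unfolding Orb_def by blast
  then show ?thesis using y(2) by (intro exI[of _ n]) simp
qed

section \<open>Uniqueness and degree of lifts\<close>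

lemma is_lift_unique:
  assumes "is_lift f F" "is_lift g F"
  obtains k :: int where "\<And>x. g x = f x + of_int k"
proof -
  have "continuous_on UNIV (\<lambda>x. g x - f x)"
    using assms by (auto simp: is_lift_def intro!: continuous_intros)
  moreover have "g x - f x \<in> \<int>" for x
    using assms by (simp add: is_lift_def to_circle_eq_iff[symmetric])
  ultimately obtain k :: int where k: "\<And>x. g x - f x = of_int k" by (rule continuous_Ints_const) blast
  show ?thesis by (rule that[of k]) (use k in \<open>simp add: algebra_simps\<close>)
qed

lemma lift_translation:
  assumes "is_lift f F"
  obtains k :: int where "\<And>x. f (x + 1) = f x + of_int k"
proof -
  have "to_circle (x + 1) = to_circle x" for x by (simp add: to_circle_eq_iff)
  then have "is_lift (\<lambda>x. f (x + 1)) F"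
    using assms unfolding is_lift_def
    by (auto intro!: continuous_intros continuous_on_compose2[of UNIV f])
  from is_lift_unique[OF assms this] show ?thesis using that by blast
qed

text \<open>Monotonicity makes the degree positive. Degree at least 2 would let \<open>f\<close>
  reach \<open>f 0 + 1\<close> strictly before 1, giving two circle points with the same
  image.\<close>

lemma strict_mono_lift_translation:
  assumes f: "is_lift f F" "strict_mono f" and inj: "inj F"
  shows "f (x + 1) = f x + 1"
proof -
  obtain k :: int where k: "\<And>x. f (x + 1) = f x + of_int k" using lift_translation[OF f(1)] by blast
  have "of_int k > (0 :: real)" using strict_monoD[OF f(2), of 0 1] k[of 0] by simp
  then have "k \<ge> 1" by simp
  moreover have "\<not> k \<ge> 2"
  proof
    assume "k \<ge> 2"
    then have "f 0 + 1 < f 1" using k[of 0] by simp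
    moreover have "continuous_on {0..1} f"
      using f(1) by (auto simp: is_lift_def intro: continuous_on_subset)
    ultimately obtain y where y: "0 \<le> y" "y \<le> 1" "f y = f 0 + 1"
      using IVT'[of f 0 "f 0 + 1" 1] by auto
    then have "0 < y" "y < 1" using \<open>f 0 + 1 < f 1\<close> by (auto simp: less_le)
    have "to_circle (f y) = to_circle (f 0)" using y(3) by (simp add: to_circle_eq_iff)
    then have "to_circle y = to_circle 0" using f(1) inj by (auto simp: is_lift_def inj_def)
    then have "y \<in> \<int>" by (simp add: to_circle_eq_iff)
    then show False using \<open>0 < y\<close> \<open>y < 1\<close> by (auto elim!: Ints_cases)
  qed
  ultimately have "k = 1" by simp
  then show ?thesis using k by simp
qed

text \<open>A lift \<open>h\<close> of the semiconjugacy stays at bounded distance from \<open>d x\<close>, where \<open>d\<close> is its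
  degree. Comparing the growth rates of \<open>h (f\<^sup>n 0)\<close> and \<open>f\<^sup>n 0\<close> gives \<open>d r = r + k\<close>, so \<open>d = 1\<close>.\<close>

lemma semiconjugacy_degree:
  assumes h: "continuous_on UNIV h" and d: "\<And>x. h (x + 1) = h x + of_int d"
    and hf: "\<And>x. h (f x) = h x + r + of_int k"
    and rot: "(\<lambda>n. (f ^^ n) 0 / real n) \<longlonglongrightarrow> r" and r: "r \<notin> \<rat>"
  shows "d = 1 \<and> k = 0"
proof -
  define u where "u x = h x - of_int d * x" for x
  have u1: "u (x + 1) = u x" for x by (simp add: u_def d distrib_left)
  have u_int: "u (x + of_int p) = u x" for x p
  proof (induction p rule: int_induct[where k = 0])
    case (step1 i)
    then show ?case using u1[of "x + of_int i"] by (simp add: add.assoc)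
  next
    case (step2 i)
    then show ?case using u1[of "x + of_int (i - 1)"] by simp
  qed simp
  have "compact (u ` {0..1})"
    unfolding u_def by (intro compact_continuous_image continuous_intros continuous_on_subset[OF h]) auto
  then obtain B where B: "\<And>y. y \<in> u ` {0..1} \<Longrightarrow> norm y \<le> B"
    using compact_imp_bounded bounded_iff by metis
  have uB: "\<bar>u x\<bar> \<le> B" for x
  proof -
    have "u (frac x) = u x" using u_int[of x "- \<lfloor>x\<rfloor>"] by (simp add: frac_def)
    moreover have "u (frac x) \<in> u ` {0..1}"
      by (rule imageI) (use frac_ge_0[of x] frac_lt_1[of x] in auto)
    ultimately show ?thesis using B by fastforce
  qed
  have hn: "h ((f ^^ n) 0) = h 0 + real n * (r + of_int k)" for n
    by (induction n) (auto simp: hf algebra_simps)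
  let ?B = "\<lambda>n. (B + \<bar>h 0\<bar>) * inverse (real (Suc n))"
  have "(\<lambda>n. (r + of_int k) - of_int d * ((f ^^ Suc n) 0 / real (Suc n))) \<longlonglongrightarrow> 0"
  proof (rule Lim_null_comparison)
    show "?B \<longlonglongrightarrow> 0"
      using tendsto_mult[OF tendsto_const LIMSEQ_inverse_real_of_nat, of "B + \<bar>h 0\<bar>"] by simp
    show "\<forall>\<^sub>F n in sequentially. norm ((r + of_int k) - of_int d * ((f ^^ Suc n) 0 / real (Suc n))) \<le> ?B n"
    proof (rule always_eventually, rule allI)
      fix n
      let ?N = "real (Suc n)" and ?y = "(f ^^ Suc n) 0"
      have "(r + of_int k) - of_int d * (?y / ?N) = (u ?y - h 0) * inverse ?N"
        using hn[of "Suc n"] by (simp add: u_def field_simps del: funpow.simps of_nat_Suc)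
      also have "norm \<dots> = \<bar>u ?y - h 0\<bar> * inverse ?N" by (simp add: abs_mult)
      also have "\<dots> \<le> ?B n"
        using uB[of ?y] by (intro mult_right_mono) auto
      finally show "norm ((r + of_int k) - of_int d * (?y / ?N)) \<le> ?B n" .
    qed
  qed
  moreover have "(\<lambda>n. (r + of_int k) - of_int d * ((f ^^ Suc n) 0 / real (Suc n))) \<longlonglongrightarrow> (r + of_int k) - of_int d * r"
    by (intro tendsto_intros LIMSEQ_Suc[OF rot])
  ultimately have "(r + of_int k) - of_int d * r = 0" by (rule LIMSEQ_unique[rotated])
  then have eq: "of_int (d - 1) * r = of_int k" by (simp add: algebra_simps)
  then have "of_int (d - 1) * r \<in> \<int>" by simp
  from irrational_mult_Ints[OF r this] have "d = 1" by simp
  then show ?thesis using eq by simp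
qed

lemma denjoy_system_lift:
  assumes "denjoy_system \<alpha> A D F"
  obtains F' f h r H where
    "homeomorphism UNIV UNIV F F'" "minimal_set F D" "is_lift f F" "is_lift h H" "to_circle r = \<alpha>"
    "semiconjugacy_lift f h r {x. to_circle x \<in> D}"
    "continuous_on UNIV H" "\<And>x. H (F x) = H x + \<alpha>"
    "A = {a. \<exists>C\<in>components (- D). H ` closure C = {a}}"
proof -
  obtain F' f0 where F': "homeomorphism UNIV UNIV F F'" and f0: "is_lift f0 F" "strict_mono f0"
    using assms by (auto simp: denjoy_system_def denjoy_homeo_def orientation_preserving_homeo_def)
  obtain f r where f: "is_lift f F" and rot: "\<And>x. (\<lambda>n. (f ^^ n) x / real n) \<longlonglongrightarrow> r" and r\<alpha>: "to_circle r = \<alpha>"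
    using assms by (auto simp: denjoy_system_def denjoy_homeo_def has_rotation_number_def)
  have D: "minimal_set F D" and irr: "irrational \<alpha>"
    using assms by (auto simp: denjoy_system_def denjoy_homeo_def)
  obtain H where H: "continuous_on UNIV H" "H \<circ> F = rotation \<alpha> \<circ> H"
    "A = {a. \<exists>C\<in>components (- D). H ` closure C = {a}}"
    using assms by (auto simp: denjoy_system_def)
  have HF: "H (F x) = H x + \<alpha>" for x using fun_cong[OF H(2), of x] by (simp add: rotation_def)
  obtain h where h: "is_lift h H" using circle_map_lift_ex[OF H(1)] by blast
  have r: "r \<notin> \<rat>" using irr r\<alpha> irrational_rep by blast
  \<comment> \<open>The lift that witnesses the rotation number and the increasing lift may differ,
    but only by an integer constant.\<close>
  obtain k0 :: int where "\<And>x. f x = f0 x + of_int k0" using is_lift_unique[OF f0(1) f] by blast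
  then have mono: "strict_mono f" using f0(2) by (simp add: strict_mono_def)
  have inj: "inj F" using F' by (metis homeomorphism_def injI UNIV_I)
  have f1: "f (x + 1) = f x + 1" for x by (rule strict_mono_lift_translation[OF f mono inj])
  have lf: "to_circle (f x) = F (to_circle x)" "continuous_on UNIV f" for x
    using f by (auto simp: is_lift_def)
  have lh: "to_circle (h x) = H (to_circle x)" "continuous_on UNIV h" for x
    using h by (auto simp: is_lift_def)
  obtain d :: int where d: "\<And>x. h (x + 1) = h x + of_int d" using lift_translation[OF h] by blast
  have "continuous_on UNIV (\<lambda>x. h (f x) - h x - r)"
    by (intro continuous_intros lh continuous_on_compose2[OF lh(2) lf(2)]) auto
  moreover have "h (f x) - h x - r \<in> \<int>" for x
    by (simp add: to_circle_eq_0_iff[symmetric] to_circle_diff lh lf HF r\<alpha>)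
  ultimately obtain k :: int where k: "\<And>x. h (f x) - h x - r = of_int k" by (rule continuous_Ints_const) blast
  then have hf: "h (f x) = h x + r + of_int k" for x using k[of x] by linarith
  have dk: "d = 1 \<and> k = 0" by (rule semiconjugacy_degree[OF lh(2) d hf rot r])
  have D': "closed D" "F ` D = D" "D \<noteq> {}" using D by (auto simp: minimal_set_def)
  have fn: "to_circle ((f ^^ n) x) = (F ^^ n) (to_circle x)" for n x by (induction n) (auto simp: lf)
  let ?E = "{x. to_circle x \<in> D}"
  have "semiconjugacy_lift f h r ?E"
  proof
    show "closed ?E"
      using continuous_closed_vimage[OF D'(1), of to_circle] continuous_on_to_circle[of UNIV]
      by (simp add: vimage_def continuous_on_eq_continuous_at)
    show "?E \<noteq> {}" using D'(3) surj_to_circle by (metis (mono_tags) empty_iff mem_Collect_eq surjD ex_in_conv)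
    show "x + 1 \<in> ?E \<longleftrightarrow> x \<in> ?E" for x
      using to_circle_eq_iff[of "x + 1" x] by simp
    show "f x \<in> ?E \<longleftrightarrow> x \<in> ?E" for x
      using inj_image_mem_iff[OF inj, of "to_circle x" D] by (simp add: lf D'(2))
    show "\<exists>n>0. \<exists>p::int. \<bar>(f ^^ n) z + of_int p - w\<bar> < e" if zwe: "z \<in> ?E" "w \<in> ?E" "e > 0" for z w e
    proof -
      obtain n where n: "n > 0" "dist ((F ^^ n) (to_circle z)) (to_circle w) < e"
        using minimal_set_recurrent[OF F' D, of "to_circle z" "to_circle w" e] zwe by auto
      obtain y where y: "to_circle y = (F ^^ n) (to_circle z)" "\<bar>w - y\<bar> = dist (to_circle w) ((F ^^ n) (to_circle z))"
        by (rule dist_to_circleE)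
      have "to_circle y = to_circle ((f ^^ n) z)" by (simp add: y(1) fn)
      then obtain p where "y - (f ^^ n) z = of_int p" unfolding to_circle_eq_iff by (auto elim: Ints_cases)
      then have "\<bar>(f ^^ n) z + of_int p - w\<bar> = \<bar>w - y\<bar>" by linarith
      also have "\<dots> < e" using n(2) y(2) by (simp add: dist_commute)
      finally show ?thesis using n(1) by blast
    qed
  qed (use mono lf lh f1 d hf dk r rot in simp_all)
  then show ?thesis using that F' D f h r\<alpha> H HF by blast
qed

theorem denjoy_split_system:
  assumes den: "denjoy_system \<alpha> A D F"
  obtains r H c where "to_circle r = \<alpha>" "split_system D F r A H c"
proof -
  obtain F' f h r H where F': "homeomorphism UNIV UNIV F F'" and D: "minimal_set F D"
    and f: "is_lift f F" and h: "is_lift h H" and r\<alpha>: "to_circle r = \<alpha>"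
    and lift: "semiconjugacy_lift f h r {x. to_circle x \<in> D}"
    and H: "continuous_on UNIV H" and HF: "\<And>x. H (F x) = H x + \<alpha>"
    and A: "A = {a. \<exists>C\<in>components (- D). H ` closure C = {a}}"
    by (rule denjoy_system_lift[OF den]) blast
  interpret semiconjugacy_lift f h r "{x. to_circle x \<in> D}" by (rule lift)
  have lf: "to_circle (f x) = F (to_circle x)" for x using f by (auto simp: is_lift_def)
  have lh: "to_circle (h x) = H (to_circle x)" for x using h by (auto simp: is_lift_def)
  have D': "closed D" "F ` D = D" "D \<noteq> {}" using D by (auto simp: minimal_set_def)
  have inj: "inj F" using F' by (metis homeomorphism_def injI UNIV_I)
  have gaps: "H ` (- D) = to_circle ` h ` (- {x. to_circle x \<in> D})"
  proof -
    have "- D = to_circle ` (- {x. to_circle x \<in> D})"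
      using surj_to_circle by (auto simp: image_iff)
    then show ?thesis by (simp add: image_image lh)
  qed
  have A_eq: "A = H ` (- D)"
  proof
    show "A \<subseteq> H ` (- D)"
    proof
      fix t assume "t \<in> A"
      then obtain C where C: "C \<in> components (- D)" "H ` closure C = {t}" by (auto simp: A)
      obtain x where x: "x \<in> C" using in_components_nonempty[OF C(1)] by blast
      then have "H x = t" using C(2) closure_subset[of C] by blast
      then show "t \<in> H ` (- D)" using x in_components_subset[OF C(1)] by blast
    qed
    show "H ` (- D) \<subseteq> A"
    proof safe
      fix x assume x: "x \<notin> D"
      define C where "C = connected_component_set (- D) x"
      have C: "C \<in> components (- D)" "x \<in> C" using x by (auto simp: C_def components_def)
      \<comment> \<open>A connected countable image is a single point, so \<open>H\<close> collapses
        each component, and by continuity its closure.\<close>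
      have "countable (H ` (- D))" unfolding gaps by (intro countable_image countable_h_gaps)
      then have "countable (H ` C)"
        by (rule countable_subset[rotated]) (use in_components_subset[OF C(1)] in blast)
      moreover have "connected (H ` C)"
        by (intro connected_continuous_image continuous_on_subset[OF H] in_components_connected[OF C(1)]) auto
      ultimately have "H y = H x" if "y \<in> C" for y
        using connected_uncountable[of "H ` C" "H y" "H x"] that C(2) by blast
      then have "H ` closure C \<subseteq> {H x}"
        by (intro image_closure_subset continuous_on_subset[OF H]) auto
      then have "H ` closure C = {H x}" using C(2) closure_subset[of C] by blast
      then show "H x \<in> A" unfolding A using C(1) by blast
    qed
  qed
  \<comment> \<open>An arbitrary base point in a gap over \<open>t\<close>; \<open>cut_c\<close>
    shows that any other choice gives the same function on \<open>D\<close>.\<close>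
  define e where "e t = (SOME y. to_circle y \<notin> D \<and> to_circle (h y) = t)" for t
  have e: "to_circle (e t) \<notin> D" "to_circle (h (e t)) = t" if "t \<in> A" for t
  proof -
    have "\<exists>y. to_circle y \<notin> D \<and> to_circle (h y) = t" using that unfolding A_eq gaps by auto
    from someI_ex[OF this] show "to_circle (e t) \<notin> D" "to_circle (h (e t)) = t" by (auto simp: e_def)
  qed
  define c where "c t x = cut (e t) (coord x)" for t x
  have cut_c: "cut y x = c t (to_circle x)"
    if "t \<in> A" "to_circle y \<notin> D" "to_circle (h y) = t" "to_circle x \<in> D" for t x y
  proof -
    have "cut y x = cut (e t) x"
      by (rule cut_same_gap) (use that e[OF that(1)] in \<open>auto simp: to_circle_eq_iff[symmetric]\<close>)
    also have "\<dots> = cut (e t) (frac x)"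
    proof -
      have "frac (frac x - e t) = frac (x - e t)" by (rule frac_cong) (simp add: frac_def)
      then show ?thesis by (simp add: cut_def)
    qed
    finally show ?thesis by (simp add: c_def)
  qed
  have FA: "t + \<alpha> \<in> A \<longleftrightarrow> t \<in> A" for t
  proof
    assume "t \<in> A"
    then obtain x where x: "x \<notin> D" "t = H x" by (auto simp: A_eq)
    then have "F x \<notin> D" using inj_image_mem_iff[OF inj, of x D] D'(2) by simp
    then show "t + \<alpha> \<in> A" unfolding A_eq using x HF[of x] by (intro image_eqI[of _ _ "F x"]) auto
  next
    assume "t + \<alpha> \<in> A"
    then obtain y where y: "y \<notin> D" "t + \<alpha> = H y" by (auto simp: A_eq)
    obtain x where x: "y = F x" using F' by (metis homeomorphism_def UNIV_I)
    then have "x \<notin> D" using inj_image_mem_iff[OF inj, of x D] D'(2) y(1) by simp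
    moreover have "t = H x" using y(2) HF[of x] by (simp add: x)
    ultimately show "t \<in> A" unfolding A_eq by blast
  qed
  have "split_system D F r A H c"
  proof unfold_locales
    have "homeomorphism D D F F'"
      by (rule homeomorphism_of_subsets[OF F']) (simp_all add: D'(2))
    moreover have "compact D" using compact_Int_closed[OF compact_UNIV_circle D'(1)] by simp
    ultimately show "system D F" using D'(3) by (auto simp: system_def)
    show "r \<notin> \<rat>" by (rule r_irrational)
    show "continuous_on D H" by (rule continuous_on_subset[OF H]) simp
    show "H (F x) = H x + to_circle r" for x by (simp add: HF r\<alpha>)
    show "t + to_circle r \<in> A \<longleftrightarrow> t \<in> A" for t unfolding r\<alpha> by (rule FA)
    show "0 \<le> c t x" "c t x \<le> 1" for t x unfolding c_def by (rule cut_bounds)+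
    show "to_circle (c t x) = H x - t" if "t \<in> A" for t x
    proof -
      have "to_circle (c t x) = to_circle (h (coord x) - h (e t))"
        using cut_Ints[of "e t" "coord x"] by (simp add: to_circle_eq_iff c_def)
      then show ?thesis using e(2)[OF that] by (simp add: to_circle_diff lh)
    qed
    show "continuous_on D (c t)" if t: "t \<in> A" for t
    proof -
      let ?s = "to_circle (e t)"
      \<comment> \<open>In this form the only possible discontinuity is at \<open>x = ?s\<close>,
        which lies in a gap and not in \<open>D\<close>.\<close>
      have c: "c t x = h (e t + coord (x - ?s)) - h (e t)" for x
      proof -
        have "coord (x - ?s) = frac (coord x - e t)"
          using coord_to_circle[of "coord x - e t"] by (simp only: to_circle_diff to_circle_coord)
        then show ?thesis by (simp add: c_def cut_def)
      qed
      have "continuous_on (- {0}) coord"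
        by (simp add: continuous_on_eq_continuous_at continuous_at_coord open_Compl)
      then have "continuous_on D (\<lambda>x. coord (x - ?s))"
        by (rule continuous_on_compose2) (use e(1)[OF t] in \<open>auto intro!: continuous_intros\<close>)
      then have "continuous_on D (\<lambda>x. h (e t + coord (x - ?s)) - h (e t))"
        by (intro continuous_intros continuous_on_compose2[OF continuous_h]) auto
      then show ?thesis unfolding c .
    qed
    show "c (t + to_circle r) (F x) = c t x" if t: "t \<in> A" and x: "x \<in> D" for t x
    proof -
      \<comment> \<open>The point \<open>f (e t)\<close> need not be the base point chosen for
        \<open>t + \<alpha>\<close>, but \<open>cut_c\<close> accepts any base point over
        it.\<close>
      have "c (t + \<alpha>) (to_circle (f (coord x))) = cut (f (e t)) (f (coord x))"
      proof (rule cut_c[symmetric])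
        show "t + \<alpha> \<in> A" using FA t by blast
        show "to_circle (f (e t)) \<notin> D" using E_f[of "e t"] e(1)[OF t] by simp
        show "to_circle (h (f (e t))) = t + \<alpha>" using e(2)[OF t] by (simp add: h_f to_circle_add r\<alpha>)
        show "to_circle (f (coord x)) \<in> D" using E_f[of "coord x"] x by simp
      qed
      also have "\<dots> = c t x" unfolding c_def by (rule cut_f) (use x e(1)[OF t] in auto)
      finally show ?thesis by (simp add: lf r\<alpha>)
    qed
    show "\<exists>x\<in>D. c t x = 0" if t: "t \<in> A" for t
    proof -
      obtain x where "to_circle x \<in> D" "cut (e t) x = 0" using cut_attains(1)[of "e t"] e(1)[OF t] by auto
      then show ?thesis using cut_c[OF t e[OF t], of x] by (intro bexI[of _ "to_circle x"]) auto
    qed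
    show "\<exists>x\<in>D. c t x = 1" if t: "t \<in> A" for t
    proof -
      obtain x where "to_circle x \<in> D" "cut (e t) x = 1" using cut_attains(2)[of "e t"] e(1)[OF t] by auto
      then show ?thesis using cut_c[OF t e[OF t], of x] by (intro bexI[of _ "to_circle x"]) auto
    qed
    show "H x \<in> A \<and> c (H x) x \<noteq> c (H x) y" if xy: "x \<in> D" "y \<in> D" "H x = H y" "x \<noteq> y" for x y
    proof -
      have "h (coord x) - h (coord y) \<in> \<int>"
        using xy(3) by (simp add: to_circle_eq_iff[symmetric] lh)
      then obtain p where p: "h (coord x) - h (coord y) = of_int p" by (auto elim: Ints_cases)
      \<comment> \<open>The lift of \<open>y\<close> with exactly the same \<open>h\<close>-value as
        \<open>coord x\<close>, so that both lie on one plateau and \<open>cut_separates\<close>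
        applies.\<close>
      define y' where "y' = coord y + of_int p"
      have y': "to_circle y' = y" "h y' = h (coord x)"
        using p by (simp add: y'_def to_circle_add, simp add: y'_def h_int)
      have "coord x \<noteq> y'" using xy(4) y'(1) to_circle_coord by metis
      then obtain z where z: "to_circle z \<notin> D" "h z = h (coord x)" "cut z (coord x) \<noteq> cut z y'"
      proof (cases "coord x < y'")
        case True
        obtain z where "z \<notin> {x. to_circle x \<in> D}" "h z = h (coord x)" "cut z (coord x) = 1" "cut z y' = 0"
          by (rule cut_separates[of "coord x" y']) (use xy y' True in auto)
        then show ?thesis using that[of z] by simp
      next
        case False
        then have "y' < coord x" using \<open>coord x \<noteq> y'\<close> by simp
        obtain z where "z \<notin> {x. to_circle x \<in> D}" "h z = h y'" "cut z y' = 1" "cut z (coord x) = 0"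
          by (rule cut_separates[of y' "coord x"]) (use xy y' \<open>y' < coord x\<close> in auto)
        then show ?thesis using that[of z] y' by simp
      qed
      have t: "to_circle (h z) = H x" using z(2) by (simp add: lh)
      then have "H x \<in> A" unfolding A_eq gaps using z(1) by force
      then show ?thesis
        using cut_c[OF _ z(1) t, of "coord x"] cut_c[OF _ z(1) t, of y'] z(3) y'(1) xy(1,2) by simp
    qed
  qed
  then show ?thesis using that r\<alpha> by blast
qed

text \<open>Only the class of the angle modulo 1 enters. The real angle found for the factor need
  not be \<open>m\<close> times the one found for the extension, while \<open>split_pair\<close>
  requires one common number.\<close>

lemma split_system_angle_cong:
  assumes "split_system X S a A H c" "to_circle a = to_circle b" "b \<notin> \<rat>"
  shows "split_system X S b A H c"
  using assms by (simp add: split_system_def split_system_axioms_def)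

theorem denjoy_two_AI_factor:
  fixes \<alpha> :: circle and A A' Am :: "circle set" and m :: nat
  assumes "countable A" and "m > 0"
    and reps: "orbit_representatives UNIV (rotation \<alpha>) A A'"
    and Am: "Am = {zpow UNIV (rotation (scale_circle m \<alpha>)) k x | x k. x \<in> A'}"
    and D: "denjoy_system \<alpha> A D F" and D': "denjoy_system (scale_circle m \<alpha>) Am D' F'"
  shows "\<exists>\<pi>. two_AI_factor D (F ^^ m) D' F' \<pi>"
proof -
  obtain r H c where r: "to_circle r = \<alpha>" and split: "split_system D F r A H c"
    by (rule denjoy_split_system[OF D])
  obtain r' K d where r': "to_circle r' = scale_circle m \<alpha>" and split': "split_system D' F' r' Am K d"
    by (rule denjoy_split_system[OF D'])
  interpret base: split_system D F r A H c by (rule split)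
  have X: "split_system D (F ^^ m) (real m * r) A H c" by (rule base.split_system_funpow[OF assms(2)])
  have m\<alpha>: "scale_circle m \<alpha> = to_circle (real m * r)" using r scale_circle_to_circle by metis
  have Y: "split_system D' F' (real m * r) Am K d"
    by (rule split_system_angle_cong[OF split'])
      (use r' m\<alpha> X in \<open>simp_all add: split_system_def split_system_axioms_def\<close>)
  have Am': "Am = {x + to_circle (of_int k * (real m * r)) | x k. x \<in> A'}"
    unfolding Am m\<alpha> zpow_rotation ..
  have A'A: "A' \<subseteq> A" using reps by (simp add: orbit_representatives_def)
  have sub: "Am \<subseteq> A"
  proof
    fix t assume "t \<in> Am"
    then obtain x k where "x \<in> A'" "t = x + to_circle (of_int (k * int m) * r)"
      unfolding Am' by (auto simp: mult.assoc)
    then show "t \<in> A" using base.A_invariant_int[of x "k * int m"] A'A by blast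
  qed
  interpret split_pair D "F ^^ m" "real m * r" A H c D' F' Am K d
    using X Y sub by (auto simp: split_pair_def split_pair_axioms_def)
  have "two_AI_factor D (F ^^ m) D' F' factor"
  proof (rule two_AI_factor_factor[OF assms(1,2)])
    fix b assume "b \<in> A - Am"
    \<comment> \<open>The representative of the orbit of \<open>b\<close> under the original
      rotation lies in \<open>Am\<close> and differs from \<open>b\<close> by a multiple of
      \<open>r\<close>; multiplying by \<open>m\<close> gives a multiple of the new angle.\<close>
    then obtain s where s: "s \<in> A'" "s \<in> orbit UNIV (rotation \<alpha>) b"
      using reps unfolding orbit_representatives_def by blast
    then obtain k where k: "s = b + to_circle (of_int k * r)"
      unfolding orbit_def r[symmetric] zpow_rotation by auto
    have "s \<in> Am" unfolding Am'
      by (rule CollectI, rule exI[of _ s], rule exI[of _ 0]) (simp add: s(1) to_circle_0)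
    moreover have "b - s = to_circle (of_int (- k) * r)" by (simp add: k to_circle_minus)
    then have "scale_circle m (b - s) = to_circle (of_int (- k) * (real m * r))"
      by (simp only: scale_circle_to_circle mult.left_commute)
    ultimately show "\<exists>s\<in>Am. \<exists>k. scale_circle m (b - s) = to_circle (of_int k * (real m * r))" by blast
  qed
  then show ?thesis by blast
qed

theorem corollary5p21:
  fixes \<alpha> :: circle and A A' Am :: "circle set" and m :: nat
  assumes "irrational \<alpha>"
    and "countable A" and "rotation \<alpha> ` A = A" and "0 \<in> A"
    and "m > 0"
    and "orbit_representatives UNIV (rotation \<alpha>) A A'" and "0 \<in> A'"
    and "Am = {zpow UNIV (rotation (scale_circle m \<alpha>)) k x | x k. x \<in> A'}"
  shows "(\<forall>D F D' F'. denjoy_system \<alpha> A D F \<and> denjoy_system (scale_circle m \<alpha>) Am D' F' \<longrightarrow>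
            (\<exists>\<pi>. two_AI_factor D (F ^^ m) D' F' \<pi>))
       \<and> two_AI_equivalent (sturmian_space (scale_circle m \<alpha>), shift)
                           (sturmian_space \<alpha>, shift ^^ m)"
  using denjoy_two_AI_factor[OF assms(2,5,6,8)] sturmian_two_AI_equivalent[OF assms(1,5)] by blast

end
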